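(* Suppose $\overline u_l<\underline u_r$, or $\overline u_l=\underline u_r$ with $\mathcal{K}_0\ne\varnothing$. Let $u$ be the entropy solution of $u_t+f(u)_x=0$, $u|_{t=0}=\varphi$, with $\varphi\in L^\infty(\mathbb{R})$ satisfying $\varphi-\underline u_r\in L^p([0,\infty))$ and $\varphi-\overline u_l\in L^p((-\infty,0])$ for some $p\in[1,\infty)$, and let $w$ be the generalized $N$-wave. Then $u\equiv w$ on $\mathcal{K}$, and: (i) If there exists a (bounded) $\mathcal{H}_{(e_n,h_n)}$, then for any $q>0$, as $t\to\infty$, $$\|f'(u(\cdot,t))-f'(w(\cdot,t))\|_{L^q([e_n(t),h_n(t)])}\lessapprox\Big(\frac{h_n-e_n}{2}\Big)^{\frac1q}\varepsilon_{n,q}(t)\,t^{-1}.$$ Furthermore, if for some $\sigma_n>0$ and some constant $k>0$, $\int_{e_n}^x(\varphi-c_n)\,d\xi\ge k|x-e_n|^{1+\sigma_n}$ as $x\to e_n+$ and $\int_{h_n}^x(\varphi-c_n)\,d\xi\ge k|x-h_n|^{1+\sigma_n}$ as $x\to h_n-$, then, as $t\to\infty$, $$\|f'(u(\cdot,t))-f'(w(\cdot,t))\|_{L^q([e_n(t),h_n(t)])}\lesssim t^{-1-\frac{1}{\sigma_n(1+\alpha_n)}}.$$ (ii) If $x_0^+=\sup\mathcal{K}_0<\infty$, then for any forward generalized characteristic $x_+(t)$ in $\mathcal{H}_\infty$ and any $q>\frac{p}{p+1+\alpha_r}$, as $t\to\infty$, $$\|f'(u(\cdot,t))-f'(w(\cdot,t))\|_{L^q([x_0^+(t),x_+(t)])}\lesssim\varepsilon_r(t)\,t^{-1+\frac{p/q}{p+1+\alpha_r}}.$$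 Furthermore, if for some $\sigma_r>0$ and $k>0$, $\int_{x_0^+}^x(\varphi-\underline u_r)\,d\xi\ge k|x-x_0^+|^{1+\sigma_r}$ as $x\to x_0^++$, then for any such $q$, as $t\to\infty$, the left-hand side is $\lesssim t^{-1+\frac{p/q}{p+1+\alpha_r}-\frac{1/\sigma_r}{p+1+\alpha_r}}$. (iii) If $x_0^-=\inf\mathcal{K}_0>-\infty$, then for any forward generalized characteristic $x_-(t)$ in $\mathcal{H}_{-\infty}$ and any $q>\frac{p}{p+1+\alpha_l}$, as $t\to\infty$, $$\|f'(u(\cdot,t))-f'(w(\cdot,t))\|_{L^q([x_-(t),x_0^-(t)])}\lesssim\varepsilon_l(t)\,t^{-1+\frac{p/q}{p+1+\alpha_l}}.$$ Furthermore, if for some $\sigma_l>0$ and $k>0$, $\int_{x_0^-}^x(\varphi-\overline u_l)\,d\xi\ge k|x-x_0^-|^{1+\sigma_l}$ as $x\to x_0^--$, then for any such $q$, as $t\to\infty$, the left-hand side is $\lesssim t^{-1+\frac{p/q}{p+1+\alpha_l}-\frac{1/\sigma_l}{p+1+\alpha_l}}$. Here $\alpha_n,\alpha_r,\alpha_l\ge0$ are the exponents with $f''(u)=(N+o(1))|u-c|^{\alpha}$ as $u\to c$ ($N>0$ depending on $c$) at $c=c_n$, $c=\underline u_r$, $c=\overline u_l$, respectively.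
   Context: Setting: $f\in C^2(\mathbb{R})$, $f''\ge0$, $\mathcal{L}\{f''=0\}=0$, so $f'$ is strictly increasing. For $t>0$: $E(u;x,t)=t\int_0^u f''(s)(\varphi(x-tf'(s))-s)\,ds$; $\mathcal{U}(x,t)$ is the (nonempty compact) set of maximizers of $E(\cdot\,;x,t)$; the entropy solution is $u(x,t)=\inf\mathcal{U}(x,t)$, with $u(x-,t)=\sup\mathcal{U}(x,t)$, $u(x+,t)=\inf\mathcal{U}(x,t)$. $\Phi(x)=\int_0^x\varphi\,d\xi$; $\overline u_l=\limsup_{x\to-\infty}\Phi(x)/x$, $\underline u_r=\liminf_{x\to\infty}\Phi(x)/x$. $\bar\Phi(x)=\lim_{N\to\infty}\bar\Phi_N(x)\in[-\infty,\infty)$, where $\bar\Phi_N$ is the convex hull (largest convex minorant) of $\Phi|_{[-N,N]}$ on $[-N,N]$ and equals $\Phi$ for $|x|\ge N$. $\mathcal{K}_0=\{x_0:\Phi(x_0)=\bar\Phi(x_0)\}$. $L_c(x_0)=\{(x,t):x=x_0+tf'(c),\ t>0\}$ is a divide emitting from $x_0$ if $\mathcal{U}(x,t)=\{c\}$ on all of it; $\mathcal{K}$ is the union of all divides. $\mathbb{R}\setminus\mathcal{K}_0=\bigcup_n(e_n,h_n)$ (components); for bounded $(e_n,h_n)$: $c_n=\frac{\Phi(h_n)-\Phi(e_n)}{h_n-e_n}$, $e_n(t)=e_n+tf'(c_n)$, $h_n(t)=h_n+tf'(c_n)$, $\mathcal{H}_{(e_n,h_n)}=\{t>0,\ e_n(t)<x<h_n(t)\}$.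 If $x_0^+=\sup\mathcal{K}_0<\infty$: $x_0^+(t)=x_0^++tf'(\underline u_r)$, $\mathcal{H}_\infty=\{t>0,\ x>x_0^+(t)\}$. If $x_0^-=\inf\mathcal{K}_0>-\infty$: $x_0^-(t)=x_0^-+tf'(\overline u_l)$, $\mathcal{H}_{-\infty}=\{t>0,\ x<x_0^-(t)\}$. Forward generalized characteristics: for $t>0$, $\Delta_I(x,t)=\{(\xi,\tau):\xi=x+(\tau-t)f'(v),\ 0<\tau<t,\ v\in[u(x+,t),u(x-,t)]\}$; the forward generalized characteristic of $(x_0,t_0)$, $t_0>0$, is the unique curve $x(t)$, $t\ge t_0$, $x(t_0)=x_0$, with $\Delta_I(x_0,t_0)\subset\Delta_I(x(t_1),t_1)\subset\Delta_I(x(t_2),t_2)$ for $t_2>t_1>t_0$; one on $[0,\infty)$ is a continuous curve whose restriction to each $[t_0,\infty)$, $t_0>0$, is the forward generalized characteristic of $(x(t_0),t_0)$. Generalized $N$-wave $w$: (1) on $\mathcal{K}$, $w(x,t)=(f')^{-1}(\frac{x-x_0}{t})$ if $(x,t)$ lies on a divide emitting from $x_0$; (2) in $\mathcal{H}_{(e_n,h_n)}$ (bounded), for any chosen forward generalized characteristic $x_n(t)$, $t\ge0$, in $\mathcal{H}_{(e_n,h_n)}$: $w=(f')^{-1}(\frac{x-e_n}{t})$ if $e_n(t)<x<x_n(t)$ and $w=(f')^{-1}(\frac{x-h_n}{t})$ if $x_n(t)<x<h_n(t)$; (3) for any chosen forward generalized characteristic $x_+(t)$, $t\ge0$, in $\mathcal{H}_\infty$: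 $w=(f')^{-1}(\frac{x-x_0^+}{t})$ if $x_0^+(t)<x<x_+(t)$; (4) for any chosen $x_-(t)$, $t\ge0$, in $\mathcal{H}_{-\infty}$: $w=(f')^{-1}(\frac{x-x_0^-}{t})$ if $x_-(t)<x<x_0^-(t)$. For a forward generalized characteristic $x(t)$ put $y^\pm(t,0)=x(t)-tf'(u(x(t)\pm,t))$; write $y_n^\pm$, $y_r^\pm$, $y_l^\pm$ for $x(t)=x_n(t),x_+(t),x_-(t)$. Then $\varepsilon_n^-(t)=y_n^-(t,0)-e_n$, $\varepsilon_n^+(t)=h_n-y_n^+(t,0)$, $\varepsilon_{n,q}(t)=\big((\varepsilon_n^-(t))^q+(\varepsilon_n^+(t))^q\big)^{1/q}$, $\varepsilon_r(t)=y_r^-(t,0)-x_0^+$, $\varepsilon_l(t)=x_0^--y_l^+(t,0)$. Notation: $\|g\|_{L^q(A)}=(\int_A|g|^q)^{1/q}$ for $q>0$; $A\lesssim B$ means $A\le O(1)B$; $A\lessapprox B$ means $A\le(1+o(1))B$. *)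

theory Defs
  imports "HOL-Analysis.Analysis" "HOL-Library.Landau_Symbols"
begin

text \<open>
  Throughout, \<open>f\<close> is the flux and \<open>\<phi>\<close> the initial datum of the scalar conservation law
  \<open>u\<^sub>t + f(u)\<^sub>x = 0\<close>, with \<open>f' = deriv f\<close> and \<open>f'' = deriv (deriv f)\<close>.
  Since \<open>\<phi>\<close> is only Lebesgue measurable, all integrals are taken over \<open>lebesgue\<close>, not \<open>lborel\<close>;
  \<open>LINT s=a..b|lebesgue\<close> is the oriented integral (it changes sign if \<open>b < a\<close>).
\<close>

definition C2 :: "(real \<Rightarrow> real) \<Rightarrow> bool" where
  "C2 f \<longleftrightarrow> (\<forall>v. f field_differentiable at v) \<and> (\<forall>v. deriv f field_differentiable at v)
           \<and> continuous_on UNIV (deriv (deriv f))"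

definition flux :: "(real \<Rightarrow> real) \<Rightarrow> bool" where
  "flux f \<longleftrightarrow> C2 f \<and> (\<forall>v. 0 \<le> deriv (deriv f) v)
             \<and> {v. deriv (deriv f) v = 0} \<in> null_sets lebesgue"

definition flux_exponent :: "(real \<Rightarrow> real) \<Rightarrow> real \<Rightarrow> real \<Rightarrow> bool" where
  "flux_exponent f c \<alpha> \<longleftrightarrow> 0 \<le> \<alpha> \<and>
     (\<exists>N>0. ((\<lambda>v. deriv (deriv f) v / \<bar>v - c\<bar> powr \<alpha>) \<longlongrightarrow> N) (at c))"

definition in_Linf :: "(real \<Rightarrow> real) \<Rightarrow> bool" where
  "in_Linf g \<longleftrightarrow> g \<in> borel_measurable lebesgue \<and> (\<exists>M. AE x in lebesgue. \<bar>g x\<bar> \<le> M)"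

definition in_Lq :: "real \<Rightarrow> real set \<Rightarrow> (real \<Rightarrow> real) \<Rightarrow> bool" where
  "in_Lq q A g \<longleftrightarrow> set_borel_measurable lebesgue A g
                   \<and> set_integrable lebesgue A (\<lambda>x. \<bar>g x\<bar> powr q)"

text \<open>Meaningful as a norm only together with \<^const>\<open>in_Lq\<close>: the Bochner integral of a
  non-integrable function is \<open>0\<close>.\<close>

definition Lq_norm :: "real \<Rightarrow> real set \<Rightarrow> (real \<Rightarrow> real) \<Rightarrow> real" where
  "Lq_norm q A g = (LINT x:A|lebesgue. \<bar>g x\<bar> powr q) powr (1 / q)"

definition lessapprox :: "(real \<Rightarrow> real) \<Rightarrow> (real \<Rightarrow> real) \<Rightarrow> bool" where
  "lessapprox A B \<longleftrightarrow>
     (\<exists>\<delta>. (\<delta> \<longlongrightarrow> 0) at_top \<and> (\<forall>\<^sub>F t in at_top. A t \<le> (1 + \<delta> t) * B t))"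


definition E_fun :: "(real \<Rightarrow> real) \<Rightarrow> (real \<Rightarrow> real) \<Rightarrow> real \<Rightarrow> real \<Rightarrow> real \<Rightarrow> real" where
  "E_fun f \<phi> x t v =
     t * (LINT s=0..v|lebesgue. (deriv (deriv f) s * (\<phi> (x - t * deriv f s) - s)))"

definition maximizers :: "(real \<Rightarrow> real) \<Rightarrow> (real \<Rightarrow> real) \<Rightarrow> real \<Rightarrow> real \<Rightarrow> real set" where
  "maximizers f \<phi> x t = {v. \<forall>v'. E_fun f \<phi> x t v' \<le> E_fun f \<phi> x t v}"

definition entropy_solution :: "(real \<Rightarrow> real) \<Rightarrow> (real \<Rightarrow> real) \<Rightarrow> real \<Rightarrow> real \<Rightarrow> real" where
  "entropy_solution f \<phi> x t = Inf (maximizers f \<phi> x t)"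

text \<open>The one-sided traces \<open>u(x-,t)\<close> and \<open>u(x+,t)\<close>.\<close>

definition u_left :: "(real \<Rightarrow> real) \<Rightarrow> (real \<Rightarrow> real) \<Rightarrow> real \<Rightarrow> real \<Rightarrow> real" where
  "u_left f \<phi> x t = Sup (maximizers f \<phi> x t)"

definition u_right :: "(real \<Rightarrow> real) \<Rightarrow> (real \<Rightarrow> real) \<Rightarrow> real \<Rightarrow> real \<Rightarrow> real" where
  "u_right f \<phi> x t = Inf (maximizers f \<phi> x t)"


definition Phi :: "(real \<Rightarrow> real) \<Rightarrow> real \<Rightarrow> real" where
  "Phi \<phi> x = (LINT \<xi>=0..x|lebesgue. (\<phi> \<xi>))"

text \<open>For \<open>\<phi> \<in> L\<^sup>\<infinity>\<close> the quotient \<open>\<Phi>(x)/x\<close> is bounded, so the two limits below are finite.\<close>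

definition ul_bar :: "(real \<Rightarrow> real) \<Rightarrow> real" where
  "ul_bar \<phi> = real_of_ereal (Limsup at_bot (\<lambda>x. ereal (Phi \<phi> x / x)))"

definition ur_bar :: "(real \<Rightarrow> real) \<Rightarrow> real" where
  "ur_bar \<phi> = real_of_ereal (Liminf at_top (\<lambda>x. ereal (Phi \<phi> x / x)))"

definition Phi_hull_on :: "(real \<Rightarrow> real) \<Rightarrow> real \<Rightarrow> real \<Rightarrow> real" where
  "Phi_hull_on \<phi> N x =
     (if \<bar>x\<bar> < N
      then Sup {g x |g. convex_on {-N..N} g \<and> (\<forall>y\<in>{-N..N}. g y \<le> Phi \<phi> y)}
      else Phi \<phi> x)"

definition Phi_hull :: "(real \<Rightarrow> real) \<Rightarrow> real \<Rightarrow> ereal" where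
  "Phi_hull \<phi> x = Lim at_top (\<lambda>N. ereal (Phi_hull_on \<phi> N x))"

definition K0 :: "(real \<Rightarrow> real) \<Rightarrow> real set" where
  "K0 \<phi> = {x. ereal (Phi \<phi> x) = Phi_hull \<phi> x}"


definition char_line :: "(real \<Rightarrow> real) \<Rightarrow> real \<Rightarrow> real \<Rightarrow> (real \<times> real) set" where
  "char_line f c x0 = {(x, t). x = x0 + t * deriv f c \<and> 0 < t}"

definition is_divide :: "(real \<Rightarrow> real) \<Rightarrow> (real \<Rightarrow> real) \<Rightarrow> real \<Rightarrow> real \<Rightarrow> bool" where
  "is_divide f \<phi> c x0 \<longleftrightarrow> (\<forall>(x, t) \<in> char_line f c x0. maximizers f \<phi> x t = {c})"

definition divides :: "(real \<Rightarrow> real) \<Rightarrow> (real \<Rightarrow> real) \<Rightarrow> (real \<times> real) set" where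
  "divides f \<phi> = \<Union>{char_line f c x0 |c x0. is_divide f \<phi> c x0}"


text \<open>\<open>gap \<phi> e h\<close>: \<open>(e,h)\<close> is one of the bounded intervals \<open>(e\<^sub>n,h\<^sub>n)\<close>.\<close>

definition gap :: "(real \<Rightarrow> real) \<Rightarrow> real \<Rightarrow> real \<Rightarrow> bool" where
  "gap \<phi> e h \<longleftrightarrow> e < h \<and> {e<..<h} \<in> components (- K0 \<phi>)"

definition gap_c :: "(real \<Rightarrow> real) \<Rightarrow> real \<Rightarrow> real \<Rightarrow> real" where
  "gap_c \<phi> e h = (Phi \<phi> h - Phi \<phi> e) / (h - e)"

definition e_line :: "(real \<Rightarrow> real) \<Rightarrow> (real \<Rightarrow> real) \<Rightarrow> real \<Rightarrow> real \<Rightarrow> real \<Rightarrow> real" where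
  "e_line f \<phi> e h t = e + t * deriv f (gap_c \<phi> e h)"

definition h_line :: "(real \<Rightarrow> real) \<Rightarrow> (real \<Rightarrow> real) \<Rightarrow> real \<Rightarrow> real \<Rightarrow> real \<Rightarrow> real" where
  "h_line f \<phi> e h t = h + t * deriv f (gap_c \<phi> e h)"

text \<open>The points \<open>x\<^sub>0\<^sup>+ = sup K\<^sub>0\<close> and \<open>x\<^sub>0\<^sup>- = inf K\<^sub>0\<close>; used only when \<open>K\<^sub>0\<close> is bounded on the
  respective side.\<close>

definition x0_plus :: "(real \<Rightarrow> real) \<Rightarrow> real" where
  "x0_plus \<phi> = Sup (K0 \<phi>)"

definition x0_minus :: "(real \<Rightarrow> real) \<Rightarrow> real" where
  "x0_minus \<phi> = Inf (K0 \<phi>)"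

definition x0_plus_line :: "(real \<Rightarrow> real) \<Rightarrow> (real \<Rightarrow> real) \<Rightarrow> real \<Rightarrow> real" where
  "x0_plus_line f \<phi> t = x0_plus \<phi> + t * deriv f (ur_bar \<phi>)"

definition x0_minus_line :: "(real \<Rightarrow> real) \<Rightarrow> (real \<Rightarrow> real) \<Rightarrow> real \<Rightarrow> real" where
  "x0_minus_line f \<phi> t = x0_minus \<phi> + t * deriv f (ul_bar \<phi>)"

definition H_gap :: "(real \<Rightarrow> real) \<Rightarrow> (real \<Rightarrow> real) \<Rightarrow> real \<Rightarrow> real \<Rightarrow> (real \<times> real) set" where
  "H_gap f \<phi> e h = {(x, t). 0 < t \<and> e_line f \<phi> e h t < x \<and> x < h_line f \<phi> e h t}"

definition H_right :: "(real \<Rightarrow> real) \<Rightarrow> (real \<Rightarrow> real) \<Rightarrow> (real \<times> real) set" where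
  "H_right f \<phi> = {(x, t). 0 < t \<and> x0_plus_line f \<phi> t < x}"

definition H_left :: "(real \<Rightarrow> real) \<Rightarrow> (real \<Rightarrow> real) \<Rightarrow> (real \<times> real) set" where
  "H_left f \<phi> = {(x, t). 0 < t \<and> x < x0_minus_line f \<phi> t}"


definition Delta_I :: "(real \<Rightarrow> real) \<Rightarrow> (real \<Rightarrow> real) \<Rightarrow> real \<Rightarrow> real \<Rightarrow> (real \<times> real) set" where
  "Delta_I f \<phi> x t =
     {(\<xi>, \<tau>). 0 < \<tau> \<and> \<tau> < t \<and>
        (\<exists>v \<in> {u_right f \<phi> x t..u_left f \<phi> x t}. \<xi> = x + (\<tau> - t) * deriv f v)}"

text \<open>Only the values of \<open>X\<close> on \<open>[t0, \<infinity>)\<close> matter.\<close>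

definition fwd_char_from ::
    "(real \<Rightarrow> real) \<Rightarrow> (real \<Rightarrow> real) \<Rightarrow> real \<Rightarrow> real \<Rightarrow> (real \<Rightarrow> real) \<Rightarrow> bool" where
  "fwd_char_from f \<phi> x0 t0 X \<longleftrightarrow> X t0 = x0 \<and>
     (\<forall>t1 t2. t0 < t1 \<and> t1 < t2 \<longrightarrow>
        Delta_I f \<phi> x0 t0 \<subseteq> Delta_I f \<phi> (X t1) t1 \<and>
        Delta_I f \<phi> (X t1) t1 \<subseteq> Delta_I f \<phi> (X t2) t2)"

definition fwd_char :: "(real \<Rightarrow> real) \<Rightarrow> (real \<Rightarrow> real) \<Rightarrow> (real \<Rightarrow> real) \<Rightarrow> bool" where
  "fwd_char f \<phi> X \<longleftrightarrow>
     continuous_on {0..} X \<and> (\<forall>t0>0. fwd_char_from f \<phi> (X t0) t0 X)"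

definition fwd_char_in ::
    "(real \<Rightarrow> real) \<Rightarrow> (real \<Rightarrow> real) \<Rightarrow> (real \<times> real) set \<Rightarrow> (real \<Rightarrow> real) \<Rightarrow> bool" where
  "fwd_char_in f \<phi> H X \<longleftrightarrow> fwd_char f \<phi> X \<and> (\<forall>t>0. (X t, t) \<in> H)"

text \<open>\<open>w\<close> is the generalized N-wave belonging to the chosen forward generalized
  characteristics \<open>X e h\<close> (one for each bounded gap \<open>(e,h)\<close>), \<open>Xr\<close> and \<open>Xl\<close> (the latter two
  only if the corresponding unbounded region exists). The values of \<open>w\<close> on these curves and
  beyond \<open>Xr\<close>, \<open>Xl\<close> are left open. If \<open>f'\<close> is not onto, \<open>inv f'\<close> may be applied outside the range
  of \<open>f'\<close> for small \<open>t\<close>; this is irrelevant for the behaviour as \<open>t \<rightarrow> \<infinity>\<close>.\<close>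

definition generalized_N_wave ::
    "(real \<Rightarrow> real) \<Rightarrow> (real \<Rightarrow> real) \<Rightarrow> (real \<Rightarrow> real \<Rightarrow> real \<Rightarrow> real)
     \<Rightarrow> (real \<Rightarrow> real) \<Rightarrow> (real \<Rightarrow> real) \<Rightarrow> (real \<Rightarrow> real \<Rightarrow> real) \<Rightarrow> bool" where
  "generalized_N_wave f \<phi> X Xr Xl w \<longleftrightarrow>
     (\<forall>c x0 x t. is_divide f \<phi> c x0 \<and> (x, t) \<in> char_line f c x0 \<longrightarrow>
        w x t = inv (deriv f) ((x - x0) / t)) \<and>
     (\<forall>e h. gap \<phi> e h \<longrightarrow>
        fwd_char_in f \<phi> (H_gap f \<phi> e h) (X e h) \<and>
        (\<forall>t>0. \<forall>x.
           (e_line f \<phi> e h t < x \<and> x < X e h t \<longrightarrow> w x t = inv (deriv f) ((x - e) / t)) \<and>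
           (X e h t < x \<and> x < h_line f \<phi> e h t \<longrightarrow> w x t = inv (deriv f) ((x - h) / t)))) \<and>
     (bdd_above (K0 \<phi>) \<longrightarrow>
        fwd_char_in f \<phi> (H_right f \<phi>) Xr \<and>
        (\<forall>t>0. \<forall>x. x0_plus_line f \<phi> t < x \<and> x < Xr t \<longrightarrow>
           w x t = inv (deriv f) ((x - x0_plus \<phi>) / t))) \<and>
     (bdd_below (K0 \<phi>) \<longrightarrow>
        fwd_char_in f \<phi> (H_left f \<phi>) Xl \<and>
        (\<forall>t>0. \<forall>x. Xl t < x \<and> x < x0_minus_line f \<phi> t \<longrightarrow>
           w x t = inv (deriv f) ((x - x0_minus \<phi>) / t)))"


definition y_left :: "(real \<Rightarrow> real) \<Rightarrow> (real \<Rightarrow> real) \<Rightarrow> (real \<Rightarrow> real) \<Rightarrow> real \<Rightarrow> real" where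
  "y_left f \<phi> X t = X t - t * deriv f (u_left f \<phi> (X t) t)"

definition y_right :: "(real \<Rightarrow> real) \<Rightarrow> (real \<Rightarrow> real) \<Rightarrow> (real \<Rightarrow> real) \<Rightarrow> real \<Rightarrow> real" where
  "y_right f \<phi> X t = X t - t * deriv f (u_right f \<phi> (X t) t)"

definition eps_gap ::
    "(real \<Rightarrow> real) \<Rightarrow> (real \<Rightarrow> real) \<Rightarrow> real \<Rightarrow> real \<Rightarrow> (real \<Rightarrow> real) \<Rightarrow> real \<Rightarrow> real \<Rightarrow> real" where
  "eps_gap f \<phi> e h X q t =
     ((y_left f \<phi> X t - e) powr q + (h - y_right f \<phi> X t) powr q) powr (1 / q)"

definition eps_r :: "(real \<Rightarrow> real) \<Rightarrow> (real \<Rightarrow> real) \<Rightarrow> (real \<Rightarrow> real) \<Rightarrow> real \<Rightarrow> real" where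
  "eps_r f \<phi> X t = y_left f \<phi> X t - x0_plus \<phi>"

definition eps_l :: "(real \<Rightarrow> real) \<Rightarrow> (real \<Rightarrow> real) \<Rightarrow> (real \<Rightarrow> real) \<Rightarrow> real \<Rightarrow> real" where
  "eps_l f \<phi> X t = x0_minus \<phi> - y_right f \<phi> X t"

definition speed_diff ::
    "(real \<Rightarrow> real) \<Rightarrow> (real \<Rightarrow> real) \<Rightarrow> (real \<Rightarrow> real \<Rightarrow> real) \<Rightarrow> real \<Rightarrow> real \<Rightarrow> real" where
  "speed_diff f \<phi> w t x = deriv f (entropy_solution f \<phi> x t) - deriv f (w x t)"

end

theory Submission
  imports Defs
begin

text \<open>
  Substituting \<open>y = x - t f'(s)\<close> turns the maximization of \<open>E\<close> into the Lax--Oleinik minimization of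
  \<open>\<Phi>(x - t f'(v)) + t (v f'(v) - f(v))\<close>. If the line of slope \<open>c\<close> through \<open>(e, \<Phi>(e))\<close> supports \<open>\<Phi>\<close>,
  this cost is, up to a constant, the excess of \<open>\<Phi>\<close> over the line at the foot \<open>y = x - t f'(v)\<close> plus
  \<open>t\<close> times the Bregman distance \<open>D(v) = (v - c) f'(v) - f(v) + f(c)\<close>. Both terms are nonnegative, so
  comparing a minimizer with the competitor whose foot is \<open>e\<close> bounds the excess at the foot, and
  comparing it with \<open>v = c\<close> bounds the distance of a forward characteristic from the divide
  \<open>x = e + t f'(c)\<close>. Along a forward generalized characteristic the feet are monotone, hence converge
  to zeros of the excess, i.e. to the end points of the gap; on a bounded gap the equality of the costs
  of the two extremal minimizers forces the characteristic towards the middle of the strip.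
  Everything on the left of a divide follows by the reflection \<open>f(-v)\<close>, \<open>\<Phi>(-y)\<close>.
\<close>

subsection \<open>Primitives of bounded data\<close>

text \<open>If \<open>y\<close> is the foot of the minimizer \<open>u\<close>, then
  \<open>f' u = (x - y) / t\<close>, while \<open>f' w = (x - e) / t\<close> in the fan centred at
  \<open>e\<close>. So the quantity to be estimated is exactly \<open>(e - y) / t\<close>. Feet are
  monotone in \<open>x\<close>, hence between divide and characteristic it is at most
  \<open>\<epsilon> / t\<close> in modulus, and each norm is this bound times a width to the power
  \<open>1 / q\<close>. It remains to control the width and \<open>\<epsilon>\<close>. In a bounded
  gap the sharp constant requires both widths to tend to \<open>(h - e) / 2\<close>. In an unbounded
  region the width \<open>L\<close> results from balancing the Bregman term
  \<open>t (L / t)^\<beta>\<close>, \<open>\<beta> = 1 + 1 / (1 + \<alpha>)\<close>, against the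
  growth \<open>L^(1 - 1 / p)\<close> of the primitive of L^p data, which gives the order
  \<open>t^(p / (p + 1 + \<alpha>))\<close>. The rate of \<open>\<epsilon>\<close> comes from
  \<open>k \<epsilon>^(1 + \<sigma>) \<le> C s^(1 / (1 + \<alpha>)) \<epsilon>\<close> with
  \<open>s\<close> the width divided by \<open>t\<close>, after one factor \<open>\<epsilon>\<close>
  is cancelled. Since \<open>f'\<close> may fail to be onto, every state with a prescribed speed is
  found between two attained speeds.\<close>

lemma interval_LINT_eq_integral:
  fixes a b :: real and g :: "real \<Rightarrow> real"
  assumes "g absolutely_integrable_on {a..b}" "a \<le> b"
  shows "(LINT x=ereal a..ereal b|lebesgue. g x) = integral {a..b} g"
proof -
  have "g absolutely_integrable_on {a<..<b}"
    using assms(1) by (rule set_integrable_subset) auto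
  then have "(LINT x:{a<..<b}|lebesgue. g x) = integral {a<..<b} g"
    by (rule set_lebesgue_integral_eq_integral)
  then show ?thesis
    using assms(2) by (simp add: interval_lebesgue_integral_def integral_open_interval_real)
qed

lemma interval_LINT_eq_neg_integral:
  fixes a b :: real and g :: "real \<Rightarrow> real"
  assumes "g absolutely_integrable_on {a..b}" "a \<le> b"
  shows "(LINT x=ereal b..ereal a|lebesgue. g x) = - integral {a..b} g"
proof (cases "a = b")
  case False
  then show ?thesis
    using interval_LINT_eq_integral[OF assms] assms(2) by (simp add: interval_lebesgue_integral_def)
qed (simp add: interval_lebesgue_integral_def set_lebesgue_integral_def)

lemma in_Linf_absolutely_integrable:
  assumes "in_Linf \<phi>"
  shows "\<phi> absolutely_integrable_on {a..b}"
proof -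
  obtain M where M: "AE x in lebesgue. \<bar>\<phi> x\<bar> \<le> M" and meas: "\<phi> \<in> borel_measurable lebesgue"
    using assms by (auto simp: in_Linf_def)
  show ?thesis
    unfolding set_integrable_def
    by (rule integrableI_bounded_set_indicator[where B = M])
       (use M meas in \<open>auto simp: emeasure_lborel_Icc_eq\<close>)
qed

lemma in_Linf_integral_bound:
  assumes "in_Linf \<phi>"
  obtains M where "0 \<le> M" "\<And>a b. a \<le> b \<Longrightarrow> \<bar>integral {a..b} \<phi>\<bar> \<le> M * (b - a)"
proof -
  obtain M where M: "AE x in lebesgue. \<bar>\<phi> x\<bar> \<le> M"
    using assms by (auto simp: in_Linf_def)
  \<comment> \<open>\<open>max M 0\<close> makes the bound nonnegative without arguing that an
    essential bound on the line must be.\<close>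
  have "\<bar>integral {a..b} \<phi>\<bar> \<le> max M 0 * (b - a)" if "a \<le> b" for a b
  proof -
    note int = in_Linf_absolutely_integrable[OF assms, of a b]
    have "\<bar>integral {a..b} \<phi>\<bar> = norm (LINT x:{a..b}|lebesgue. \<phi> x)"
      using set_lebesgue_integral_eq_integral(2)[OF int] by simp
    also have "\<dots> \<le> (LINT x:{a..b}|lebesgue. norm (\<phi> x))"
      by (rule set_integral_norm_bound[OF int])
    also have "\<dots> \<le> (LINT x:{a..b}|lebesgue. max M 0)"
      by (rule set_integral_mono_AE) (use M int in \<open>auto simp flip: real_norm_def intro: set_integrable_norm\<close>)
    also have "\<dots> = integral {a..b} (\<lambda>x. max M 0)"
      by (rule set_lebesgue_integral_eq_integral) auto
    also have "\<dots> = max M 0 * (b - a)"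
      using that by simp
    finally show ?thesis .
  qed
  then show ?thesis
    using that[of "max M 0"] by simp
qed

lemma Phi_diff:
  assumes "in_Linf \<phi>" "a \<le> b"
  shows "Phi \<phi> b - Phi \<phi> a = integral {a..b} \<phi>"
proof -
  note int = in_Linf_absolutely_integrable[OF assms(1)]
  have pos: "Phi \<phi> x = integral {0..x} \<phi>" if "0 \<le> x" for x
    using interval_LINT_eq_integral[OF int that] by (simp add: Phi_def zero_ereal_def)
  have neg: "Phi \<phi> x = - integral {x..0} \<phi>" if "x \<le> 0" for x
    using interval_LINT_eq_neg_integral[OF int that] by (simp add: Phi_def zero_ereal_def)
  have int': "\<phi> integrable_on {a..b}" for a b
    using set_lebesgue_integral_eq_integral(1)[OF int] .
  consider "0 \<le> a" | "a \<le> 0" "0 \<le> b" | "b \<le> 0"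
    by linarith
  then show ?thesis
  proof cases
    case 1
    then show ?thesis
      using Henstock_Kurzweil_Integration.integral_combine[OF 1 assms(2) int'] assms(2) 1 pos[of a] pos[of b] by simp
  next
    case 2
    then show ?thesis
      using Henstock_Kurzweil_Integration.integral_combine[OF 2 int'] 2 neg[of a] pos[of b] by simp
  next
    case 3
    then show ?thesis
      using Henstock_Kurzweil_Integration.integral_combine[OF assms(2) 3 int'] assms(2) 3 neg[of a] neg[of b] by simp
  qed
qed

lemma Phi_lipschitz:
  assumes "in_Linf \<phi>"
  obtains M where "M-lipschitz_on UNIV (Phi \<phi>)"
proof -
  obtain M where "0 \<le> M" and M: "\<And>a b. a \<le> b \<Longrightarrow> \<bar>integral {a..b} \<phi>\<bar> \<le> M * (b - a)"
    using in_Linf_integral_bound[OF assms] by blast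
  have "\<bar>Phi \<phi> b - Phi \<phi> a\<bar> \<le> M * \<bar>b - a\<bar>" if "a \<le> b" for a b
    using Phi_diff[OF assms that] M[OF that] that by simp
  then have "\<bar>Phi \<phi> b - Phi \<phi> a\<bar> \<le> M * \<bar>b - a\<bar>" for a b
    by (metis abs_minus_commute linear)
  then show ?thesis
    using that[of M] \<open>0 \<le> M\<close> by (simp add: lipschitz_on_def dist_real_def)
qed

text \<open>The decay hypotheses of the theorem are written with this oriented integral; the
  right-hand side is the excess of the primitive over the line of slope \<open>c\<close> through its
  value at \<open>a\<close>, on either side of \<open>a\<close>.\<close>

lemma interval_LINT_Phi:
  assumes "in_Linf \<phi>"
  shows "(LINT \<xi>=ereal a..ereal x|lebesgue. (\<phi> \<xi> - c)) = Phi \<phi> x - Phi \<phi> a - c * (x - a)"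
proof -
  note int = in_Linf_absolutely_integrable[OF assms]
  have int': "(\<lambda>\<xi>. \<phi> \<xi> - c) absolutely_integrable_on {a..b}" for a b
    by (intro set_integral_diff int) auto
  have *: "integral {a..b} (\<lambda>\<xi>. \<phi> \<xi> - c) = Phi \<phi> b - Phi \<phi> a - c * (b - a)" if "a \<le> b" for a b
    using Phi_diff[OF assms that] that
      Henstock_Kurzweil_Integration.integral_diff[OF set_lebesgue_integral_eq_integral(1)[OF int[of a b]], of "\<lambda>_. c"]
    by (simp add: mult.commute integrable_on_const)
  show ?thesis
  proof (cases "a \<le> x")
    case True
    then show ?thesis
      using interval_LINT_eq_integral[OF int' True] *[OF True] by simp
  next
    case False
    then have "x \<le> a" by simp
    then show ?thesis
      using interval_LINT_eq_neg_integral[OF int' \<open>x \<le> a\<close>] *[OF \<open>x \<le> a\<close>] by (simp add: algebra_simps)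
  qed
qed

text \<open>A Hoelder estimate obtained by splitting the values of \<open>g\<close> at a level
  \<open>l\<close>: below it the bound is \<open>l\<close>, above it \<open>l powr (1 - p)\<close>
  times the p-th power. The choice \<open>l = (b - a) powr (- 1 / p)\<close> gives both
  contributions the order \<open>(b - a) powr (1 - 1 / p)\<close>, which explains the
  constant.\<close>

lemma Lp_integral_growth:
  fixes g :: "real \<Rightarrow> real"
  assumes p: "1 \<le> p" and gp: "set_integrable lebesgue S (\<lambda>x. \<bar>g x\<bar> powr p)"
    and g: "g absolutely_integrable_on {a..b}" and ab: "a < b" "{a..b} \<subseteq> S"
  shows "\<bar>integral {a..b} g\<bar> \<le> (1 + (LINT x:S|lebesgue. \<bar>g x\<bar> powr p)) * (b - a) powr (1 - 1 / p)"
proof -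
  define A where "A = (LINT x:S|lebesgue. \<bar>g x\<bar> powr p)"
  define l where "l = (b - a) powr (- 1 / p)"
  have l: "0 < l" using ab by (simp add: l_def)
  have gp': "set_integrable lebesgue {a..b} (\<lambda>x. \<bar>g x\<bar> powr p)"
    using gp by (rule set_integrable_subset) (use ab in auto)
  have gp_le: "(LINT x:{a..b}|lebesgue. \<bar>g x\<bar> powr p) \<le> A"
    unfolding A_def set_lebesgue_integral_def
    by (rule integral_mono)
       (use gp gp' ab in \<open>auto simp: set_integrable_def indicator_def split: if_splits\<close>)
  have pw: "\<bar>y\<bar> \<le> l + l powr (1 - p) * \<bar>y\<bar> powr p" for y :: real
  proof (cases "\<bar>y\<bar> \<le> l")
    case True
    then show ?thesis by (smt (verit) powr_ge_zero mult_nonneg_nonneg)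
  next
    case False
    then have "\<bar>y\<bar> = \<bar>y\<bar> powr (1 - p) * \<bar>y\<bar> powr p"
      using l by (simp flip: powr_add)
    also have "\<dots> \<le> l powr (1 - p) * \<bar>y\<bar> powr p"
      using p l False by (intro mult_right_mono powr_mono2') auto
    finally show ?thesis using l by simp
  qed
  have "\<bar>integral {a..b} g\<bar> = norm (LINT x:{a..b}|lebesgue. g x)"
    using set_lebesgue_integral_eq_integral(2)[OF g] by simp
  also have "\<dots> \<le> (LINT x:{a..b}|lebesgue. norm (g x))"
    by (rule set_integral_norm_bound[OF g])
  also have "\<dots> \<le> (LINT x:{a..b}|lebesgue. l + l powr (1 - p) * \<bar>g x\<bar> powr p)"
    by (rule set_integral_mono) (use g gp' pw in \<open>auto simp flip: real_norm_def intro: set_integrable_norm\<close>)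
  also have "\<dots> = (LINT x:{a..b}|lebesgue. l) + l powr (1 - p) * (LINT x:{a..b}|lebesgue. \<bar>g x\<bar> powr p)"
    using gp' by (subst set_integral_add) auto
  also have "(LINT x:{a..b}|lebesgue. l) = integral {a..b} (\<lambda>_. l)"
    by (rule set_lebesgue_integral_eq_integral) auto
  also have "\<dots> = l * (b - a)" using ab by simp
  also have "l * (b - a) + l powr (1 - p) * (LINT x:{a..b}|lebesgue. \<bar>g x\<bar> powr p)
      \<le> l * (b - a) + l powr (1 - p) * A"
    using gp_le by (intro add_left_mono mult_left_mono) auto
  also have "l * (b - a) = (b - a) powr (1 - 1 / p)"
    using ab by (simp add: l_def powr_diff powr_minus field_simps)
  also have "l powr (1 - p) = (b - a) powr (1 - 1 / p)"
    proof -
    have "- 1 / p * (1 - p) = 1 - 1 / p" using p by (simp add: field_simps)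
    then show ?thesis unfolding l_def powr_powr by (simp only:)
  qed
  finally show ?thesis by (simp add: A_def algebra_simps)
qed

text \<open>All information drawn from the L^p assumptions passes through this sublinear bound. Both
  half lines are covered because \<open>\<bar>y\<bar>\<close> is the distance from the base point 0
  of \<open>Phi\<close>.\<close>

lemma Phi_Lp_growth:
  assumes "in_Linf \<phi>" "1 \<le> p" and L: "in_Lq p S (\<lambda>x. \<phi> x - r)" and S: "S = {0..} \<or> S = {..0}"
  obtains C where "\<And>y. y \<in> S \<Longrightarrow> \<bar>Phi \<phi> y - r * y\<bar> \<le> C * \<bar>y\<bar> powr (1 - 1 / p)"
proof -
  define C where "C = 1 + (LINT x:S|lebesgue. \<bar>\<phi> x - r\<bar> powr p)"
  note int = in_Linf_absolutely_integrable[OF assms(1)]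
  have int': "(\<lambda>\<xi>. \<phi> \<xi> - r) absolutely_integrable_on {a..b}" for a b
    by (intro set_integral_diff int) auto
  have P0: "Phi \<phi> 0 = 0"
    by (simp add: Phi_def zero_ereal_def interval_lebesgue_integral_def set_lebesgue_integral_def)
  have "\<bar>Phi \<phi> y - r * y\<bar> \<le> C * \<bar>y\<bar> powr (1 - 1 / p)" if y: "y \<in> S" for y
  proof -
    consider "y = 0" | "S = {0..}" "0 < y" | "S = {..0}" "y < 0"
      using S y by fastforce
    then show ?thesis
    proof cases
      case 1
      then show ?thesis by (simp add: P0)
    next
      case 2
      then have "{0..y} \<subseteq> S" by auto
      from Lp_integral_growth[OF assms(2) _ int' 2(2) this] L
      show ?thesis
        using interval_LINT_Phi[OF assms(1), of 0 y r] interval_LINT_eq_integral[OF int'[of 0 y]] 2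
        by (simp add: in_Lq_def C_def P0)
    next
      case 3
      then have "{y..0} \<subseteq> S" by auto
      from Lp_integral_growth[OF assms(2) _ int' 3(2) this] L
      show ?thesis
        using interval_LINT_Phi[OF assms(1), of y 0 r] interval_LINT_eq_integral[OF int'[of y 0]] 3
        by (simp add: in_Lq_def C_def P0)
    qed
  qed
  then show ?thesis using that by blast
qed

subsection \<open>The Lax--Oleinik minimization problem\<close>

text \<open>The Hopf-Lax functional \<open>P y + t L((x - y) / t)\<close> with \<open>L\<close> the
  Legendre transform of \<open>f\<close>, parametrized by the state \<open>v\<close> with
  \<open>f' v = (x - y) / t\<close> instead of by the foot \<open>y\<close>. This keeps
  \<open>(x - y) / t\<close> in the range of \<open>f'\<close>, where \<open>L\<close> is given by
  \<open>v f' v - f v\<close>.\<close>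

definition cost :: "(real \<Rightarrow> real) \<Rightarrow> (real \<Rightarrow> real) \<Rightarrow> real \<Rightarrow> real \<Rightarrow> real \<Rightarrow> real" where
  "cost f P x t v = P (x - t * deriv f v) + t * (v * deriv f v - f v)"

definition minimizers :: "(real \<Rightarrow> real) \<Rightarrow> (real \<Rightarrow> real) \<Rightarrow> real \<Rightarrow> real \<Rightarrow> real set" where
  "minimizers f P x t = {v. \<forall>v'. cost f P x t v \<le> cost f P x t v'}"

text \<open>\<open>m\<close> is a global subgradient at \<open>x\<close>. For a primitive that is
  not convex, such points are those where it meets its convex hull.\<close>

definition supported_at :: "(real \<Rightarrow> real) \<Rightarrow> real \<Rightarrow> real \<Rightarrow> bool" where
  "supported_at P x m \<longleftrightarrow> (\<forall>y. P x + m * (y - x) \<le> P y)"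

lemma supported_atD: "supported_at P x m \<Longrightarrow> P x + m * (y - x) \<le> P y"
  by (simp add: supported_at_def)

section \<open>Strict monotonicity of the characteristic speed and the Bregman distance\<close>

lemma flux_D:
  assumes "flux f"
  shows flux_deriv: "(f has_real_derivative deriv f v) (at v)"
    and flux_deriv2: "(deriv f has_real_derivative deriv (deriv f) v) (at v)"
    and flux_deriv2_nonneg: "0 \<le> deriv (deriv f) v"
    and flux_continuous_deriv2: "continuous_on A (deriv (deriv f))"
  using assms by (auto simp: flux_def C2_def DERIV_deriv_iff_field_differentiable
      intro: continuous_on_subset)

lemma flux_deriv_continuous: "flux f \<Longrightarrow> continuous_on A (deriv f)"
  by (meson DERIV_continuous_on has_field_derivative_at_within flux_deriv2)

text \<open>If \<open>f'\<close> took equal values at \<open>a < b\<close>, it would be constant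
  between them, so \<open>f''\<close> would vanish on an interval of positive measure.\<close>

lemma flux_deriv_strict_mono:
  assumes f: "flux f" shows "strict_mono (deriv f)"
proof (rule strict_monoI)
  fix a b :: real assume "a < b"
  have mono: "deriv f x \<le> deriv f y" if "x \<le> y" for x y
    using that by (rule deriv_nonneg_imp_mono[OF flux_deriv2[OF f] flux_deriv2_nonneg[OF f]])
  show "deriv f a < deriv f b"
  proof (rule ccontr)
    assume "\<not> deriv f a < deriv f b"
    then have eq: "deriv f s = deriv f a" if "s \<in> {a<..<b}" for s
      using mono[of a s] mono[of s b] that by auto
    have "deriv (deriv f) s = 0" if s: "s \<in> {a<..<b}" for s
    proof -
      have "((\<lambda>_. deriv f a) has_real_derivative deriv (deriv f) s) (at s)"
        by (rule has_field_derivative_transform_within_open[OF flux_deriv2[OF f], of "{a<..<b}"])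
           (use s eq in auto)
      then show ?thesis using DERIV_const DERIV_unique by blast
    qed
    then have "{a<..<b} \<subseteq> {v. deriv (deriv f) v = 0}" by auto
    then have "{a<..<b} \<in> null_sets lebesgue"
      using f by (auto simp: flux_def intro: null_sets_completion_subset)
    then have "emeasure lborel {a<..<b} = 0"
      by (simp add: null_sets_def)
    then show False using \<open>a < b\<close> by simp
  qed
qed

lemma flux_deriv_less_iff: "flux f \<Longrightarrow> deriv f a < deriv f b \<longleftrightarrow> a < b"
  by (simp add: flux_deriv_strict_mono strict_mono_less)

lemma flux_deriv_le_iff: "flux f \<Longrightarrow> deriv f a \<le> deriv f b \<longleftrightarrow> a \<le> b"
  by (simp add: flux_deriv_strict_mono strict_mono_less_eq)

lemma flux_deriv_eq_iff: "flux f \<Longrightarrow> deriv f a = deriv f b \<longleftrightarrow> a = b"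
  by (simp add: flux_deriv_strict_mono strict_mono_eq)

lemma inv_deriv_flux: "flux f \<Longrightarrow> inv (deriv f) (deriv f v) = v"
  by (simp add: inv_f_f flux_deriv_strict_mono strict_mono_on_imp_inj_on)

text \<open>Takes the place of surjectivity of \<open>f'\<close>: a speed is attained as soon as it
  is bracketed by attained ones.\<close>

lemma flux_deriv_between:
  assumes f: "flux f" and "deriv f a \<le> y" "y \<le> deriv f b"
  obtains v where "deriv f v = y"
proof -
  have "a \<le> b" using assms flux_deriv_le_iff[OF f, of a b] by simp
  with IVT'[of "deriv f" a y b] flux_deriv_continuous[OF f] assms that show ?thesis by blast
qed

lemma flux_tangent:
  assumes f: "flux f" and "a \<noteq> b"
  shows "f a + deriv f a * (b - a) < f b"
proof -
  have "\<exists>z. min a b < z \<and> z < max a b \<and> f (max a b) - f (min a b) = (max a b - min a b) * deriv f z"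
    using MVT2[of "min a b" "max a b" f "deriv f"] flux_deriv[OF f] \<open>a \<noteq> b\<close> by auto
  then obtain z where z: "min a b < z" "z < max a b" "f b - f a = (b - a) * deriv f z"
    by (auto simp: min_def max_def algebra_simps split: if_splits)
  have "(b - a) * (deriv f z - deriv f a) > 0"
    using z \<open>a \<noteq> b\<close> flux_deriv_less_iff[OF f, of a z] flux_deriv_less_iff[OF f, of z a]
    by (cases "a < b") (auto simp: zero_less_mult_iff)
  then show ?thesis using z(3) by (simp add: algebra_simps)
qed

lemma flux_tangent_le: "flux f \<Longrightarrow> f a + deriv f a * (b - a) \<le> f b"
  using flux_tangent[of f a b] by (cases "a = b") auto

text \<open>The gap at \<open>c\<close> between \<open>f\<close> and its tangent at
  \<open>v\<close>. In the speed variable it is the gap at \<open>f' v\<close> between the Legendre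
  transform and its tangent at \<open>f' c\<close>; its derivative in \<open>v\<close> is
  \<open>(v - c) f'' v\<close>.\<close>

definition bregman :: "(real \<Rightarrow> real) \<Rightarrow> real \<Rightarrow> real \<Rightarrow> real" where
  "bregman f c v = (v - c) * deriv f v - f v + f c"

lemma bregman_pos: "flux f \<Longrightarrow> v \<noteq> c \<Longrightarrow> 0 < bregman f c v"
  using flux_tangent[of f v c] by (simp add: bregman_def algebra_simps)

lemma bregman_nonneg: "flux f \<Longrightarrow> 0 \<le> bregman f c v"
  using bregman_pos[of f v c] by (cases "v = c") (auto simp: bregman_def)

text \<open>The tangent inequality for the Bregman distance as a convex function of the speed, with
  slope \<open>a - c\<close> at the speed \<open>f' a\<close>.\<close>

lemma bregman_diff_le:
  "flux f \<Longrightarrow> bregman f c a - bregman f c b \<le> (a - c) * (deriv f a - deriv f b)"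
  using flux_tangent_le[of f b a] by (simp add: bregman_def algebra_simps)

lemma cost_eq_bregman:
  "cost f P x t v = (P (x - t * deriv f v) - (P e + c * (x - t * deriv f v - e))) + t * bregman f c v
     + (P e + c * (x - e) - t * f c)"
  by (simp add: cost_def bregman_def algebra_simps)

lemma minimizers_le: "v \<in> minimizers f P x t \<Longrightarrow> cost f P x t v \<le> cost f P x t v'"
  by (simp add: minimizers_def)

text \<open>The substitution \<open>y = g s = x - t f' s\<close> turns the part with the datum into
  an increment of \<open>Phi\<close>; the part \<open>- s f''\<close> is an exact derivative of the
  Legendre term. The map \<open>g\<close> is strictly decreasing but \<open>g'\<close> may vanish,
  so the change of variables for injective maps and absolutely integrable functions is used. The
  cost at 0 appears because \<open>E\<close> is integrated from 0.\<close>

lemma E_fun_eq_cost: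
  assumes f: "flux f" and \<phi>: "in_Linf \<phi>" and t: "0 < t"
  shows "E_fun f \<phi> x t v = cost f (Phi \<phi>) x t 0 - cost f (Phi \<phi>) x t v"
proof -
  define h where "h = (\<lambda>s. deriv (deriv f) s * (\<phi> (x - t * deriv f s) - s))"
  note int = in_Linf_absolutely_integrable[OF \<phi>]
  have main: "h absolutely_integrable_on {a..b} \<and>
      t * integral {a..b} h = cost f (Phi \<phi>) x t a - cost f (Phi \<phi>) x t b" if "a \<le> b" for a b
  proof -
    define g where "g = (\<lambda>s. x - t * deriv f s)"
    have g': "(g has_field_derivative (- t * deriv (deriv f) s)) (at s within A)" for s A
      unfolding g_def
      by (rule has_field_derivative_at_within)
         (auto intro!: derivative_eq_intros flux_deriv2[OF f])
    have inj: "inj_on g {a..b}"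
      using t by (auto simp: inj_on_def g_def flux_deriv_eq_iff[OF f])
    have img: "g ` {a..b} = {g b..g a}"
    proof (intro equalityI subsetI)
      fix y assume "y \<in> {g b..g a}"
      moreover have "continuous_on {a..b} g"
        unfolding g_def by (intro continuous_intros flux_deriv_continuous[OF f])
      ultimately show "y \<in> g ` {a..b}"
        using IVT2'[of g b y a] \<open>a \<le> b\<close> by auto
    next
      fix y assume "y \<in> g ` {a..b}"
      then show "y \<in> {g b..g a}"
        using t by (auto simp: g_def flux_deriv_le_iff[OF f])
    qed
    have "g b \<le> g a"
      using t \<open>a \<le> b\<close> by (simp add: g_def flux_deriv_le_iff[OF f])
    then have "integral (g ` {a..b}) \<phi> = Phi \<phi> (g a) - Phi \<phi> (g b)"
      using Phi_diff[OF \<phi>] img by simp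
    then have 1: "(\<lambda>s. \<bar>- t * deriv (deriv f) s\<bar> * \<phi> (g s)) absolutely_integrable_on {a..b}"
      and 2: "integral {a..b} (\<lambda>s. \<bar>- t * deriv (deriv f) s\<bar> * \<phi> (g s)) = Phi \<phi> (g a) - Phi \<phi> (g b)"
      using has_absolute_integral_change_of_variables_1'[where S = "{a..b}" and g = g
          and g' = "\<lambda>s. - t * deriv (deriv f) s" and f = \<phi> and b = "Phi \<phi> (g a) - Phi \<phi> (g b)"] g' inj int img by auto
    have 3: "(\<lambda>s. t * deriv (deriv f) s * s) absolutely_integrable_on {a..b}"
      by (intro absolutely_integrable_continuous_real continuous_intros flux_continuous_deriv2[OF f])
    have 4: "((\<lambda>s. t * deriv (deriv f) s * s) has_integral
        (t * (b * deriv f b - f b) - t * (a * deriv f a - f a))) {a..b}"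
      using \<open>a \<le> b\<close>
    proof (rule fundamental_theorem_of_calculus)
      fix s
      have "((\<lambda>s. t * (s * deriv f s - f s)) has_real_derivative t * deriv (deriv f) s * s) (at s)"
        by (auto intro!: derivative_eq_intros flux_deriv2[OF f] flux_deriv[OF f] simp: algebra_simps)
      then show "((\<lambda>s. t * (s * deriv f s - f s)) has_vector_derivative t * deriv (deriv f) s * s)
          (at s within {a..b})"
        by (simp add: has_real_derivative_iff_has_vector_derivative has_vector_derivative_at_within)
    qed
    have th: "t * h s = \<bar>- t * deriv (deriv f) s\<bar> * \<phi> (g s) - t * deriv (deriv f) s * s" for s
      using t flux_deriv2_nonneg[OF f, of s] by (simp add: h_def g_def abs_mult algebra_simps)
    have "(\<lambda>s. t * h s) absolutely_integrable_on {a..b}"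
      unfolding th by (rule set_integral_diff(1)[OF 1 3])
    then have "h absolutely_integrable_on {a..b}"
      using t by simp
    moreover have "integral {a..b} (\<lambda>s. t * h s) = cost f (Phi \<phi>) x t a - cost f (Phi \<phi>) x t b"
      unfolding th
      using Henstock_Kurzweil_Integration.integral_diff[OF set_lebesgue_integral_eq_integral(1)[OF 1]
          has_integral_integrable[OF 4]] 2 integral_unique[OF 4]
      by (simp add: cost_def g_def algebra_simps)
    ultimately show ?thesis by simp
  qed
  show ?thesis
  proof (cases "0 \<le> v")
    case True
    then show ?thesis
      using main[OF True] interval_LINT_eq_integral[of 0 v h]
      by (simp add: E_fun_def h_def zero_ereal_def)
  next
    case False
    then have "v \<le> 0" by simp
    then show ?thesis
      using main[OF \<open>v \<le> 0\<close>] interval_LINT_eq_neg_integral[of v 0 h]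
      by (simp add: E_fun_def h_def zero_ereal_def)
  qed
qed

lemma maximizers_eq_minimizers:
  assumes "flux f" "in_Linf \<phi>" "0 < t"
  shows "maximizers f \<phi> x t = minimizers f (Phi \<phi>) x t"
  by (simp add: maximizers_def minimizers_def E_fun_eq_cost[OF assms])

text \<open>As \<open>v\<close> rises above \<open>M\<close>, the Legendre term gains more than
  \<open>M\<close> per unit of displacement of the foot, while \<open>P\<close> drops by at most
  \<open>M\<close> per unit. So states outside \<open>{-M..M}\<close> cost more than the nearer end
  point, and the minimization takes place on a compact interval.\<close>

lemma minimizers_nonempty_compact:
  assumes f: "flux f" and P: "M-lipschitz_on UNIV P" and t: "0 < t"
  shows "minimizers f P x t \<noteq> {}" "compact (minimizers f P x t)" "minimizers f P x t \<subseteq> {-M..M}"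
proof -
  have M: "0 \<le> M" using P by (simp add: lipschitz_on_def)
  have PM: "\<bar>P a - P b\<bar> \<le> M * \<bar>a - b\<bar>" for a b
    using lipschitz_onD[OF P, of a b] by (simp add: dist_real_def)
  have cont: "continuous_on A (cost f P x t)" for A
  proof -
    have "continuous_on UNIV P"
      by (rule lipschitz_on_continuous_on[OF P])
    then have "continuous_on A (\<lambda>v. P (x - t * deriv f v))"
      by (rule continuous_on_compose2) (auto intro!: continuous_intros flux_deriv_continuous[OF f])
    moreover have "continuous_on A f"
      by (meson DERIV_continuous_on has_field_derivative_at_within flux_deriv[OF f])
    ultimately show ?thesis
      unfolding cost_def by (intro continuous_intros flux_deriv_continuous[OF f])
  qed
  have up: "cost f P x t M < cost f P x t v" if "M < v" for v
  proof -
    have "M * (deriv f v - deriv f M) < v * deriv f v - f v - M * deriv f M + f M"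
      using flux_tangent[OF f, of v M] that by (simp add: algebra_simps)
    from mult_strict_left_mono[OF this t]
    have "t * M * (deriv f v - deriv f M) < t * (v * deriv f v - f v - M * deriv f M + f M)"
      by (simp only: mult.assoc)
    moreover have "P (x - t * deriv f M) - P (x - t * deriv f v) \<le> M * (t * (deriv f v - deriv f M))"
      using PM[of "x - t * deriv f M" "x - t * deriv f v"] that t flux_deriv_less_iff[OF f, of M v]
      by (simp add: abs_mult flip: right_diff_distrib)
    ultimately show ?thesis by (simp add: cost_def algebra_simps)
  qed
  have down: "cost f P x t (-M) < cost f P x t v" if "v < -M" for v
  proof -
    have "- M * (deriv f v - deriv f (-M)) < v * deriv f v - f v + M * deriv f (-M) + f (-M)"
      using flux_tangent[OF f, of v "-M"] that by (simp add: algebra_simps)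
    from mult_strict_left_mono[OF this t]
    have "- (t * M * (deriv f v - deriv f (-M))) < t * (v * deriv f v - f v + M * deriv f (-M) + f (-M))"
      by (simp only: mult.assoc mult_minus_left mult_minus_right)
    moreover have "P (x - t * deriv f (-M)) - P (x - t * deriv f v) \<le> M * (t * (deriv f (-M) - deriv f v))"
      using PM[of "x - t * deriv f (-M)" "x - t * deriv f v"] that t flux_deriv_less_iff[OF f, of v "-M"]
      by (simp add: abs_mult flip: right_diff_distrib)
    ultimately show ?thesis by (simp add: cost_def algebra_simps)
  qed
  obtain m where m: "m \<in> {-M..M}" "\<And>v. v \<in> {-M..M} \<Longrightarrow> cost f P x t m \<le> cost f P x t v"
    using continuous_attains_inf[OF _ _ cont, of "{-M..M}"] M by auto
  have "cost f P x t m \<le> cost f P x t v" for v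
    using m(2)[of v] m(2)[of M] m(2)[of "-M"] up[of v] down[of v] M by force
  then show "minimizers f P x t \<noteq> {}" by (auto simp: minimizers_def)
  show sub: "minimizers f P x t \<subseteq> {-M..M}"
    using up down by (fastforce simp: minimizers_def dest: leD intro: leI)
  have "closed (minimizers f P x t)"
    unfolding minimizers_def
    by (intro closed_Collect_all closed_Collect_le continuous_intros cont)
  then show "compact (minimizers f P x t)"
    using sub by (meson bounded_closed_interval bounded_subset compact_eq_bounded_closed)
qed

text \<open>Strict convexity of the Legendre transform \<open>v f'(v) - f(v)\<close> in the variable \<open>f'(v)\<close> rules out
  crossing backward characteristics: swapping the two feet would strictly lower the total cost.\<close>

lemma minimizers_foot_mono:
  assumes f: "flux f" and t: "0 < t" and x: "x1 < x2"
    and v1: "v1 \<in> minimizers f P x1 t" and v2: "v2 \<in> minimizers f P x2 t"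
  shows "x1 - t * deriv f v1 \<le> x2 - t * deriv f v2"
proof (rule ccontr)
  define y1 where "y1 = x1 - t * deriv f v1"
  define y2 where "y2 = x2 - t * deriv f v2"
  define g where "g = (\<lambda>v. v * deriv f v - f v)"
  assume "\<not> ?thesis"
  then have y: "y2 < y1" by (simp add: y1_def y2_def)
  \<comment> \<open>\<open>a\<close> and \<open>b\<close> are the states of the exchanged segments,
    from \<open>x1\<close> to the foot \<open>y2\<close> and from \<open>x2\<close> to
    \<open>y1\<close>. Their speeds lie strictly between those of \<open>v1\<close> and
    \<open>v2\<close>, hence are attained.\<close>
  have la: "deriv f v1 < (x1 - y2) / t" "(x1 - y2) / t < deriv f v2"
    using t x y by (simp_all add: y1_def y2_def field_simps)
  obtain a where a: "deriv f a = (x1 - y2) / t"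
    by (rule flux_deriv_between[OF f less_imp_le[OF la(1)] less_imp_le[OF la(2)]])
  then have va: "v1 < a"
    using la(1) flux_deriv_less_iff[OF f, of v1 a] by simp
  have lb: "deriv f v1 < (x2 - y1) / t" "(x2 - y1) / t < deriv f v2"
    using t x y by (simp_all add: y1_def y2_def field_simps)
  obtain b where b: "deriv f b = (x2 - y1) / t"
    by (rule flux_deriv_between[OF f less_imp_le[OF lb(1)] less_imp_le[OF lb(2)]])
  then have vb: "v1 < b"
    using lb(1) flux_deriv_less_iff[OF f, of v1 b] by simp
  have y2: "x1 - t * deriv f a = y2" and y1: "x2 - t * deriv f b = y1"
    using t by (simp_all add: a b)
  have "P y1 + t * g v1 \<le> P y2 + t * g a" "P y2 + t * g v2 \<le> P y1 + t * g b"
    using minimizers_le[OF v1, of a] minimizers_le[OF v2, of b] unfolding cost_def y1 y2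
    by (simp_all add: y1_def y2_def g_def)
  then have "t * (g v1 + g v2) \<le> t * (g a + g b)"
    by (simp add: algebra_simps)
  then have le: "g v1 + g v2 \<le> g a + g b"
    using t by simp
  have up: "g r - g s \<le> r * (deriv f r - deriv f s)" for r s
    using flux_tangent_le[OF f, of s r] by (simp add: g_def algebra_simps)
  have up': "g r - g s < r * (deriv f r - deriv f s)" if "r \<noteq> s" for r s
    using flux_tangent[OF f, of s r] that by (simp add: g_def algebra_simps)
  have sum: "deriv f a - deriv f v1 = deriv f v2 - deriv f b"
    "deriv f b - deriv f v1 = deriv f v2 - deriv f a"
    using t by (simp_all add: a b y1_def y2_def field_simps)
  \<comment> \<open>The speeds satisfy \<open>f' a + f' b = f' v1 + f' v2\<close> with
    \<open>a\<close>, \<open>b\<close> as the inner pair, so strict convexity of \<open>g\<close> in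
    the speed applies. The case distinction only orders the two inner states.\<close>
  have "g v1 + g v2 > g a + g b"
  proof (cases "a \<le> b")
    case True
    have "g a - g v1 < a * (deriv f a - deriv f v1)" using up' va by simp
    also have "\<dots> \<le> b * (deriv f a - deriv f v1)"
      using True va flux_deriv_less_iff[OF f, of v1 a] by (intro mult_right_mono) auto
    also have "\<dots> = - (b * (deriv f b - deriv f v2))" by (simp add: sum algebra_simps)
    also have "\<dots> \<le> g v2 - g b"
      using flux_tangent_le[OF f, of v2 b] by (simp add: g_def algebra_simps)
    finally show ?thesis by simp
  next
    case False
    have "g b - g v1 < b * (deriv f b - deriv f v1)" using up' vb by simp
    also have "\<dots> \<le> a * (deriv f b - deriv f v1)"
      using False vb flux_deriv_less_iff[OF f, of v1 b] by (intro mult_right_mono) auto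
    also have "\<dots> = - (a * (deriv f a - deriv f v2))" by (simp add: sum algebra_simps)
    also have "\<dots> \<le> g v2 - g a"
      using flux_tangent_le[OF f, of v2 a] by (simp add: g_def algebra_simps)
    finally show ?thesis by simp
  qed
  with le show False by simp
qed

text \<open>On this line the state \<open>c\<close> has foot \<open>e\<close>, where the excess
  vanishes, and zero Bregman distance; every other state has positive Bregman distance. Hence a
  contact point emits a divide.\<close>

lemma minimizers_on_divide:
  assumes f: "flux f" and t: "0 < t" and s: "supported_at P e c"
  shows "minimizers f P (e + t * deriv f c) t = {c}"
proof -
  let ?x = "e + t * deriv f c"
  have c: "cost f P ?x t c = P e + c * (?x - e) - t * f c"
    by (simp add: cost_def algebra_simps)
  have "cost f P ?x t c < cost f P ?x t v" if "v \<noteq> c" for v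
    using supported_atD[OF s, of "?x - t * deriv f v"] mult_pos_pos[OF t bregman_pos[OF f that]]
    unfolding c cost_eq_bregman[of f P ?x t v e c] by linarith
  then show ?thesis
    by (fastforce simp: minimizers_def intro: less_imp_le dest: leD)
qed

text \<open>Feet are ordered like the points they come from, and a point on the divide has the
  single foot \<open>e\<close>; a divide is therefore a barrier for backward
  characteristics.\<close>

lemma minimizers_foot_ge:
  assumes "flux f" "0 < t" "supported_at P e c" "e + t * deriv f c < x" "v \<in> minimizers f P x t"
  shows "e \<le> x - t * deriv f v"
  using minimizers_foot_mono[OF assms(1,2,4) _ assms(5), of c] minimizers_on_divide[OF assms(1-3)] by simp

lemma minimizers_foot_le:
  assumes "flux f" "0 < t" "supported_at P e c" "x < e + t * deriv f c" "v \<in> minimizers f P x t"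
  shows "x - t * deriv f v \<le> e"
  using minimizers_foot_mono[OF assms(1,2,4,5), of c] minimizers_on_divide[OF assms(1-3)] by simp

text \<open>\<open>v0\<close> is the state of the segment from \<open>e\<close> to
  \<open>(x, t)\<close>, whose excess is zero. Convexity turns the difference of Bregman distances
  into a product; its factor \<open>x - t * deriv f v - e\<close> is what can later be cancelled
  against a power-type lower bound of the excess.\<close>

lemma minimizers_excess_le:
  assumes f: "flux f" and t: "0 < t"
    and v: "v \<in> minimizers f P x t" and v0: "deriv f v0 = (x - e) / t"
  shows "P (x - t * deriv f v) - (P e + c * (x - t * deriv f v - e)) \<le> (v0 - c) * (x - t * deriv f v - e)"
proof -
  let ?y = "x - t * deriv f v"
  have y0: "x - t * deriv f v0 = e" using t v0 by simp
  have "P ?y - (P e + c * (?y - e)) \<le> t * (bregman f c v0 - bregman f c v)"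
    using minimizers_le[OF v, of v0] cost_eq_bregman[of f P x t v e c] cost_eq_bregman[of f P x t v0 e c]
    unfolding y0 by (simp add: algebra_simps)
  also have "\<dots> \<le> t * ((v0 - c) * (deriv f v0 - deriv f v))"
    using bregman_diff_le[OF f] t by (intro mult_left_mono) auto
  also have "\<dots> = (v0 - c) * (?y - e)" using t by (simp add: v0 field_simps)
  finally show ?thesis .
qed

subsection \<open>Contact points of the convex hull\<close>

lemma supported_at_reflect: "supported_at (\<lambda>y. P (- y)) x m \<longleftrightarrow> supported_at P (- x) (- m)"
proof
  show "supported_at (\<lambda>y. P (- y)) x m" if "supported_at P (- x) (- m)"
    unfolding supported_at_def
  proof
    fix y show "P (- x) + m * (y - x) \<le> P (- y)"
      using supported_atD[OF that, of "- y"] by (simp add: algebra_simps)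
  qed
  show "supported_at P (- x) (- m)" if "supported_at (\<lambda>y. P (- y)) x m"
    unfolding supported_at_def
  proof
    fix y show "P (- x) + - m * (y - - x) \<le> P y"
      using supported_atD[OF that, of "- y"] by (simp add: algebra_simps)
  qed
qed

lemma supported_at_transfer:
  assumes "supported_at P x m" "P z = P x + m * (z - x)"
  shows "supported_at P z m"
  unfolding supported_at_def
proof
  fix y show "P z + m * (y - z) \<le> P y"
    using supported_atD[OF assms(1), of y] assms(2) by (simp add: algebra_simps)
qed

text \<open>A support line exists iff every left difference quotient is at most every right one. The
  chord form contains no existential slope and is therefore a closed condition on
  \<open>x\<close>.\<close>

lemma ex_supported_at_iff_chords:
  "(\<exists>m. supported_at P x m) \<longleftrightarrow> (\<forall>a>0. \<forall>b>0. (a + b) * P x \<le> b * P (x - a) + a * P (x + b))"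
proof
  assume "\<exists>m. supported_at P x m"
  then obtain m where m: "supported_at P x m" ..
  show "\<forall>a>0. \<forall>b>0. (a + b) * P x \<le> b * P (x - a) + a * P (x + b)"
  proof (intro allI impI)
    fix a b :: real assume "0 < a" "0 < b"
    then have "b * (P x - m * a) \<le> b * P (x - a)" "a * (P x + m * b) \<le> a * P (x + b)"
      using supported_atD[OF m, of "x - a"] supported_atD[OF m, of "x + b"]
      by (auto intro!: mult_left_mono)
    then show "(a + b) * P x \<le> b * P (x - a) + a * P (x + b)"
      by (simp add: algebra_simps)
  qed
next
  assume chords: "\<forall>a>0. \<forall>b>0. (a + b) * P x \<le> b * P (x - a) + a * P (x + b)"
  \<comment> \<open>The supremum of the left difference quotients is the smallest slope that can
    support.\<close>
  define m where "m = (SUP a\<in>{0<..}. (P x - P (x - a)) / a)"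
  have le: "(P x - P (x - a)) / a \<le> (P (x + b) - P x) / b" if "0 < a" "0 < b" for a b
    using chords that by (simp add: field_simps)
  have bdd: "bdd_above ((\<lambda>a. (P x - P (x - a)) / a) ` {0<..})"
    using le[of _ 1] by (intro bdd_aboveI2[where M = "(P (x + 1) - P x) / 1"]) auto
  have "P x + m * (y - x) \<le> P y" for y
  proof (cases y x rule: linorder_cases)
    case less
    then have "(P x - P (x - (x - y))) / (x - y) \<le> m"
      unfolding m_def using bdd by (intro cSUP_upper) auto
    then show ?thesis using less by (simp add: field_simps)
  next
    case greater
    have "m \<le> (P (x + (y - x)) - P x) / (y - x)"
      unfolding m_def
    proof (rule cSUP_least)
      fix a :: real assume "a \<in> {0<..}"
      then show "(P x - P (x - a)) / a \<le> (P (x + (y - x)) - P x) / (y - x)"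
        using greater by (intro le) auto
    qed auto
    then show ?thesis using greater by (simp add: field_simps)
  qed simp
  then show "\<exists>m. supported_at P x m" by (auto simp: supported_at_def)
qed

lemma closed_supported_points:
  assumes "continuous_on UNIV P"
  shows "closed {x. \<exists>m. supported_at P x m}"
proof -
  have "{x. \<exists>m. supported_at P x m} =
      (\<Inter>a\<in>{0<..}. \<Inter>b\<in>{0<..}. {x. (a + b) * P x \<le> b * P (x - a) + a * P (x + b)})"
    unfolding ex_supported_at_iff_chords by auto
  also have "closed \<dots>"
    by (intro closed_INT ballI closed_Collect_le continuous_intros
        continuous_on_compose2[OF assms]) auto
  finally show ?thesis .
qed

text \<open>\<open>H N x\<close> decreases in \<open>N\<close>, so the limit is an infimum. A
  support line at \<open>x\<close> competes in every hull and keeps the value \<open>P x\<close>.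
  Without one, some chord from \<open>x - a\<close> to \<open>x + b\<close> passes strictly below
  \<open>P x\<close>, and it caps all hulls on intervals that contain the chord.\<close>

lemma K0_eq_supported_points:
  assumes \<phi>: "in_Linf \<phi>"
  shows "K0 \<phi> = {x. \<exists>m. supported_at (Phi \<phi>) x m}"
proof -
  define P where "P = Phi \<phi>"
  obtain M where "M-lipschitz_on UNIV P"
    using Phi_lipschitz[OF \<phi>] unfolding P_def .
  then have cont: "continuous_on UNIV P" by (rule lipschitz_on_continuous_on)
  have "ereal (P x) = Phi_hull \<phi> x \<longleftrightarrow> (\<exists>m. supported_at P x m)" for x
  proof -
    define S where "S N = {g x |g. convex_on {-N..N} g \<and> (\<forall>y\<in>{-N..N}. g y \<le> P y)}" for N
    define H where "H = Phi_hull_on \<phi>"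
    have H: "H N x = Sup (S N)" if "\<bar>x\<bar> < N" for N
      using that by (simp add: H_def Phi_hull_on_def S_def P_def)
    have le: "s \<le> P x" if "s \<in> S N" "\<bar>x\<bar> < N" for s N
    proof -
      have "x \<in> {-N..N}" using that(2) by (simp add: abs_less_iff)
      then show ?thesis using that(1) by (auto simp: S_def)
    qed
    have bdd: "bdd_above (S N)" if "\<bar>x\<bar> < N" for N
      using le that by (auto intro!: bdd_aboveI[of _ "P x"])
    have ne: "S N \<noteq> {}" if "\<bar>x\<bar> < N" for N
    proof -
      \<comment> \<open>The minimum of \<open>P\<close>, as a constant function, is a convex
        minorant, so the supremum in the hull is not that of an empty set.\<close>
      have "\<exists>z\<in>{-N..N}. \<forall>y\<in>{-N..N}. P z \<le> P y"
        by (rule continuous_attains_inf) (use that in \<open>auto intro: continuous_on_subset[OF cont]\<close>)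
      then obtain z where "\<forall>y\<in>{-N..N}. P z \<le> P y" ..
      moreover have "convex_on {-N..N} (\<lambda>_. P z)"
        by (simp add: convex_on_const)
      ultimately have "P z \<in> S N"
        unfolding S_def by (intro CollectI exI[of _ "\<lambda>_. P z"]) auto
      then show ?thesis by auto
    qed
    have anti: "H N' x \<le> H N x" if "\<bar>x\<bar> < N" "N \<le> N'" for N N'
    proof -
      have "S N' \<subseteq> S N"
      proof
        fix s assume "s \<in> S N'"
        then obtain g where g: "s = g x" "convex_on {-N'..N'} g" "\<forall>y\<in>{-N'..N'}. g y \<le> P y"
          by (auto simp: S_def)
        have sub: "{-N..N} \<subseteq> {-N'..N'}" using that by auto
        have "convex_on {-N..N} g" using convex_on_subset[OF g(2) sub] by simp
        then show "s \<in> S N"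
          using g(1,3) sub unfolding S_def by (intro CollectI exI[of _ g]) auto
      qed
      then show ?thesis
        using that ne[of N'] bdd[of N] by (simp add: H cSup_subset_mono)
    qed
    have hull: "Phi_hull \<phi> x = Lim at_top (\<lambda>N. ereal (H N x))"
      by (simp add: Phi_hull_def H_def)
    show ?thesis
    proof
      assume "\<exists>m. supported_at P x m"
      then obtain m where m: "supported_at P x m" ..
      have "H N x = P x" if N: "\<bar>x\<bar> < N" for N
      proof -
        have "convex_on {-N..N} (\<lambda>y. P x + m * (y - x))"
          by (intro convex_onI) (auto simp: algebra_simps simp flip: distrib_right)
        then have "P x \<in> S N"
          using supported_atD[OF m] unfolding S_def
          by (intro CollectI exI[of _ "\<lambda>y. P x + m * (y - x)"]) auto
        then show ?thesis
          using le N by (simp add: H cSup_eq_maximum)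
      qed
      then have "((\<lambda>N. ereal (H N x)) \<longlongrightarrow> ereal (P x)) at_top"
        by (intro tendsto_eventually) (auto intro: eventually_mono[OF eventually_gt_at_top[of "\<bar>x\<bar>"]])
      from tendsto_Lim[OF trivial_limit_at_top_linorder this]
      show "ereal (P x) = Phi_hull \<phi> x"
        unfolding hull by simp
    next
      assume eq: "ereal (P x) = Phi_hull \<phi> x"
      show "\<exists>m. supported_at P x m"
      proof (rule ccontr)
        assume "\<nexists>m. supported_at P x m"
        then obtain a b where ab: "0 < a" "0 < b" "(a + b) * P x > b * P (x - a) + a * P (x + b)"
          unfolding ex_supported_at_iff_chords by (auto simp: not_le)
        define q where "q = (b * P (x - a) + a * P (x + b)) / (a + b)"
        have q: "q < P x" using ab by (simp add: q_def field_simps)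
        \<comment> \<open>Large enough for both chord ends to lie in the interval and for
          \<open>\<bar>x\<bar> < N0\<close> to select the branch of the hull that is a
          supremum.\<close>
        define N0 where "N0 = \<bar>x\<bar> + a + b"
        have N0: "\<bar>x\<bar> < N0" using ab by (simp add: N0_def)
        have "H N0 x \<le> q"
          unfolding H[OF N0]
        proof (rule cSup_least[OF ne[OF N0]])
          fix s assume "s \<in> S N0"
          then obtain g where g: "s = g x" "convex_on {-N0..N0} g" "\<And>y. y \<in> {-N0..N0} \<Longrightarrow> g y \<le> P y"
            by (auto simp: S_def)
          have in': "x - a \<in> {-N0..N0}" "x + b \<in> {-N0..N0}" using ab by (auto simp: N0_def)
          have x: "(1 - a / (a + b)) *\<^sub>R (x - a) + (a / (a + b)) *\<^sub>R (x + b) = x"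
          proof -
            have "(1 - a / (a + b)) *\<^sub>R (x - a) + (a / (a + b)) *\<^sub>R (x + b) = x - a + a / (a + b) * (a + b)"
              by (simp only: real_scaleR_def) algebra
            then show ?thesis using ab by simp
          qed
          have "g x \<le> (1 - a / (a + b)) * g (x - a) + (a / (a + b)) * g (x + b)"
            using convex_onD[OF g(2) _ _ in', of "a / (a + b)"] ab unfolding x by simp
          also have "\<dots> \<le> (1 - a / (a + b)) * P (x - a) + (a / (a + b)) * P (x + b)"
            using ab g(3)[OF in'(1)] g(3)[OF in'(2)]
            by (intro add_mono mult_left_mono) (auto simp: field_simps)
          also have "1 - a / (a + b) = b / (a + b)" using ab by (simp add: field_simps)
          also have "b / (a + b) * P (x - a) + a / (a + b) * P (x + b) = q"
            by (simp add: q_def add_divide_distrib)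
          finally show "s \<le> q" by (simp add: g(1))
        qed
        \<comment> \<open>\<open>Lim\<close> carries information only when the limit exists, so
          convergence to the infimum is proved before its value is used.\<close>
        define I where "I = (INF N\<in>{N0..}. ereal (H N x))"
        have "((\<lambda>N. ereal (H N x)) \<longlongrightarrow> I) at_top"
        proof (rule order_tendstoI)
          fix l assume "l < I"
          then have "l < ereal (H N x)" if "N0 \<le> N" for N
            using that unfolding I_def by (meson INF_lower atLeast_iff less_le_trans)
          then show "\<forall>\<^sub>F N in at_top. l < ereal (H N x)"
            by (rule eventually_mono[OF eventually_ge_at_top[of N0]])
        next
          fix l assume "I < l"
          then obtain N1 where N1: "N0 \<le> N1" "ereal (H N1 x) < l"
            unfolding I_def by (auto simp: INF_less_iff)
          have "ereal (H N x) < l" if "N1 \<le> N" for N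
          proof -
            have "ereal (H N x) \<le> ereal (H N1 x)" using anti[of N1 N] N1 N0 that by simp
            then show ?thesis using N1(2) by (rule le_less_trans)
          qed
          then show "\<forall>\<^sub>F N in at_top. ereal (H N x) < l"
            by (rule eventually_mono[OF eventually_ge_at_top[of N1]])
        qed
        then have "Phi_hull \<phi> x = I"
          unfolding hull by (intro tendsto_Lim trivial_limit_at_top_linorder)
        moreover have "I \<le> ereal (H N0 x)" unfolding I_def by (rule INF_lower) simp
        ultimately have "ereal (P x) \<le> ereal (H N0 x)" using eq by simp
        then show False using \<open>H N0 x \<le> q\<close> q by simp
      qed
    qed
  qed
  then show ?thesis by (simp add: K0_def P_def)
qed

text \<open>The end points lie in the contact set because a component is maximal. Their support
  slopes lie on either side of the chord slope \<open>c\<close>, which puts the chord below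
  \<open>Phi\<close> outside the gap. Inside, a minimum point of \<open>Phi y - c y\<close> over the
  closed gap is supported with slope \<open>c\<close>, so it is an end point; the same reasoning
  excludes equality in the interior.\<close>

lemma gap_support:
  assumes \<phi>: "in_Linf \<phi>" and gap: "gap \<phi> e h"
  shows "supported_at (Phi \<phi>) e (gap_c \<phi> e h)" "supported_at (Phi \<phi>) h (gap_c \<phi> e h)"
    "\<And>y. e < y \<Longrightarrow> y < h \<Longrightarrow> Phi \<phi> e + gap_c \<phi> e h * (y - e) < Phi \<phi> y"
proof -
  define P where "P = Phi \<phi>"
  define c where "c = gap_c \<phi> e h"
  have eh: "e < h" and comp: "{e<..<h} \<in> components (- K0 \<phi>)" using gap by (auto simp: gap_def)
  obtain M where "M-lipschitz_on UNIV P"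
    using Phi_lipschitz[OF \<phi>] unfolding P_def .
  then have cont: "continuous_on UNIV P" by (rule lipschitz_on_continuous_on)
  note K0 = K0_eq_supported_points[OF \<phi>, folded P_def]
  have sub: "{e<..<h} \<subseteq> - K0 \<phi>" using comp by (rule in_components_subset)
  have "e \<in> K0 \<phi>"
  proof (rule ccontr)
    assume "e \<notin> K0 \<phi>"
    then have "{e..<h} \<subseteq> - K0 \<phi>"
      using sub by (auto simp: subset_iff order.order_iff_strict)
    moreover have "(e + h) / 2 \<in> {e<..<h} \<inter> {e..<h}" using eh by auto
    then have "{e<..<h} \<inter> {e..<h} \<noteq> {}" by blast
    ultimately have "{e..<h} \<subseteq> {e<..<h}"
      by (intro components_maximal[OF comp]) (auto intro: convex_connected)
    then show False using eh by auto
  qed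
  then obtain me where me: "supported_at P e me" by (auto simp: K0)
  have "h \<in> K0 \<phi>"
  proof (rule ccontr)
    assume "h \<notin> K0 \<phi>"
    then have "{e<..h} \<subseteq> - K0 \<phi>"
      using sub by (auto simp: subset_iff order.order_iff_strict)
    moreover have "(e + h) / 2 \<in> {e<..<h} \<inter> {e<..h}" using eh by auto
    then have "{e<..<h} \<inter> {e<..h} \<noteq> {}" by blast
    ultimately have "{e<..h} \<subseteq> {e<..<h}"
      by (intro components_maximal[OF comp]) (auto intro: convex_connected)
    then show False using eh by auto
  qed
  then obtain mh where mh: "supported_at P h mh" by (auto simp: K0)
  have Ph: "P h = P e + c * (h - e)" using eh by (simp add: c_def gap_c_def P_def)
  have me_c: "me \<le> c"
    using supported_atD[OF me, of h] Ph eh by (simp add: mult_le_cancel_right)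
  have mh_c: "c \<le> mh"
  proof -
    have "c * (h - e) \<le> mh * (h - e)"
      using supported_atD[OF mh, of e] Ph by (simp add: algebra_simps)
    then show ?thesis using eh by (simp add: mult_le_cancel_right)
  qed
  have left: "P e + c * (y - e) \<le> P y" if "y < e" for y
    using supported_atD[OF me, of y] mult_right_mono_neg[OF me_c, of "y - e"] that by linarith
  have right: "P e + c * (y - e) \<le> P y" if "h < y" for y
    using supported_atD[OF mh, of y] mult_right_mono[OF mh_c, of "y - h"] that Ph
    by (simp add: algebra_simps)
  have "continuous_on {e..h} (\<lambda>y. P y - c * y)"
    by (intro continuous_intros continuous_on_subset[OF cont]) auto
  then have "\<exists>z\<in>{e..h}. \<forall>y\<in>{e..h}. P z - c * z \<le> P y - c * y"
    by (intro continuous_attains_inf) (use eh in auto)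
  then obtain z where z: "e \<le> z" "z \<le> h" "\<And>y. e \<le> y \<Longrightarrow> y \<le> h \<Longrightarrow> P z - c * z \<le> P y - c * y"
    by auto
  have zsup: "supported_at P z c"
    unfolding supported_at_def
  proof
    fix y
    consider "y < e" | "e \<le> y" "y \<le> h" | "h < y" by linarith
    then show "P z + c * (y - z) \<le> P y"
      by cases (use left[of y] right[of y] z(3)[of y] z(3)[of e] eh in \<open>auto simp: algebra_simps\<close>)
  qed
  then have "z \<in> K0 \<phi>" by (auto simp: K0)
  then have "z = e \<or> z = h" using z(1,2) sub by (smt (verit) ComplD greaterThanLessThan_iff subsetD)
  then have e: "supported_at P e c"
    using supported_at_transfer[OF zsup, of e] Ph by (auto simp: algebra_simps)
  then show "supported_at (Phi \<phi>) e (gap_c \<phi> e h)" "supported_at (Phi \<phi>) h (gap_c \<phi> e h)"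
    using supported_at_transfer[OF e Ph] by (simp_all add: P_def c_def)
  show "Phi \<phi> e + gap_c \<phi> e h * (y - e) < Phi \<phi> y" if y: "e < y" "y < h" for y
  proof (rule ccontr)
    assume "\<not> ?thesis"
    then have "P y = P e + c * (y - e)"
      using supported_atD[OF e, of y] by (simp add: P_def c_def)
    then have "y \<in> K0 \<phi>" using supported_at_transfer[OF e] by (auto simp: K0)
    then show False using sub y by auto
  qed
qed

section \<open>Existence of contact points and slopes at the outermost ones\<close>

lemma attains_min_at_top:
  fixes g :: "real \<Rightarrow> real"
  assumes "continuous_on UNIV g" "filterlim g at_top at_top"
  shows "\<exists>z\<ge>a. \<forall>y\<ge>a. g z \<le> g y"
proof -
  obtain B where B: "\<And>y. B \<le> y \<Longrightarrow> g a \<le> g y"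
    using assms(2) unfolding filterlim_at_top eventually_at_top_linorder by blast
  have "\<exists>z\<in>{a..max a B}. \<forall>y\<in>{a..max a B}. g z \<le> g y"
    by (rule continuous_attains_inf) (auto intro: continuous_on_subset[OF assms(1)])
  then obtain z where z: "z \<in> {a..max a B}" "\<forall>y\<in>{a..max a B}. g z \<le> g y" ..
  have "g z \<le> g y" if "a \<le> y" for y
  proof (cases "y \<le> max a B")
    case False
    then have "g a \<le> g y" by (intro B) simp
    moreover have "g z \<le> g a" using z(2) by simp
    ultimately show ?thesis by simp
  qed (use z(2) that in auto)
  with z(1) show ?thesis by auto
qed

lemma tilted_at_top:
  fixes P :: "real \<Rightarrow> real"
  assumes "((\<lambda>y. P y / y) \<longlongrightarrow> r) at_top" "m < r"
  shows "filterlim (\<lambda>y. P y - m * y) at_top at_top"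
proof -
  have "((\<lambda>y. P y / y - m) \<longlongrightarrow> r - m) at_top" by (intro tendsto_intros assms)
  then have "filterlim (\<lambda>y. (P y / y - m) * y) at_top at_top"
    using assms(2) by (intro filterlim_tendsto_pos_mult_at_top[of _ "r - m"] filterlim_ident) auto
  moreover have "\<forall>\<^sub>F y in at_top. (P y / y - m) * y = P y - m * y"
    using eventually_gt_at_top[of 0] by eventually_elim (simp add: field_simps)
  ultimately show ?thesis by (simp add: filterlim_cong)
qed

text \<open>For a slope \<open>m\<close> strictly between the asymptotic slopes,
  \<open>P y - m * y\<close> tends to infinity in both directions, and its global minimum is a
  contact point. The hypothesis on \<open>l\<close> is the limit at minus infinity, written with
  reflected argument.\<close>

lemma ex_supported_at:
  fixes P :: "real \<Rightarrow> real"
  assumes cont: "continuous_on UNIV P" and "l < r"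
    and r: "((\<lambda>y. P y / y) \<longlongrightarrow> r) at_top" and l: "((\<lambda>y. P (- y) / y) \<longlongrightarrow> - l) at_top"
  shows "\<exists>x m. supported_at P x m"
proof -
  define m where "m = (l + r) / 2"
  have m: "m < r" "- m < - l" using \<open>l < r\<close> by (auto simp: m_def)
  have cont': "continuous_on UNIV (\<lambda>y. P (- y))"
    by (intro continuous_on_compose2[OF cont] continuous_intros) auto
  have "continuous_on UNIV (\<lambda>y. P y - m * y)" "continuous_on UNIV (\<lambda>y. P (- y) - (- m) * y)"
    by (intro continuous_intros cont cont')+
  from attains_min_at_top[OF this(1) tilted_at_top[OF r m(1)], of 0]
    attains_min_at_top[OF this(2) tilted_at_top[OF l m(2)], of 0]
  obtain z1 z2 where z1: "\<forall>y\<ge>0. P z1 - m * z1 \<le> P y - m * y"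
    and z2: "\<forall>y\<ge>0. P (- z2) - (- m) * z2 \<le> P (- y) - (- m) * y"
    by auto
  define z where "z = (if P z1 - m * z1 \<le> P (- z2) - m * (- z2) then z1 else - z2)"
  have "supported_at P z m"
    unfolding supported_at_def
  proof
    fix y show "P z + m * (y - z) \<le> P y"
      using z1[rule_format, of y] z2[rule_format, of "- y"]
      by (cases "0 \<le> y") (auto simp: z_def algebra_simps split: if_splits)
  qed
  then show ?thesis by blast
qed

text \<open>Dividing a support inequality by \<open>y\<close> shows that no support slope at
  \<open>x0\<close> exceeds \<open>r\<close>. If \<open>P\<close> dipped below the line of slope
  \<open>r\<close> beyond \<open>x0\<close>, a slope between that of the dip and \<open>r\<close>
  would produce a contact point further to the right.\<close>

lemma Sup_supported_points:
  fixes P :: "real \<Rightarrow> real"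
  assumes cont: "continuous_on UNIV P" and r: "((\<lambda>y. P y / y) \<longlongrightarrow> r) at_top"
    and ne: "\<exists>x m. supported_at P x m" and bdd: "bdd_above {x. \<exists>m. supported_at P x m}"
  defines "x0 \<equiv> Sup {x. \<exists>m. supported_at P x m}"
  shows "supported_at P x0 r" "\<And>y. x0 < y \<Longrightarrow> P x0 + r * (y - x0) < P y"
proof -
  define K where "K = {x. \<exists>m. supported_at P x m}"
  have "x0 \<in> K"
    unfolding x0_def K_def using closed_supported_points[OF cont] ne bdd
    by (intro closed_contains_Sup) auto
  then obtain m where m: "supported_at P x0 m" by (auto simp: K_def)
  have not_K: "y \<notin> K" if "x0 < y" for y
    using that bdd cSup_upper[of y K] by (auto simp: x0_def K_def)
  have "m \<le> r"
  proof (rule tendsto_le[OF _ r])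
    have "((\<lambda>y. (P x0 - m * x0) / y + m) \<longlongrightarrow> 0 + m) at_top"
      by (intro tendsto_intros tendsto_divide_0[OF tendsto_const]
          filterlim_at_top_imp_at_infinity filterlim_ident)
    then show "((\<lambda>y. (P x0 - m * x0) / y + m) \<longlongrightarrow> m) at_top" by simp
    show "\<forall>\<^sub>F y in at_top. (P x0 - m * x0) / y + m \<le> P y / y"
      using eventually_gt_at_top[of 0]
    proof eventually_elim
      case (elim y)
      then have "(P x0 - m * x0 + m * y) / y \<le> P y / y"
        using supported_atD[OF m, of y] by (intro divide_right_mono) (auto simp: algebra_simps)
      then show ?case using elim by (simp add: add_divide_distrib)
    qed
  qed simp
  have ge: "P x0 + r * (y - x0) \<le> P y" if "x0 < y" for y
  proof (rule ccontr)
    assume neg: "\<not> ?thesis"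
    define s where "s = (P y - P x0) / (y - x0)"
    have s: "P y = P x0 + s * (y - x0)" using that by (simp add: s_def)
    have "s < r" using neg that s by simp
    \<comment> \<open>\<open>m' < r\<close> makes the tilted function coercive,
      \<open>s < m'\<close> moves its minimum away from \<open>x0\<close>, and
      \<open>m \<le> s < m'\<close> keeps the new line below \<open>P\<close> to the left of
      \<open>x0\<close>.\<close>
    then obtain m' where m': "s < m'" "m' < r" using dense by blast
    have "m \<le> s" using supported_atD[OF m, of y] s that by simp
    have "continuous_on UNIV (\<lambda>y. P y - m' * y)"
      by (intro continuous_intros cont)
    from attains_min_at_top[OF this tilted_at_top[OF r m'(2)], of x0]
    obtain z where z: "x0 \<le> z" "\<And>y. x0 \<le> y \<Longrightarrow> P z - m' * z \<le> P y - m' * y"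
      by auto
    have "s * (y - x0) < m' * (y - x0)" using m' that by simp
    then have "P y - m' * y < P x0 - m' * x0" using s by (simp add: algebra_simps)
    then have "z \<noteq> x0" using z(2)[of y] that by auto
    have "supported_at P z m'"
      unfolding supported_at_def
    proof
      fix v show "P z + m' * (v - z) \<le> P v"
      proof (cases "x0 \<le> v")
        case True
        then show ?thesis using z(2)[of v] by (simp add: algebra_simps)
      next
        case False
        then have "m' * (v - x0) \<le> m * (v - x0)"
          using \<open>m \<le> s\<close> m' by (intro mult_right_mono_neg) auto
        then show ?thesis
          using supported_atD[OF m, of v] z(2)[of x0] by (simp add: algebra_simps)
      qed
    qed
    then have "z \<in> K" by (auto simp: K_def)
    then show False using not_K[of z] z(1) \<open>z \<noteq> x0\<close> by simp
  qed
  show sup: "supported_at P x0 r"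
    unfolding supported_at_def
  proof
    fix y
    consider "y < x0" | "y = x0" | "x0 < y" by linarith
    then show "P x0 + r * (y - x0) \<le> P y"
    proof cases
      case 1
      then have "r * (y - x0) \<le> m * (y - x0)"
        using \<open>m \<le> r\<close> by (intro mult_right_mono_neg) auto
      then show ?thesis using supported_atD[OF m, of y] by linarith
    qed (use ge in auto)
  qed
  show "P x0 + r * (y - x0) < P y" if "x0 < y" for y
  proof (rule ccontr)
    assume "\<not> ?thesis"
    then have "P y = P x0 + r * (y - x0)" using ge[OF that] by simp
    then have "y \<in> K" using supported_at_transfer[OF sup] by (auto simp: K_def)
    then show False using not_K[OF that] by simp
  qed
qed

subsection \<open>Reflection and asymptotics of the flux\<close>

lemma deriv_reflect:
  assumes "flux f"
  shows "deriv (\<lambda>v. f (- v)) = (\<lambda>v. - deriv f (- v))"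
    and "deriv (\<lambda>v. - deriv f (- v)) = (\<lambda>v. deriv (deriv f) (- v))"
    and "(\<lambda>v. f (- v)) field_differentiable at v"
    and "(\<lambda>v. - deriv f (- v)) field_differentiable at v"
proof -
  have 1: "((\<lambda>v. f (- v)) has_real_derivative - deriv f (- v)) (at v)" for v
    using DERIV_mirror[THEN iffD1, OF flux_deriv[OF assms, of "- v"]] .
  have 2: "((\<lambda>v. - deriv f (- v)) has_real_derivative deriv (deriv f) (- v)) (at v)" for v
    using DERIV_minus[OF DERIV_mirror[THEN iffD1, OF flux_deriv2[OF assms, of "- v"]]] by simp
  show "deriv (\<lambda>v. f (- v)) = (\<lambda>v. - deriv f (- v))"
    "deriv (\<lambda>v. - deriv f (- v)) = (\<lambda>v. deriv (deriv f) (- v))"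
    using DERIV_imp_deriv[OF 1] DERIV_imp_deriv[OF 2] by auto
  show "(\<lambda>v. f (- v)) field_differentiable at v" "(\<lambda>v. - deriv f (- v)) field_differentiable at v"
    using 1 2 by (auto simp: field_differentiable_def)
qed

lemma flux_reflect:
  assumes f: "flux f"
  shows "flux (\<lambda>v. f (- v))"
proof -
  note d = deriv_reflect[OF f]
  have cont: "continuous_on UNIV (\<lambda>v. deriv (deriv f) (- v))"
    by (rule continuous_on_compose2[OF flux_continuous_deriv2[OF f, of UNIV]])
       (auto intro: continuous_intros)
  have "{v. deriv (deriv f) v = 0} \<in> null_sets lebesgue"
    using f by (simp add: flux_def)
  then have "negligible (uminus ` {v. deriv (deriv f) v = 0})"
    by (intro negligible_locally_Lipschitz_image exI[of _ UNIV] exI[of _ 1])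
       (auto simp: negligible_iff_null_sets)
  moreover have "uminus ` {v. deriv (deriv f) v = 0} = {v. deriv (deriv f) (- v) = 0}"
    by force
  ultimately have "{v. deriv (deriv f) (- v) = 0} \<in> null_sets lebesgue"
    by (simp add: negligible_iff_null_sets)
  then show ?thesis
    unfolding flux_def C2_def d(1,2) using d(3,4) cont flux_deriv2_nonneg[OF f] by auto
qed

lemma bregman_reflect: "flux f \<Longrightarrow> bregman (\<lambda>v. f (- v)) (- c) v = bregman f c (- v)"
  by (simp add: bregman_def deriv_reflect algebra_simps)

lemma cost_reflect:
  "flux f \<Longrightarrow> cost (\<lambda>v. f (- v)) (\<lambda>y. P (- y)) (- x) t v = cost f P x t (- v)"
  by (simp add: cost_def deriv_reflect algebra_simps)

lemma minimizers_reflect: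
  assumes f: "flux f" and v: "v \<in> minimizers f P x t"
  shows "- v \<in> minimizers (\<lambda>v. f (- v)) (\<lambda>y. P (- y)) (- x) t"
  using minimizers_le[OF v] by (simp add: minimizers_def cost_reflect[OF f])

lemma tendsto_at_reflect:
  fixes g :: "real \<Rightarrow> real"
  shows "((\<lambda>v. g (- v)) \<longlongrightarrow> N) (at (- c)) \<longleftrightarrow> (g \<longlongrightarrow> N) (at c)"
  unfolding filtermap_at_minus[of c, symmetric] filterlim_filtermap by simp

lemma flux_exponent_reflect:
  assumes f: "flux f" and "flux_exponent f c \<alpha>"
  shows "flux_exponent (\<lambda>v. f (- v)) (- c) \<alpha>"
proof -
  have eq: "\<bar>v - - c\<bar> = \<bar>- v - c\<bar>" for v by linarith
  show ?thesis
    using assms(2)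
    unfolding flux_exponent_def deriv_reflect(1,2)[OF f] eq
      tendsto_at_reflect[of "\<lambda>v. deriv (deriv f) v / \<bar>v - c\<bar> powr \<alpha>"] .
qed

section \<open>Power laws of the speed and of the Bregman distance near a state\<close>

lemma flux_deriv_ratio:
  assumes f: "flux f" and \<alpha>: "0 \<le> \<alpha>"
    and N: "((\<lambda>v. deriv (deriv f) v / \<bar>v - c\<bar> powr \<alpha>) \<longlongrightarrow> N) (at c)"
  shows "((\<lambda>v. (deriv f v - deriv f c) / (v - c) powr (1 + \<alpha>)) \<longlongrightarrow> N / (1 + \<alpha>)) (at_right c)"
proof (rule lhopital_right[where f' = "deriv (deriv f)" and g' = "\<lambda>v. (1 + \<alpha>) * (v - c) powr \<alpha>"])
  have gt: "\<forall>\<^sub>F v in at_right c. c < v" by (simp add: eventually_at_right_less)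
  have "isCont (deriv f) c" by (rule DERIV_isCont[OF flux_deriv2[OF f]])
  then have "(deriv f \<longlongrightarrow> deriv f c) (at_right c)"
    by (simp add: isCont_def filterlim_at_split)
  then show "((\<lambda>v. deriv f v - deriv f c) \<longlongrightarrow> 0) (at_right c)"
    by (rule LIM_zero)
  have "((\<lambda>v. (v - c) powr (1 + \<alpha>)) \<longlongrightarrow> (c - c) powr (1 + \<alpha>)) (at_right c)"
    using \<alpha> gt by (intro tendsto_powr2 tendsto_intros) (auto elim: eventually_mono)
  then show "((\<lambda>v. (v - c) powr (1 + \<alpha>)) \<longlongrightarrow> 0) (at_right c)" by simp
  show "\<forall>\<^sub>F v in at_right c. (v - c) powr (1 + \<alpha>) \<noteq> 0"
    using gt by eventually_elim simp
  show "\<forall>\<^sub>F v in at_right c. (1 + \<alpha>) * (v - c) powr \<alpha> \<noteq> 0"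
    using gt by eventually_elim (use \<alpha> in simp)
  show "\<forall>\<^sub>F v in at_right c. ((\<lambda>v. deriv f v - deriv f c) has_real_derivative deriv (deriv f) v) (at v)"
    by (intro always_eventually allI) (auto intro!: derivative_eq_intros flux_deriv2[OF f])
  show "\<forall>\<^sub>F v in at_right c. ((\<lambda>v. (v - c) powr (1 + \<alpha>)) has_real_derivative
      (1 + \<alpha>) * (v - c) powr \<alpha>) (at v)"
    using gt by eventually_elim (auto intro!: derivative_eq_intros)
  have "((\<lambda>v. deriv (deriv f) v / \<bar>v - c\<bar> powr \<alpha> / (1 + \<alpha>)) \<longlongrightarrow> N / (1 + \<alpha>)) (at_right c)"
    using N \<alpha> by (intro tendsto_intros) (auto simp: filterlim_at_split)
  then show "((\<lambda>v. deriv (deriv f) v / ((1 + \<alpha>) * (v - c) powr \<alpha>)) \<longlongrightarrow> N / (1 + \<alpha>)) (at_right c)"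
  proof (rule Lim_transform_eventually)
    show "\<forall>\<^sub>F v in at_right c. deriv (deriv f) v / \<bar>v - c\<bar> powr \<alpha> / (1 + \<alpha>)
        = deriv (deriv f) v / ((1 + \<alpha>) * (v - c) powr \<alpha>)"
      using gt by eventually_elim (simp add: field_simps)
  qed
qed

text \<open>The derivatives in \<open>v\<close> are \<open>(v - c) f''\<close> above and
  \<open>(1 + a) D^a f''\<close> below, so \<open>f''\<close> cancels and
  \<open>(v - c) / D^a\<close> remains, governed by the power law of the speed. In terms of the
  speed increment the Bregman distance thus has order \<open>1 + 1 / (1 + \<alpha>)\<close>.\<close>

lemma bregman_ratio_right:
  assumes f: "flux f" and \<alpha>: "0 \<le> \<alpha>" and Npos: "0 < N"
    and N: "((\<lambda>v. deriv (deriv f) v / \<bar>v - c\<bar> powr \<alpha>) \<longlongrightarrow> N) (at c)"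
  shows "((\<lambda>v. bregman f c v / \<bar>deriv f v - deriv f c\<bar> powr (1 + 1 / (1 + \<alpha>))) \<longlongrightarrow>
    (N / (1 + \<alpha>)) powr (- 1 / (1 + \<alpha>)) / (1 + 1 / (1 + \<alpha>))) (at_right c)"
proof -
  define a where "a = 1 / (1 + \<alpha>)"
  have a: "0 < a" using \<alpha> by (simp add: a_def)
  define D where "D = (\<lambda>v. deriv f v - deriv f c)"
  have gt: "\<forall>\<^sub>F v in at_right c. c < v" by (simp add: eventually_at_right_less)
  then have D_pos: "\<forall>\<^sub>F v in at_right c. 0 < D v"
    by eventually_elim (simp add: D_def flux_deriv_less_iff[OF f])
  have "isCont (deriv f) c" by (rule DERIV_isCont[OF flux_deriv2[OF f]])
  then have Dc: "(deriv f \<longlongrightarrow> deriv f c) (at_right c)"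
    by (simp add: isCont_def filterlim_at_split)
  then have D0: "(D \<longlongrightarrow> 0) (at_right c)"
    unfolding D_def by (rule LIM_zero)
  have fc: "(f \<longlongrightarrow> f c) (at_right c)"
    using DERIV_isCont[OF flux_deriv[OF f]] by (simp add: isCont_def filterlim_at_split)
  have N': "\<forall>\<^sub>F v in at_right c. deriv (deriv f) v \<noteq> 0"
  proof -
    have "((\<lambda>v. deriv (deriv f) v / \<bar>v - c\<bar> powr \<alpha>) \<longlongrightarrow> N) (at_right c)"
      using N by (simp add: filterlim_at_split)
    from order_tendstoD(1)[OF this Npos] show ?thesis by eventually_elim auto
  qed
  have "((\<lambda>v. bregman f c v / D v powr (1 + a)) \<longlongrightarrow> (N / (1 + \<alpha>)) powr (- a) / (1 + a)) (at_right c)"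
  proof (rule lhopital_right[where f' = "\<lambda>v. (v - c) * deriv (deriv f) v"
        and g' = "\<lambda>v. (1 + a) * D v powr a * deriv (deriv f) v"])
    have "((\<lambda>v. (v - c) * deriv f v - f v + f c) \<longlongrightarrow> (c - c) * deriv f c - f c + f c) (at_right c)"
      by (intro tendsto_intros Dc fc)
    then show "(bregman f c \<longlongrightarrow> 0) (at_right c)"
      unfolding bregman_def by simp
    have "((\<lambda>v. D v powr (1 + a)) \<longlongrightarrow> 0 powr (1 + a)) (at_right c)"
      using a D_pos by (intro tendsto_powr2 tendsto_intros D0) (auto elim: eventually_mono)
    then show "((\<lambda>v. D v powr (1 + a)) \<longlongrightarrow> 0) (at_right c)" by simp
    show "\<forall>\<^sub>F v in at_right c. D v powr (1 + a) \<noteq> 0"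
      using D_pos by eventually_elim simp
    show "\<forall>\<^sub>F v in at_right c. (1 + a) * D v powr a * deriv (deriv f) v \<noteq> 0"
      using D_pos N' by eventually_elim (use a in simp)
    show "\<forall>\<^sub>F v in at_right c. (bregman f c has_real_derivative (v - c) * deriv (deriv f) v) (at v)"
      unfolding bregman_def
      by (intro always_eventually allI)
         (auto intro!: derivative_eq_intros flux_deriv[OF f] flux_deriv2[OF f])
    show "\<forall>\<^sub>F v in at_right c. ((\<lambda>v. D v powr (1 + a)) has_real_derivative
        (1 + a) * D v powr a * deriv (deriv f) v) (at v)"
      using D_pos
    proof eventually_elim
      case (elim v)
      have "(D has_real_derivative deriv (deriv f) v) (at v)"
        unfolding D_def by (auto intro!: derivative_eq_intros flux_deriv2[OF f])
      then show ?case using elim by (auto intro!: derivative_eq_intros)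
    qed
    have "((\<lambda>v. (D v / (v - c) powr (1 + \<alpha>)) powr (- a) / (1 + a)) \<longlongrightarrow>
        (N / (1 + \<alpha>)) powr (- a) / (1 + a)) (at_right c)"
      unfolding D_def using a Npos \<alpha> by (intro tendsto_intros flux_deriv_ratio[OF f \<alpha> N]) auto
    then show "((\<lambda>v. (v - c) * deriv (deriv f) v / ((1 + a) * D v powr a * deriv (deriv f) v)) \<longlongrightarrow>
        (N / (1 + \<alpha>)) powr (- a) / (1 + a)) (at_right c)"
    proof (rule Lim_transform_eventually)
      show "\<forall>\<^sub>F v in at_right c. (D v / (v - c) powr (1 + \<alpha>)) powr (- a) / (1 + a)
          = (v - c) * deriv (deriv f) v / ((1 + a) * D v powr a * deriv (deriv f) v)"
        using D_pos N' gt
      proof eventually_elim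
        case (elim v)
        have "((v - c) powr (1 + \<alpha>)) powr a = v - c"
          using elim \<alpha> by (simp add: powr_powr a_def)
        then have "(D v / (v - c) powr (1 + \<alpha>)) powr (- a) = (v - c) / D v powr a"
          using elim by (simp add: powr_minus powr_divide)
        then show ?case using elim by simp
      qed
    qed
  qed
  then show ?thesis
  proof (rule Lim_transform_eventually[OF tendsto_eq_rhs])
    show "\<forall>\<^sub>F v in at_right c. bregman f c v / D v powr (1 + a)
        = bregman f c v / \<bar>deriv f v - deriv f c\<bar> powr (1 + 1 / (1 + \<alpha>))"
      using D_pos by eventually_elim (simp add: D_def a_def)
  qed (simp add: a_def)
qed

text \<open>The constant \<open>K\<close> is the same on both sides of \<open>c\<close>, since the
  left limit is the right limit for the reflected flux. The balance in a bounded gap relies on this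
  equality.\<close>

lemma bregman_ratio:
  assumes f: "flux f" and \<alpha>: "flux_exponent f c \<alpha>"
  obtains K where "0 < K"
    "((\<lambda>v. bregman f c v / \<bar>deriv f v - deriv f c\<bar> powr (1 + 1 / (1 + \<alpha>))) \<longlongrightarrow> K) (at c)"
proof -
  obtain N where N: "0 \<le> \<alpha>" "0 < N" "((\<lambda>v. deriv (deriv f) v / \<bar>v - c\<bar> powr \<alpha>) \<longlongrightarrow> N) (at c)"
    using \<alpha> by (auto simp: flux_exponent_def)
  define K where "K = (N / (1 + \<alpha>)) powr (- 1 / (1 + \<alpha>)) / (1 + 1 / (1 + \<alpha>))"
  have "0 < K" using N by (simp add: K_def add_pos_nonneg)
  have eq: "\<bar>v - - c\<bar> = \<bar>- v - c\<bar>" for v by linarith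
  have N': "((\<lambda>v. deriv (deriv (\<lambda>v. f (- v))) v / \<bar>v - - c\<bar> powr \<alpha>) \<longlongrightarrow> N) (at (- c))"
    using N(3) unfolding deriv_reflect(1,2)[OF f] eq
      tendsto_at_reflect[of "\<lambda>v. deriv (deriv f) v / \<bar>v - c\<bar> powr \<alpha>"] .
  have "((\<lambda>v. bregman f c v / \<bar>deriv f v - deriv f c\<bar> powr (1 + 1 / (1 + \<alpha>))) \<longlongrightarrow> K) (at_right c)"
    unfolding K_def by (rule bregman_ratio_right[OF f N])
  moreover have "((\<lambda>v. bregman f c v / \<bar>deriv f v - deriv f c\<bar> powr (1 + 1 / (1 + \<alpha>))) \<longlongrightarrow> K) (at_left c)"
    using bregman_ratio_right[OF flux_reflect[OF f] N(1,2) N']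
    unfolding K_def filterlim_at_left_to_right[of _ _ c] bregman_reflect[OF f] deriv_reflect(1)[OF f]
    by (simp add: abs_minus_commute)
  ultimately show ?thesis
    using that[OF \<open>0 < K\<close>] by (simp add: filterlim_at_split)
qed

text \<open>The local inverse of \<open>f'\<close> is Hoelder with exponent
  \<open>1 / (1 + \<alpha>)\<close> at \<open>f' c\<close>. It is stated through preimages because
  \<open>f'\<close> may fail to be onto; \<open>\<delta>\<close> is a speed increment attained
  inside the interval where the ratio exceeds half its limit.\<close>

lemma inverse_deriv_rate:
  assumes f: "flux f" and \<alpha>: "flux_exponent f c \<alpha>"
  obtains C \<delta> where "0 < C" "0 < \<delta>"
    "\<And>s. 0 \<le> s \<Longrightarrow> s \<le> \<delta> \<Longrightarrow> \<exists>v\<ge>c. deriv f v = deriv f c + s \<and> v - c \<le> C * s powr (1 / (1 + \<alpha>))"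
proof -
  obtain N where N: "0 \<le> \<alpha>" "0 < N" "((\<lambda>v. deriv (deriv f) v / \<bar>v - c\<bar> powr \<alpha>) \<longlongrightarrow> N) (at c)"
    using \<alpha> by (auto simp: flux_exponent_def)
  define k where "k = N / (1 + \<alpha>) / 2"
  have k: "0 < k" "k < N / (1 + \<alpha>)"
  proof -
    show "0 < k" using N by (simp add: k_def)
    moreover have "k + k = N / (1 + \<alpha>)" unfolding k_def by (rule field_sum_of_halves)
    ultimately show "k < N / (1 + \<alpha>)" by linarith
  qed
  from order_tendstoD(1)[OF flux_deriv_ratio[OF f N(1,3)] k(2)]
  obtain b where b: "c < b" "\<And>v. c < v \<Longrightarrow> v < b \<Longrightarrow> k < (deriv f v - deriv f c) / (v - c) powr (1 + \<alpha>)"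
    unfolding eventually_at_right_field by blast
  define m where "m = (c + b) / 2"
  have m: "c < m" "m < b" using b(1) by (auto simp: m_def)
  define C where "C = (1 / k) powr (1 / (1 + \<alpha>))"
  have "\<exists>v\<ge>c. deriv f v = deriv f c + s \<and> v - c \<le> C * s powr (1 / (1 + \<alpha>))"
    if s: "0 \<le> s" "s \<le> deriv f m - deriv f c" for s
  proof -
    obtain v where v: "deriv f v = deriv f c + s"
      using flux_deriv_between[OF f, of c "deriv f c + s" m] s by auto
    have "c \<le> v" "v < b"
      using s v m flux_deriv_le_iff[OF f, of c v] flux_deriv_le_iff[OF f, of v m] by auto
    moreover have "v - c \<le> C * s powr (1 / (1 + \<alpha>))"
    proof (cases "v = c")
      case False
      then have "k * (v - c) powr (1 + \<alpha>) \<le> s"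
        using b(2)[of v] v \<open>c \<le> v\<close> \<open>v < b\<close> by (simp add: field_simps)
      then have "(v - c) powr (1 + \<alpha>) \<le> 1 / k * s" using k by (simp add: field_simps)
      then have "((v - c) powr (1 + \<alpha>)) powr (1 / (1 + \<alpha>)) \<le> (1 / k * s) powr (1 / (1 + \<alpha>))"
        using N(1) by (intro powr_mono2) auto
      also have "\<dots> = C * s powr (1 / (1 + \<alpha>))"
        by (simp only: C_def powr_mult)
      finally show ?thesis
        using N(1) \<open>c \<le> v\<close> False by (simp add: powr_powr)
    qed (use s k in \<open>simp add: C_def\<close>)
    ultimately show ?thesis using v by blast
  qed
  moreover have "0 < deriv f m - deriv f c" using m by (simp add: flux_deriv_less_iff[OF f])
  moreover have "0 < C" using k by (simp add: C_def)
  ultimately show ?thesis using that by blast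
qed

lemma flux_deriv_tendsto_cancel:
  assumes f: "flux f" and lim: "((\<lambda>t. deriv f (v t)) \<longlongrightarrow> deriv f c) F"
  shows "(v \<longlongrightarrow> c) F"
proof (rule order_tendstoI)
  fix a assume "a < c"
  then show "\<forall>\<^sub>F t in F. a < v t"
    using order_tendstoD(1)[OF lim, of "deriv f a"] by (simp add: flux_deriv_less_iff[OF f])
next
  fix a assume "c < a"
  then show "\<forall>\<^sub>F t in F. v t < a"
    using order_tendstoD(2)[OF lim, of "deriv f a"] by (simp add: flux_deriv_less_iff[OF f])
qed

subsection \<open>Backward characteristics to the right of a divide\<close>

text \<open>The left (or, after reflection, right) boundaries of the nested backward triangles along a
  forward generalized characteristic \<open>X\<close>; \<open>V\<close> is the extremal minimizer.\<close>

definition nested_backward ::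
    "(real \<Rightarrow> real) \<Rightarrow> (real \<Rightarrow> real) \<Rightarrow> (real \<Rightarrow> real) \<Rightarrow> (real \<Rightarrow> real) \<Rightarrow> bool" where
  "nested_backward f P X V \<longleftrightarrow> (\<forall>t>0. V t \<in> minimizers f P (X t) t) \<and>
     (\<forall>\<tau> t1 t2. 0 < \<tau> \<and> \<tau> < t1 \<and> t1 < t2 \<longrightarrow>
        X t2 - (t2 - \<tau>) * deriv f (V t2) \<le> X t1 - (t1 - \<tau>) * deriv f (V t1))"

text \<open>The backward triangles omit the initial line, so the nesting is available only at times
  \<open>\<tau> > 0\<close>; letting \<open>\<tau>\<close> decrease to 0 gives it for the
  feet.\<close>

lemma nested_backward_foot_antimono:
  assumes nb: "nested_backward f P X V" and t: "0 < t1" "t1 \<le> t2"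
  shows "X t2 - t2 * deriv f (V t2) \<le> X t1 - t1 * deriv f (V t1)"
proof (cases "t1 = t2")
  case False
  show ?thesis
  proof (rule tendsto_le)
    show "((\<lambda>\<tau>. X t1 - (t1 - \<tau>) * deriv f (V t1)) \<longlongrightarrow> X t1 - t1 * deriv f (V t1)) (at_right 0)"
      "((\<lambda>\<tau>. X t2 - (t2 - \<tau>) * deriv f (V t2)) \<longlongrightarrow> X t2 - t2 * deriv f (V t2)) (at_right 0)"
      by (auto intro!: tendsto_eq_intros)
    have "\<forall>\<^sub>F \<tau> in at_right 0. \<tau> < t1"
      using t by (intro order_tendstoD[OF tendsto_ident_at])
    then show "\<forall>\<^sub>F \<tau> in at_right 0. X t2 - (t2 - \<tau>) * deriv f (V t2) \<le> X t1 - (t1 - \<tau>) * deriv f (V t1)"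
      using eventually_at_right_less[of 0]
      by eventually_elim (use nb t False in \<open>auto simp: nested_backward_def\<close>)
  qed simp
qed simp

text \<open>A one-sided setting, used with \<open>u_left\<close> at a left divide and, for the
  reflected flux and primitive, with \<open>- u_right\<close> at a right one. \<open>s t\<close> is
  the speed of the segment from \<open>e\<close> to \<open>X t\<close> minus \<open>f' c\<close>,
  that is, the distance from the divide divided by \<open>t\<close>.\<close>

locale right_of_divide =
  fixes f P :: "real \<Rightarrow> real" and e c \<alpha> :: real and X V s :: "real \<Rightarrow> real"
  assumes f: "flux f" and sup: "supported_at P e c" and exponent: "flux_exponent f c \<alpha>"
    and nb: "nested_backward f P X V"
    and right: "\<And>t. 0 < t \<Longrightarrow> e + t * deriv f c < X t"
  defines "s \<equiv> \<lambda>t. (X t - e - t * deriv f c) / t"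
begin

definition Y :: "real \<Rightarrow> real" where "Y t = X t - t * deriv f (V t)"

definition excess :: "real \<Rightarrow> real" where "excess y = P y - (P e + c * (y - e))"

lemma V: "0 < t \<Longrightarrow> V t \<in> minimizers f P (X t) t"
  using nb by (auto simp: nested_backward_def)

lemma excess_nonneg: "0 \<le> excess y"
  using supported_atD[OF sup, of y] by (simp add: excess_def)

lemma Y_ge: "0 < t \<Longrightarrow> e \<le> Y t"
  unfolding Y_def by (rule minimizers_foot_ge[OF f _ sup right V])

lemma Y_antimono: "0 < t1 \<Longrightarrow> t1 \<le> t2 \<Longrightarrow> Y t2 \<le> Y t1"
  unfolding Y_def by (rule nested_backward_foot_antimono[OF nb])

lemma s_pos: "0 < t \<Longrightarrow> 0 < s t"
  using right[of t] by (simp add: s_def)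

lemma exponent_nonneg: "0 \<le> \<alpha>"
  using exponent by (simp add: flux_exponent_def)

text \<open>The competitor with foot \<open>e\<close> at \<open>X t\<close> has speed
  \<open>f' c + s t\<close>; for small \<open>s t\<close> the inverse rate of \<open>f'\<close>
  bounds the distance of its state from \<open>c\<close>.\<close>

lemma excess_foot_le:
  assumes s0: "(s \<longlongrightarrow> 0) at_top"
  obtains C where "0 < C"
    "\<forall>\<^sub>F t in at_top. excess (Y t) \<le> C * s t powr (1 / (1 + \<alpha>)) * (Y t - e)"
proof -
  obtain C \<delta> where C: "0 < C" "0 < \<delta>"
    "\<And>s. 0 \<le> s \<Longrightarrow> s \<le> \<delta> \<Longrightarrow> \<exists>v\<ge>c. deriv f v = deriv f c + s \<and> v - c \<le> C * s powr (1 / (1 + \<alpha>))"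
    using inverse_deriv_rate[OF f exponent] by blast
  have "\<forall>\<^sub>F t in at_top. s t < \<delta>" using order_tendstoD(2)[OF s0 C(2)] .
  then have "\<forall>\<^sub>F t in at_top. excess (Y t) \<le> C * s t powr (1 / (1 + \<alpha>)) * (Y t - e)"
    using eventually_gt_at_top[of 0]
  proof eventually_elim
    case (elim t)
    obtain v where v: "deriv f v = deriv f c + s t" "v - c \<le> C * s t powr (1 / (1 + \<alpha>))"
      using C(3)[of "s t"] elim s_pos[of t] by auto
    have "deriv f v = (X t - e) / t" using v elim by (simp add: s_def field_simps)
    then have "excess (Y t) \<le> (v - c) * (Y t - e)"
      using minimizers_excess_le[OF f elim(2) V[OF elim(2)], of v e c] by (simp add: excess_def Y_def)
    also have "\<dots> \<le> C * s t powr (1 / (1 + \<alpha>)) * (Y t - e)"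
      using v Y_ge[OF elim(2)] by (intro mult_right_mono) auto
    finally show ?case .
  qed
  then show ?thesis using that C(1) by blast
qed

lemma excess_foot_tendsto:
  assumes s0: "(s \<longlongrightarrow> 0) at_top"
  shows "((\<lambda>t. excess (Y t)) \<longlongrightarrow> 0) at_top"
proof -
  obtain C where C: "0 < C" "\<forall>\<^sub>F t in at_top. excess (Y t) \<le> C * s t powr (1 / (1 + \<alpha>)) * (Y t - e)"
    using excess_foot_le[OF s0] .
  show ?thesis
  proof (rule tendsto_sandwich[where f = "\<lambda>_. 0"])
    have "\<forall>\<^sub>F t in at_top. 0 \<le> s t"
      using eventually_gt_at_top[of 0] by eventually_elim (simp add: s_pos less_imp_le)
    then have "((\<lambda>t. s t powr (1 / (1 + \<alpha>))) \<longlongrightarrow> 0 powr (1 / (1 + \<alpha>))) at_top"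
      using s0 exponent_nonneg by (intro tendsto_powr2 tendsto_const) auto
    then have "((\<lambda>t. C * s t powr (1 / (1 + \<alpha>)) * (Y 1 - e)) \<longlongrightarrow> C * 0 * (Y 1 - e)) at_top"
      using exponent_nonneg by (intro tendsto_intros) simp
    then show "((\<lambda>t. C * s t powr (1 / (1 + \<alpha>)) * (Y 1 - e)) \<longlongrightarrow> 0) at_top" by simp
    show "\<forall>\<^sub>F t in at_top. excess (Y t) \<le> C * s t powr (1 / (1 + \<alpha>)) * (Y 1 - e)"
      using C(2) eventually_ge_at_top[of 1]
    proof eventually_elim
      case (elim t)
      have "C * s t powr (1 / (1 + \<alpha>)) * (Y t - e) \<le> C * s t powr (1 / (1 + \<alpha>)) * (Y 1 - e)"
        using C(1) Y_antimono[of 1 t] elim by (intro mult_left_mono) auto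
      then show ?case using elim by simp
    qed
  qed (use excess_nonneg in auto)
qed

lemma Y_convergent:
  obtains y where "(Y \<longlongrightarrow> y) at_top" "\<And>t. 0 < t \<Longrightarrow> y \<le> Y t" "e \<le> y"
proof -
  define y where "y = (INF t\<in>{1..}. Y t)"
  have bdd: "bdd_below (Y ` {1..})"
    using Y_ge by (intro bdd_belowI2[where m = e]) auto
  have le1: "y \<le> Y t" if "1 \<le> t" for t
    unfolding y_def using that by (intro cINF_lower bdd) auto
  have le: "y \<le> Y t" if "0 < t" for t
    using le1[of "max 1 t"] Y_antimono[of t "max 1 t"] that by simp
  have "(Y \<longlongrightarrow> y) at_top"
  proof (rule order_tendstoI)
    fix a assume "a < y"
    then show "\<forall>\<^sub>F t in at_top. a < Y t"
      by (intro eventually_mono[OF eventually_ge_at_top[of 1]]) (use le1 in force)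
  next
    fix a assume "y < a"
    then obtain t0 where t0: "1 \<le> t0" "Y t0 < a"
      using bdd by (auto simp: y_def cINF_less_iff)
    show "\<forall>\<^sub>F t in at_top. Y t < a"
      using eventually_ge_at_top[of t0]
    proof eventually_elim
      case (elim t)
      then show ?case using Y_antimono[of t0 t] t0 by simp
    qed
  qed
  moreover have "e \<le> y" unfolding y_def using Y_ge by (intro cINF_greatest) auto
  ultimately show ?thesis using that le by blast
qed

lemma excess_limit_zero:
  assumes "continuous_on UNIV P" "(s \<longlongrightarrow> 0) at_top" "(Y \<longlongrightarrow> y) at_top"
  shows "excess y = 0"
proof -
  have "continuous_on UNIV excess"
    unfolding excess_def by (intro continuous_intros assms)
  then have "((\<lambda>t. excess (Y t)) \<longlongrightarrow> excess y) at_top"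
    using assms(3) by (rule continuous_on_tendsto_compose) auto
  then show ?thesis
    using excess_foot_tendsto[OF assms(2)] by (rule tendsto_unique[OF trivial_limit_at_top_linorder])
qed

lemma Y_tendsto:
  assumes "continuous_on UNIV P" "(s \<longlongrightarrow> 0) at_top" and pos: "\<And>y. e < y \<Longrightarrow> 0 < excess y"
  shows "(Y \<longlongrightarrow> e) at_top"
proof -
  obtain y where y: "(Y \<longlongrightarrow> y) at_top" "e \<le> y" using Y_convergent by blast
  have "y = e" using excess_limit_zero[OF assms(1,2) y(1)] pos[of y] y(2) by force
  then show ?thesis using y(1) by simp
qed

text \<open>If \<open>Y\<close> did not tend to \<open>e\<close>, it would be constantly \<open>h\<close>; then the backward characteristics
  through \<open>X\<close> would all emanate from \<open>h\<close> with nonincreasing speed below \<open>f'(c)\<close>, and \<open>X\<close> would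
  leave the strip through its left boundary.\<close>

lemma Y_tendsto_gap:
  assumes cont: "continuous_on UNIV P" and h: "supported_at P h c"
    and pos: "\<And>y. e < y \<Longrightarrow> y < h \<Longrightarrow> 0 < excess y"
    and left: "\<And>t. 0 < t \<Longrightarrow> X t < h + t * deriv f c"
    and s0: "(s \<longlongrightarrow> 0) at_top"
  shows "(Y \<longlongrightarrow> e) at_top"
proof -
  obtain y where y: "(Y \<longlongrightarrow> y) at_top" "\<And>t. 0 < t \<Longrightarrow> y \<le> Y t" "e \<le> y" using Y_convergent by blast
  have le: "Y t \<le> h" if "0 < t" for t
    unfolding Y_def by (rule minimizers_foot_le[OF f that h left[OF that] V[OF that]])
  have "y \<le> h" using y(2)[of 1] le[of 1] by simp
  have "y = e"
  proof (rule ccontr)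
    assume "y \<noteq> e"
    then have "y = h"
      using excess_limit_zero[OF cont s0 y(1)] pos[of y] \<open>e \<le> y\<close> \<open>y \<le> h\<close> by force
    then have Yh: "Y t = h" if "0 < t" for t using y(2)[OF that] le[OF that] by simp
    then have X: "X t = h + t * deriv f (V t)" if "0 < t" for t using that by (simp add: Y_def field_simps)
    \<comment> \<open>With all feet at \<open>h\<close>, this is the speed deficit at time 1
      relative to the divide; it is positive because \<open>X 1\<close> lies left of the divide
      through \<open>h\<close>.\<close>
    define d where "d = deriv f c - deriv f (V 1)"
    have d: "0 < d" using X[of 1] left[of 1] by (simp add: d_def)
    have mono: "deriv f (V t) \<le> deriv f (V 1)" if "1 < t" for t
    proof -
      have "X t - (t - 1 / 2) * deriv f (V t) \<le> X 1 - (1 - 1 / 2) * deriv f (V 1)"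
        using nb[unfolded nested_backward_def, THEN conjunct2, rule_format, of "1 / 2" 1 t] that by simp
      then show ?thesis using X[of t] X[of 1] that by (simp add: algebra_simps)
    qed
    \<comment> \<open>By time \<open>(h - e) / d\<close> the deficit, which never shrinks, has used
      up the whole width of the strip; the maximum with 2 puts \<open>t\<close> beyond time 1, where
      the comparison with \<open>V 1\<close> holds.\<close>
    define t where "t = max 2 ((h - e) / d)"
    have t: "1 < t" "(h - e) / d \<le> t" by (simp_all add: t_def)
    then have "h - e \<le> t * d" using d by (simp add: field_simps)
    moreover have "t * deriv f (V t) \<le> t * deriv f (V 1)"
      using t(1) by (intro mult_left_mono mono) auto
    moreover have "e + t * deriv f c < h + t * deriv f (V t)"
      using right[of t] X[of t] t(1) by simp
    ultimately show False
      unfolding d_def right_diff_distrib by linarith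
  qed
  then show ?thesis using y(1) by simp
qed

text \<open>The upper bound of the excess carries the factor \<open>Y t - e\<close>, the lower bound
  its power \<open>1 + \<sigma>\<close>; after cancellation \<open>(Y t - e) powr \<sigma>\<close>
  is controlled by \<open>s t powr (1 / (1 + \<alpha>))\<close>. The exponent
  \<open>\<theta>\<close> will be 1 in a bounded gap and \<open>1 - p / (p + 1 + \<alpha>)\<close>
  in an unbounded region.\<close>

lemma foot_rate:
  assumes Y: "(Y \<longlongrightarrow> e) at_top" and k: "0 < k" and \<sigma>: "0 < \<sigma>"
    and lower: "\<forall>\<^sub>F y in at_right e. k * \<bar>y - e\<bar> powr (1 + \<sigma>) \<le> excess y"
    and s: "\<forall>\<^sub>F t in at_top. s t \<le> B * t powr (- \<theta>)" and \<theta>: "0 < \<theta>"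
  obtains C where "0 \<le> C" "\<forall>\<^sub>F t in at_top. Y t - e \<le> C * t powr (- \<theta> / (\<sigma> * (1 + \<alpha>)))"
proof -
  note \<alpha> = exponent_nonneg
  have B: "0 \<le> B"
  proof -
    obtain t where "0 < t" "s t \<le> B * t powr (- \<theta>)"
      using eventually_happens'[OF _ eventually_conj[OF eventually_gt_at_top[of 0] s]] by auto
    then show ?thesis using s_pos[of t] by (smt (verit) mult_nonneg_nonpos2 powr_ge_zero mult.commute)
  qed
  have "(s \<longlongrightarrow> 0) at_top"
  proof (rule tendsto_sandwich[OF _ s tendsto_const])
    show "\<forall>\<^sub>F t in at_top. 0 \<le> s t"
      using eventually_gt_at_top[of 0] by eventually_elim (simp add: s_pos less_imp_le)
    have "((\<lambda>t. B * t powr (- \<theta>)) \<longlongrightarrow> B * 0) at_top"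
      using \<theta> by (intro tendsto_intros tendsto_neg_powr filterlim_ident) auto
    then show "((\<lambda>t. B * t powr (- \<theta>)) \<longlongrightarrow> 0) at_top" by simp
  qed
  from excess_foot_le[OF this] obtain C
    where C: "0 < C" "\<forall>\<^sub>F t in at_top. excess (Y t) \<le> C * s t powr (1 / (1 + \<alpha>)) * (Y t - e)" .
  obtain b where b: "e < b" "\<And>y. e < y \<Longrightarrow> y < b \<Longrightarrow> k * \<bar>y - e\<bar> powr (1 + \<sigma>) \<le> excess y"
    using lower unfolding eventually_at_right_field by blast
  define Q where "Q = C * B powr (1 / (1 + \<alpha>)) / k"
  have Q: "0 \<le> Q" using C(1) k by (simp add: Q_def)
  have "\<forall>\<^sub>F t in at_top. Y t - e \<le> Q powr (1 / \<sigma>) * t powr (- \<theta> / (\<sigma> * (1 + \<alpha>)))"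
    using C(2) order_tendstoD(2)[OF Y b(1)] s eventually_gt_at_top[of 0]
  proof eventually_elim
    case (elim t)
    define z where "z = Y t - e"
    have "0 \<le> z" using Y_ge[OF elim(4)] by (simp add: z_def)
    show ?case
    proof (cases "z = 0")
      case False
      then have z: "0 < z" using \<open>0 \<le> z\<close> by simp
      have "k * z powr \<sigma> * z = k * z powr (1 + \<sigma>)" using z by (simp add: powr_add)
      also have "\<dots> \<le> C * s t powr (1 / (1 + \<alpha>)) * z"
        using b(2)[of "Y t"] elim z by (simp add: z_def)
      finally have "k * z powr \<sigma> \<le> C * s t powr (1 / (1 + \<alpha>))" using z by simp
      also have "\<dots> \<le> C * (B * t powr (- \<theta>)) powr (1 / (1 + \<alpha>))"
        using elim s_pos[of t] C(1) \<alpha> by (intro mult_left_mono powr_mono2) auto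
      also have "(B * t powr (- \<theta>)) powr (1 / (1 + \<alpha>)) = B powr (1 / (1 + \<alpha>)) * t powr (- \<theta> / (1 + \<alpha>))"
        using B by (simp add: powr_mult powr_powr)
      finally have "z powr \<sigma> \<le> Q * t powr (- \<theta> / (1 + \<alpha>))"
        using k by (simp add: Q_def field_simps)
      then have "(z powr \<sigma>) powr (1 / \<sigma>) \<le> (Q * t powr (- \<theta> / (1 + \<alpha>))) powr (1 / \<sigma>)"
        using \<sigma> by (intro powr_mono2) auto
      then show ?thesis
        using z \<sigma> Q by (simp add: powr_powr powr_mult z_def mult.commute)
    qed (simp add: z_def)
  qed
  then show ?thesis using that[of "Q powr (1 / \<sigma>)"] by simp
qed

end

section \<open>Speeds along the characteristic and its distance from the divide\<close>

context right_of_divide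
begin

lemma deriv_V: "0 < t \<Longrightarrow> deriv f (V t) = deriv f c + (s t - (Y t - e) / t)"
  by (simp add: Y_def s_def field_simps)

lemma V_tendsto:
  assumes "(s \<longlongrightarrow> 0) at_top"
  shows "(V \<longlongrightarrow> c) at_top"
proof (rule flux_deriv_tendsto_cancel[OF f])
  have "((\<lambda>t. (Y t - e) / t) \<longlongrightarrow> 0) at_top"
  proof (rule tendsto_sandwich[where f = "\<lambda>_. 0"])
    show "((\<lambda>t. (Y 1 - e) / t) \<longlongrightarrow> 0) at_top"
      by (intro tendsto_divide_0[OF tendsto_const] filterlim_at_top_imp_at_infinity filterlim_ident)
    show "\<forall>\<^sub>F t in at_top. (Y t - e) / t \<le> (Y 1 - e) / t" "\<forall>\<^sub>F t in at_top. 0 \<le> (Y t - e) / t"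
      using eventually_ge_at_top[of 1]
      by (eventually_elim, use Y_antimono[of 1] Y_ge in \<open>auto intro!: divide_right_mono\<close>)+
  qed simp
  with assms have "((\<lambda>t. deriv f c + (s t - (Y t - e) / t)) \<longlongrightarrow> deriv f c + (0 - 0)) at_top"
    by (intro tendsto_intros)
  then have "((\<lambda>t. deriv f c + (s t - (Y t - e) / t)) \<longlongrightarrow> deriv f c) at_top" by simp
  then show "((\<lambda>t. deriv f (V t)) \<longlongrightarrow> deriv f c) at_top"
  proof (rule Lim_transform_eventually)
    show "\<forall>\<^sub>F t in at_top. deriv f c + (s t - (Y t - e) / t) = deriv f (V t)"
      using eventually_gt_at_top[of 0] by eventually_elim (simp add: deriv_V)
  qed
qed

lemma s_tendsto_bounded:
  assumes "\<And>t. 0 < t \<Longrightarrow> X t - e - t * deriv f c \<le> B"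
  shows "(s \<longlongrightarrow> 0) at_top"
proof (rule tendsto_sandwich[where f = "\<lambda>_. 0"])
  show "((\<lambda>t. B / t) \<longlongrightarrow> 0) at_top"
    by (intro tendsto_divide_0[OF tendsto_const] filterlim_at_top_imp_at_infinity filterlim_ident)
  show "\<forall>\<^sub>F t in at_top. s t \<le> B / t"
    using eventually_gt_at_top[of 0]
    by eventually_elim (auto simp: s_def intro!: divide_right_mono assms)
  show "\<forall>\<^sub>F t in at_top. 0 \<le> s t"
    using eventually_gt_at_top[of 0] by eventually_elim (simp add: s_pos less_imp_le)
qed simp

text \<open>\<open>t * s t\<close> is at most \<open>B\<close>, so the scaling factor is absorbed by
  the power of \<open>s t\<close>, and the remaining factor \<open>Y t - e\<close> tends to zero. On
  this scale \<open>t\<close> times the Bregman distance stays bounded in a strip of bounded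
  width.\<close>

lemma scaled_excess_tendsto:
  assumes B: "\<And>t. 0 < t \<Longrightarrow> X t - e - t * deriv f c \<le> B" and Y: "(Y \<longlongrightarrow> e) at_top"
  shows "((\<lambda>t. t powr (1 / (1 + \<alpha>)) * excess (Y t)) \<longlongrightarrow> 0) at_top"
proof -
  define a where "a = 1 / (1 + \<alpha>)"
  have a: "0 < a" using exponent_nonneg by (simp add: a_def)
  obtain C where C: "0 < C" "\<forall>\<^sub>F t in at_top. excess (Y t) \<le> C * s t powr a * (Y t - e)"
    using excess_foot_le[OF s_tendsto_bounded[OF B]] unfolding a_def by blast
  have "((\<lambda>t. t powr a * excess (Y t)) \<longlongrightarrow> 0) at_top"
  proof (rule tendsto_sandwich[where f = "\<lambda>_. 0"])
    have "((\<lambda>t. C * B powr a * (Y t - e)) \<longlongrightarrow> C * B powr a * (e - e)) at_top"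
      by (intro tendsto_intros Y)
    then show "((\<lambda>t. C * B powr a * (Y t - e)) \<longlongrightarrow> 0) at_top" by simp
    show "\<forall>\<^sub>F t in at_top. t powr a * excess (Y t) \<le> C * B powr a * (Y t - e)"
      using C(2) eventually_gt_at_top[of 0]
    proof eventually_elim
      case (elim t)
      have ts: "t powr a * s t powr a = (t * s t) powr a"
        by (simp add: powr_mult)
      have "t powr a * excess (Y t) \<le> t powr a * (C * s t powr a * (Y t - e))"
        using elim by (intro mult_left_mono) auto
      also have "\<dots> = C * (t * s t) powr a * (Y t - e)"
        by (simp flip: ts)
      also have "\<dots> \<le> C * B powr a * (Y t - e)"
        using C(1) B[OF elim(2)] right[OF elim(2)] Y_ge[OF elim(2)] elim(2) a
        by (intro mult_right_mono mult_left_mono powr_mono2) (auto simp: s_def)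
      finally show ?case .
    qed
  qed (use excess_nonneg in auto)
  then show ?thesis by (simp only: a_def)
qed

text \<open>The witness \<open>v\<close> ensures that the argument of \<open>inv f'\<close> in the N-wave lies in the range of \<open>f'\<close>.\<close>

lemma speed_estimate:
  assumes "(s \<longlongrightarrow> 0) at_top"
  shows "\<forall>\<^sub>F t in at_top. \<forall>x u. e + t * deriv f c < x \<and> x < X t \<and> u \<in> minimizers f P x t \<longrightarrow>
    (\<exists>v. deriv f v = (x - e) / t) \<and> 0 \<le> (x - e) / t - deriv f u \<and> (x - e) / t - deriv f u \<le> (Y t - e) / t"
proof -
  \<comment> \<open>\<open>c + 1\<close> is an arbitrary larger state; its speed brackets
    \<open>(x - e) / t\<close> from above once \<open>s t\<close> is small.\<close>
  have "deriv f c < deriv f (c + 1)" by (simp add: flux_deriv_less_iff[OF f])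
  then have "\<forall>\<^sub>F t in at_top. s t < deriv f (c + 1) - deriv f c"
    using order_tendstoD(2)[OF assms] by simp
  then show ?thesis
    using eventually_gt_at_top[of 0]
  proof eventually_elim
    case (elim t)
    show ?case
    proof (intro allI impI, elim conjE)
      fix x u assume x: "e + t * deriv f c < x" "x < X t" and u: "u \<in> minimizers f P x t"
      have le: "deriv f c \<le> (x - e) / t" "(x - e) / t \<le> deriv f (c + 1)"
      proof -
        show "deriv f c \<le> (x - e) / t" using x elim by (simp add: field_simps)
        have "(x - e) / t \<le> (X t - e) / t" using x elim by (simp add: divide_right_mono)
        also have "\<dots> = deriv f c + s t" using elim by (simp add: s_def field_simps)
        finally show "(x - e) / t \<le> deriv f (c + 1)" using elim by simp
      qed
      then have 1: "\<exists>v. deriv f v = (x - e) / t"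
        using flux_deriv_between[OF f le] by blast
      have eq: "(x - e) / t - deriv f u = (x - t * deriv f u - e) / t"
        using elim by (simp add: field_simps)
      have "e \<le> x - t * deriv f u"
        by (rule minimizers_foot_ge[OF f elim(2) sup x(1) u])
      moreover have "x - t * deriv f u \<le> Y t"
        unfolding Y_def by (rule minimizers_foot_mono[OF f elim(2) x(2) u V[OF elim(2)]])
      ultimately show "(\<exists>v. deriv f v = (x - e) / t) \<and> 0 \<le> (x - e) / t - deriv f u \<and>
          (x - e) / t - deriv f u \<le> (Y t - e) / t"
        unfolding eq using 1 elim by (auto intro!: divide_right_mono)
    qed
  qed
qed

lemma bregman_mono:
  assumes "c \<le> a" "a \<le> b"
  shows "bregman f c a \<le> bregman f c b"
proof -
  have "(a - c) * (deriv f a - deriv f b) \<le> 0"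
    using assms flux_deriv_le_iff[OF f, of a b] by (simp add: mult_nonneg_nonpos)
  then show ?thesis using bregman_diff_le[OF f, of c a b] by linarith
qed

text \<open>Near \<open>c\<close> the constant is half the limiting ratio. From an intermediate
  point \<open>m\<close> on, the Bregman distance is at least its value at \<open>m\<close>, while
  the power of the speed increment is at most its value \<open>A\<close> at \<open>M\<close>. The
  range ends at \<open>M\<close>, which will be the bound on minimizers.\<close>

lemma bregman_lower:
  shows "\<exists>k>0. \<forall>v\<in>{c..M}. k * (deriv f v - deriv f c) powr (1 + 1 / (1 + \<alpha>)) \<le> bregman f c v"
proof (cases "c < M")
  case False
  have "1 * (deriv f v - deriv f c) powr (1 + 1 / (1 + \<alpha>)) \<le> bregman f c v"
    if "c \<le> v" "v \<le> M" for v
  proof -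
    have "v = c" using that False by simp
    then show ?thesis by (simp add: bregman_def)
  qed
  then show ?thesis by (intro exI[of _ 1]) auto
next
  case True
  define \<beta> where "\<beta> = 1 + 1 / (1 + \<alpha>)"
  have \<beta>: "0 < \<beta>" using exponent_nonneg by (simp add: \<beta>_def add_pos_nonneg)
  obtain K where K: "0 < K" "((\<lambda>v. bregman f c v / \<bar>deriv f v - deriv f c\<bar> powr \<beta>) \<longlongrightarrow> K) (at c)"
    using bregman_ratio[OF f exponent] unfolding \<beta>_def .
  have "((\<lambda>v. bregman f c v / \<bar>deriv f v - deriv f c\<bar> powr \<beta>) \<longlongrightarrow> K) (at_right c)"
    using K(2) by (simp add: filterlim_at_split)
  from order_tendstoD(1)[OF this, of "K / 2"] K(1)
  obtain b where b: "c < b" "\<And>v. c < v \<Longrightarrow> v < b \<Longrightarrow>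
      K / 2 < bregman f c v / \<bar>deriv f v - deriv f c\<bar> powr \<beta>"
    unfolding eventually_at_right_field by auto
  define m where "m = (c + b) / 2"
  have m: "c < m" "m < b" using b(1) by (auto simp: m_def)
  define A where "A = (deriv f M - deriv f c) powr \<beta>"
  have A: "0 < A" using True by (simp add: A_def flux_deriv_eq_iff[OF f])
  define k where "k = min (K / 2) (bregman f c m / A)"
  have Dm: "0 < bregman f c m" using bregman_pos[OF f, of m c] m by simp
  have "k * (deriv f v - deriv f c) powr \<beta> \<le> bregman f c v" if v: "c \<le> v" "v \<le> M" for v
  proof -
    consider "v = c" | "c < v" "v < b" | "m \<le> v" using v m by linarith
    then show ?thesis
    proof cases
      case 1
      then show ?thesis using bregman_nonneg[OF f] by simp
    next
      case 2
      then have d: "0 < deriv f v - deriv f c" by (simp add: flux_deriv_less_iff[OF f])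
      have "k * (deriv f v - deriv f c) powr \<beta> \<le> K / 2 * (deriv f v - deriv f c) powr \<beta>"
        unfolding k_def by (intro mult_right_mono min.cobounded1) auto
      also have "\<dots> \<le> bregman f c v"
        using b(2)[OF 2] d by (simp add: field_simps)
      finally show ?thesis .
    next
      case 3
      have "(deriv f v - deriv f c) powr \<beta> \<le> A"
        unfolding A_def using v \<beta> flux_deriv_le_iff[OF f] by (intro powr_mono2) auto
      then have "k * (deriv f v - deriv f c) powr \<beta> \<le> bregman f c m / A * A"
        using K(1) Dm A by (intro mult_mono) (auto simp: k_def)
      also have "\<dots> = bregman f c m" using A by simp
      also have "\<dots> \<le> bregman f c v" using bregman_mono 3 m by simp
      finally show ?thesis .
    qed
  qed
  moreover have "0 < k" using K(1) Dm A by (simp add: k_def)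
  ultimately show ?thesis unfolding \<beta>_def by (intro exI[of _ k]) auto
qed

text \<open>Comparing with the competitor \<open>v = c\<close> gives \<open>t D(V t) \<le> C L\<^sup>1\<^sup>-\<^sup>1\<^sup>/\<^sup>p\<close> for \<open>L = X - e - t f'(c)\<close>,
  where \<open>D(V t)\<close> is at least of order \<open>(L/t)\<^sup>1\<^sup>+\<^sup>1\<^sup>/\<^sup>(\<^sup>1\<^sup>+\<^sup>\<alpha>\<^sup>)\<close>.\<close>

lemma length_rate:
  assumes lip: "M-lipschitz_on UNIV P" and p: "1 \<le> p"
    and growth: "\<And>y. e \<le> y \<Longrightarrow> excess y \<le> G * (1 + (y - e)) powr (1 - 1 / p)"
  obtains B where "0 < B"
    "\<And>t. 1 \<le> t \<Longrightarrow> X t - e - t * deriv f c \<le> B * t powr (p / (p + 1 + \<alpha>))"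
proof -
  note \<alpha> = exponent_nonneg
  define \<beta> where "\<beta> = 1 + 1 / (1 + \<alpha>)"
  define \<gamma> where "\<gamma> = 1 - 1 / p"
  have \<gamma>: "0 \<le> \<gamma>" using p by (simp add: \<gamma>_def)
  have \<beta>\<gamma>: "0 < \<beta> - \<gamma>" "1 < \<beta>" using p \<alpha> by (auto simp: \<beta>_def \<gamma>_def add_pos_pos)
  \<comment> \<open>Solving \<open>t * (L / t) powr \<beta> \<le> const * L powr \<gamma>\<close>
    for \<open>L\<close> yields the exponent on the left.\<close>
  have \<theta>: "(\<beta> - 1) * (1 / (\<beta> - \<gamma>)) = p / (p + 1 + \<alpha>)"
  proof -
    have "(1 + \<alpha>) * (\<beta> - 1) = 1" "p * (1 - \<gamma>) = 1"
      using p \<alpha> by (simp_all add: \<beta>_def \<gamma>_def)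
    then have "(\<beta> - 1) * (p + 1 + \<alpha>) = p * (\<beta> - \<gamma>)" by algebra
    moreover have "0 < p + 1 + \<alpha>" using p \<alpha> by simp
    ultimately show ?thesis using \<beta>\<gamma> by (simp add: field_simps)
  qed
  obtain k where k: "0 < k" "\<And>v. c \<le> v \<Longrightarrow> v \<le> M \<Longrightarrow> k * (deriv f v - deriv f c) powr \<beta> \<le> bregman f c v"
    using bregman_lower[of M] unfolding \<beta>_def by auto
  \<comment> \<open>Beyond this threshold \<open>L > 1\<close> allows
    \<open>1 + L \<le> 2 * L\<close>, and \<open>L > 2 * (Y 1 - e)\<close> keeps
    \<open>Y t - e\<close> below \<open>L / 2\<close>, so that the speed of \<open>V t\<close>
    exceeds \<open>f' c\<close> by at least \<open>L / (2 * t)\<close>.\<close>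
  define E where "E = max 1 (2 * (Y 1 - e))"
  define Q where "Q = max G 0 * 2 powr \<gamma> * 2 powr \<beta> / k"
  have Q: "0 \<le> Q" using k by (simp add: Q_def)
  define B where "B = E + Q powr (1 / (\<beta> - \<gamma>))"
  have "X t - e - t * deriv f c \<le> B * t powr (p / (p + 1 + \<alpha>))" if t: "1 \<le> t" for t
  proof -
    define L where "L = X t - e - t * deriv f c"
    have t0: "0 < t" using t by simp
    have tp: "1 \<le> t powr (p / (p + 1 + \<alpha>))" using t p \<alpha> by (intro ge_one_powr_ge_zero) auto
    have "L \<le> B * t powr (p / (p + 1 + \<alpha>))"
    proof (cases "L \<le> E")
      case True
      have "E \<le> B" by (simp add: B_def)
      also have "B \<le> B * t powr (p / (p + 1 + \<alpha>))"
        using mult_left_mono[OF tp, of B] by (simp add: B_def E_def add_nonneg_nonneg)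
      finally show ?thesis using True by simp
    next
      case False
      then have L: "1 < L" "2 * (Y 1 - e) < L" by (auto simp: E_def)
      have Yt: "Y t - e \<le> L / 2" using Y_antimono[of 1 t] t L by simp
      have d: "deriv f (V t) - deriv f c = (L - (Y t - e)) / t"
      proof -
        have "s t = L / t" by (simp add: s_def L_def)
        then show ?thesis using deriv_V[OF t0] by (simp add: diff_divide_distrib)
      qed
      have d2: "L / (2 * t) \<le> deriv f (V t) - deriv f c"
        unfolding d using Yt t0 by (simp add: field_simps)
      moreover have "0 < L / (2 * t)" using L t0 by simp
      ultimately have "c \<le> V t" using flux_deriv_le_iff[OF f, of c "V t"] by linarith
      moreover have "V t \<le> M"
        using minimizers_nonempty_compact(3)[OF f lip t0] V[OF t0] by force
      ultimately have "k * (deriv f (V t) - deriv f c) powr \<beta> \<le> bregman f c (V t)"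
        by (rule k(2))
      moreover have "k * (L / (2 * t)) powr \<beta> \<le> k * (deriv f (V t) - deriv f c) powr \<beta>"
        using d2 L t0 k(1) \<beta>\<gamma> by (intro mult_left_mono powr_mono2) auto
      ultimately have "k * (L / (2 * t)) powr \<beta> \<le> bregman f c (V t)" by linarith
      then have "t * (k * (L / (2 * t)) powr \<beta>) \<le> t * bregman f c (V t)" using t0 by simp
      \<comment> \<open>The competitor \<open>c\<close> has zero Bregman distance and its foot at
        \<open>e + L\<close>; the nonnegative excess at the foot of \<open>V t\<close> is
        dropped.\<close>
      also have "t * bregman f c (V t) \<le> excess (e + L)"
      proof -
        have "e + L = X t - t * deriv f c" by (simp add: L_def)
        then show ?thesis
          using minimizers_le[OF V[OF t0], of c] excess_nonneg[of "X t - t * deriv f (V t)"]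
          unfolding cost_eq_bregman[of f P "X t" t _ e c] excess_def
          by (simp add: bregman_def)
      qed
      also have "\<dots> \<le> G * (1 + L) powr \<gamma>" using growth[of "e + L"] L by (simp add: \<gamma>_def)
      also have "\<dots> \<le> max G 0 * (2 * L) powr \<gamma>"
        using L \<gamma> by (intro mult_mono powr_mono2) auto
      finally have "t * (k * (L / (2 * t)) powr \<beta>) \<le> max G 0 * (2 * L) powr \<gamma>" .
      moreover have "t * (k * (L / (2 * t)) powr \<beta>)
          = (k * L powr (\<beta> - \<gamma>) * t powr (1 - \<beta>) / 2 powr \<beta>) * L powr \<gamma>"
      proof -
        have "(L / (2 * t)) powr \<beta> = L powr (\<beta> - \<gamma>) * L powr \<gamma> / (2 powr \<beta> * t powr \<beta>)"
          by (simp add: powr_divide powr_mult flip: powr_add)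
        moreover have "t powr (1 - \<beta>) = t / t powr \<beta>" using t0 by (simp add: powr_diff)
        ultimately show ?thesis by (simp add: mult_ac)
      qed
      moreover have "max G 0 * (2 * L) powr \<gamma> = (max G 0 * 2 powr \<gamma>) * L powr \<gamma>"
        by (simp only: powr_mult mult.assoc)
      ultimately have "(k * L powr (\<beta> - \<gamma>) * t powr (1 - \<beta>) / 2 powr \<beta>) * L powr \<gamma>
          \<le> (max G 0 * 2 powr \<gamma>) * L powr \<gamma>"
        by (simp only:)
      then have "k * L powr (\<beta> - \<gamma>) * t powr (1 - \<beta>) / 2 powr \<beta> \<le> max G 0 * 2 powr \<gamma>"
        by (rule mult_right_le_imp_le) (use L in simp)
      then have "k * L powr (\<beta> - \<gamma>) * t powr (1 - \<beta>) / 2 powr \<beta> * (2 powr \<beta> / k)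
          \<le> max G 0 * 2 powr \<gamma> * (2 powr \<beta> / k)"
        using k(1) by (intro mult_right_mono) auto
      then have "L powr (\<beta> - \<gamma>) * t powr (1 - \<beta>) \<le> Q"
        using k(1) by (simp add: Q_def)
      then have "L powr (\<beta> - \<gamma>) * t powr (1 - \<beta>) * t powr (\<beta> - 1) \<le> Q * t powr (\<beta> - 1)"
        by (intro mult_right_mono) auto
      then have "L powr (\<beta> - \<gamma>) \<le> Q * t powr (\<beta> - 1)"
        using t0 by (simp add: mult.assoc flip: powr_add)
      then have "(L powr (\<beta> - \<gamma>)) powr (1 / (\<beta> - \<gamma>)) \<le> (Q * t powr (\<beta> - 1)) powr (1 / (\<beta> - \<gamma>))"
        using \<beta>\<gamma> by (intro powr_mono2) auto
      then have "L \<le> Q powr (1 / (\<beta> - \<gamma>)) * t powr (p / (p + 1 + \<alpha>))"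
        using L \<beta>\<gamma> \<theta> by (simp add: powr_powr powr_mult)
      also have "\<dots> \<le> B * t powr (p / (p + 1 + \<alpha>))"
        by (intro mult_right_mono) (auto simp: B_def E_def)
      finally show ?thesis .
    qed
    then show ?thesis by (simp add: L_def)
  qed
  moreover have "0 < B" by (simp add: B_def E_def add_pos_nonneg)
  ultimately show ?thesis by (intro that)
qed

end

text \<open>After division by the larger number the two parts lie in the unit interval and sum to 1,
  and raising them to the power \<open>\<beta>\<close> can only decrease them. Thus a vanishing
  difference of powers forces a vanishing difference of the bases.\<close>

lemma powr_diff_superadditive:
  fixes x y \<beta> :: real
  assumes "1 \<le> \<beta>" "0 \<le> x" "0 \<le> y"
  shows "\<bar>x - y\<bar> powr \<beta> \<le> \<bar>x powr \<beta> - y powr \<beta>\<bar>"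
proof -
  have *: "(x - y) powr \<beta> \<le> x powr \<beta> - y powr \<beta>" if "0 \<le> y" "y \<le> x" for x y :: real
  proof (cases "x = 0")
    case False
    then have x: "0 < x" using that by simp
    have "((x - y) / x) powr \<beta> + (y / x) powr \<beta> \<le> ((x - y) / x) powr 1 + (y / x) powr 1"
      using x that assms(1) by (intro add_mono powr_mono') auto
    also have "\<dots> = 1" using x that by (simp add: field_simps)
    finally show ?thesis using x by (simp add: powr_divide field_simps)
  qed (use that in simp)
  show ?thesis
  proof (cases "y \<le> x")
    case True
    then show ?thesis using *[of y x] assms powr_mono2[of \<beta> y x] by simp
  next
    case False
    then show ?thesis using *[of x y] assms powr_mono2[of \<beta> x y] by simp
  qed
qed

text \<open>Both extremal minimizers at \<open>X\<close> have the same cost. After scaling by \<open>t\<^sup>1\<^sup>/\<^sup>(\<^sup>1\<^sup>+\<^sup>\<alpha>\<^sup>)\<close> the excess terms vanish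
  and the Bregman terms become powers of the distances of \<open>X\<close> from the two divides, which must
  therefore balance.\<close>

lemma gap_midpoint:
  fixes f P :: "real \<Rightarrow> real" and X V1 V2 :: "real \<Rightarrow> real"
  assumes L: "right_of_divide f P e c \<alpha> X V1"
    and R: "right_of_divide (\<lambda>v. f (- v)) (\<lambda>y. P (- y)) (- h) (- c) \<alpha> (\<lambda>t. - X t) (\<lambda>t. - V2 t)"
    and h: "P h = P e + c * (h - e)"
    and Y1: "((\<lambda>t. X t - t * deriv f (V1 t)) \<longlongrightarrow> e) at_top"
    and Y2: "((\<lambda>t. X t - t * deriv f (V2 t)) \<longlongrightarrow> h) at_top"
  shows "((\<lambda>t. X t - e - t * deriv f c) \<longlongrightarrow> (h - e) / 2) at_top"
proof -
  interpret L: right_of_divide f P e c \<alpha> X V1 "\<lambda>t. (X t - e - t * deriv f c) / t"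
    by (fact L)
  interpret R: right_of_divide "\<lambda>v. f (- v)" "\<lambda>y. P (- y)" "- h" "- c" \<alpha> "\<lambda>t. - X t" "\<lambda>t. - V2 t"
    "\<lambda>t. (- X t - - h - t * deriv (\<lambda>v. f (- v)) (- c)) / t"
    by (fact R)
  note f = L.f
  note d = deriv_reflect(1)[OF f]
  have RY: "R.Y t = - (X t - t * deriv f (V2 t))" for t by (simp add: R.Y_def d)
  have Rexc: "R.excess (- y) = P y - (P e + c * (y - e))" for y
    by (simp add: R.excess_def h algebra_simps)
  define \<xi> where "\<xi> t = X t - e - t * deriv f c" for t
  define W where "W = h - e"
  have \<xi>: "0 < \<xi> t" "\<xi> t < W" if "0 < t" for t
    using L.right[OF that] R.right[OF that] by (auto simp: \<xi>_def W_def d)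
  define a where "a = 1 / (1 + \<alpha>)"
  define \<beta> where "\<beta> = 1 + a"
  have a: "0 < a" using L.exponent_nonneg by (simp add: a_def)
  then have \<beta>: "1 \<le> \<beta>" by (simp add: \<beta>_def)
  define y1 where "y1 t = L.Y t - e" for t
  define y2 where "y2 t = h - (X t - t * deriv f (V2 t))" for t
  have y1: "(y1 \<longlongrightarrow> 0) at_top"
    unfolding y1_def using Y1 by (intro LIM_zero) (simp add: L.Y_def)
  have y2: "(y2 \<longlongrightarrow> 0) at_top"
    unfolding y2_def using tendsto_diff[OF tendsto_const[of h] Y2] by simp
  have LB: "X t - e - t * deriv f c \<le> W" if "0 < t" for t
    using \<xi>[OF that] by (simp add: \<xi>_def)
  have RB: "- X t - - h - t * deriv (\<lambda>v. f (- v)) (- c) \<le> W" if "0 < t" for t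
    using \<xi>[OF that] by (simp add: \<xi>_def W_def d)
  have ex1: "((\<lambda>t. t powr a * L.excess (L.Y t)) \<longlongrightarrow> 0) at_top"
    unfolding a_def by (rule L.scaled_excess_tendsto[OF LB]) (use Y1 in \<open>auto simp: L.Y_def[abs_def]\<close>)
  have ex2: "((\<lambda>t. t powr a * R.excess (R.Y t)) \<longlongrightarrow> 0) at_top"
    unfolding a_def
    by (rule R.scaled_excess_tendsto[OF RB]) (use tendsto_minus[OF Y2] in \<open>auto simp: RY[abs_def]\<close>)
  have V1: "(V1 \<longlongrightarrow> c) at_top" by (rule L.V_tendsto[OF L.s_tendsto_bounded[OF LB]])
  have V2: "(V2 \<longlongrightarrow> c) at_top"
    using tendsto_minus[OF R.V_tendsto[OF R.s_tendsto_bounded[OF RB]]] by simp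
  obtain K where K: "0 < K" "((\<lambda>v. bregman f c v / \<bar>deriv f v - deriv f c\<bar> powr \<beta>) \<longlongrightarrow> K) (at c)"
    using bregman_ratio[OF f L.exponent] unfolding \<beta>_def a_def .
  \<comment> \<open>The ratio is filled in by its limit, which makes it continuous at
    \<open>c\<close> and keeps the product formula for the Bregman distance valid if
    \<open>V1\<close> or \<open>V2\<close> equals \<open>c\<close>.\<close>
  define r where "r v = (if v = c then K else bregman f c v / \<bar>deriv f v - deriv f c\<bar> powr \<beta>)" for v
  have "(r \<longlongrightarrow> K) (at c)"
    using K(2) by (rule Lim_transform_eventually) (auto simp: r_def eventually_at_filter)
  then have "isCont r c" by (simp add: isCont_def r_def)
  then have r1: "((\<lambda>t. r (V1 t)) \<longlongrightarrow> K) at_top" and r2: "((\<lambda>t. r (V2 t)) \<longlongrightarrow> K) at_top"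
    using isCont_tendsto_compose[OF _ V1, of r] isCont_tendsto_compose[OF _ V2, of r]
    by (auto simp: r_def)
  have breg: "bregman f c v = \<bar>deriv f v - deriv f c\<bar> powr \<beta> * r v" for v
    by (auto simp: r_def bregman_def flux_deriv_eq_iff[OF f])
  \<comment> \<open>\<open>A1\<close> and \<open>A2\<close> are
    \<open>t * \<bar>f' v - f' c\<bar>\<close> for the two extremal states. Up to the vanishing foot
    errors \<open>y1\<close> and \<open>y2\<close> they are the distances of \<open>X t\<close> from
    the left and the right divide.\<close>
  define A1 where "A1 t = \<bar>\<xi> t - y1 t\<bar>" for t
  define A2 where "A2 t = \<bar>\<xi> t - (W - y2 t)\<bar>" for t
  have y_bounds: "0 \<le> y1 t" "0 \<le> y2 t" "y1 t \<le> W" "y2 t \<le> W" if "0 < t" for t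
  proof -
    have sh: "supported_at P h c"
      using R.sup by (simp add: supported_at_reflect)
    have v1: "V1 t \<in> minimizers f P (X t) t" by (rule L.V[OF that])
    have v2: "V2 t \<in> minimizers f P (X t) t"
      using minimizers_reflect[OF R.f R.V[OF that]] by simp
    have lt: "X t < h + t * deriv f c" using \<xi>(2)[OF that] by (simp add: \<xi>_def W_def)
    show "0 \<le> y1 t" "0 \<le> y2 t" "y1 t \<le> W" "y2 t \<le> W"
      unfolding y1_def y2_def W_def L.Y_def
      using minimizers_foot_ge[OF f that L.sup L.right[OF that] v1]
        minimizers_foot_ge[OF f that L.sup L.right[OF that] v2]
        minimizers_foot_le[OF f that sh lt v1] minimizers_foot_le[OF f that sh lt v2] by auto
  qed
  have scaled: "t powr a * (t * bregman f c v) = \<bar>t * (deriv f v - deriv f c)\<bar> powr \<beta> * r v" if "0 < t" for t v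
  proof -
    have "\<bar>t * (deriv f v - deriv f c)\<bar> powr \<beta> = t powr a * t * \<bar>deriv f v - deriv f c\<bar> powr \<beta>"
      using that by (simp add: abs_mult powr_mult \<beta>_def powr_add)
    then show ?thesis by (simp add: breg)
  qed
  have balance: "t powr a * L.excess (L.Y t) + A1 t powr \<beta> * r (V1 t)
      = t powr a * R.excess (R.Y t) + A2 t powr \<beta> * r (V2 t)" if t: "0 < t" for t
  proof -
    have v2: "V2 t \<in> minimizers f P (X t) t"
      using minimizers_reflect[OF R.f R.V[OF t]] by simp
    have eq: "cost f P (X t) t (V1 t) = cost f P (X t) t (V2 t)"
      using minimizers_le[OF L.V[OF t], of "V2 t"] minimizers_le[OF v2, of "V1 t"] by simp
    then have "L.excess (L.Y t) + t * bregman f c (V1 t) = R.excess (R.Y t) + t * bregman f c (V2 t)"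
      unfolding cost_eq_bregman[of f P "X t" t _ e c] RY Rexc L.excess_def L.Y_def by simp
    then have "t powr a * L.excess (L.Y t) + t powr a * (t * bregman f c (V1 t))
        = t powr a * R.excess (R.Y t) + t powr a * (t * bregman f c (V2 t))"
      unfolding distrib_left[symmetric] by simp
    moreover have "t * (deriv f (V1 t) - deriv f c) = \<xi> t - y1 t"
      "t * (deriv f (V2 t) - deriv f c) = \<xi> t - (W - y2 t)"
      by (simp_all add: \<xi>_def y1_def y2_def W_def L.Y_def algebra_simps)
    ultimately show ?thesis
      unfolding scaled[OF t] A1_def A2_def by simp
  qed
  \<comment> \<open>Replacing the ratio by its limit \<open>K\<close> costs nothing asymptotically,
    because \<open>A1\<close> and \<open>A2\<close> never exceed the width \<open>W\<close>.\<close>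
  have small: "((\<lambda>t. A t powr \<beta> * (r (V t) - K)) \<longlongrightarrow> 0) at_top"
    if A: "\<And>t. 0 < t \<Longrightarrow> 0 \<le> A t \<and> A t \<le> W" and r: "((\<lambda>t. r (V t)) \<longlongrightarrow> K) at_top" for A V :: "real \<Rightarrow> real"
  proof (rule Lim_null_comparison)
    have "((\<lambda>t. W powr \<beta> * \<bar>r (V t) - K\<bar>) \<longlongrightarrow> W powr \<beta> * 0) at_top"
      by (intro tendsto_mult_left tendsto_rabs_zero LIM_zero r)
    then show "((\<lambda>t. W powr \<beta> * \<bar>r (V t) - K\<bar>) \<longlongrightarrow> 0) at_top" by simp
    show "\<forall>\<^sub>F t in at_top. norm (A t powr \<beta> * (r (V t) - K)) \<le> W powr \<beta> * \<bar>r (V t) - K\<bar>"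
      using eventually_gt_at_top[of 0]
    proof eventually_elim
      case (elim t)
      then show ?case
        using A[OF elim] \<beta> by (auto simp: abs_mult intro!: mult_right_mono powr_mono2)
    qed
  qed
  have A1: "0 \<le> A1 t \<and> A1 t \<le> W" if "0 < t" for t
    using \<xi>[OF that] y_bounds[OF that] by (auto simp: A1_def)
  have A2: "0 \<le> A2 t \<and> A2 t \<le> W" if "0 < t" for t
    using \<xi>[OF that] y_bounds[OF that] by (auto simp: A2_def)
  have "((\<lambda>t. (t powr a * R.excess (R.Y t) - t powr a * L.excess (L.Y t)
      + A2 t powr \<beta> * (r (V2 t) - K) - A1 t powr \<beta> * (r (V1 t) - K)) / K) \<longlongrightarrow> (0 - 0 + 0 - 0) / K) at_top"
    using K(1) by (intro tendsto_intros ex1 ex2 small[OF A1 r1] small[OF A2 r2]) auto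
  then have pow: "((\<lambda>t. A1 t powr \<beta> - A2 t powr \<beta>) \<longlongrightarrow> 0) at_top"
  proof (rule Lim_transform_eventually[OF tendsto_eq_rhs])
    show "\<forall>\<^sub>F t in at_top. (t powr a * R.excess (R.Y t) - t powr a * L.excess (L.Y t)
      + A2 t powr \<beta> * (r (V2 t) - K) - A1 t powr \<beta> * (r (V1 t) - K)) / K = A1 t powr \<beta> - A2 t powr \<beta>"
      using eventually_gt_at_top[of 0]
    proof eventually_elim
      case (elim t)
      have "t powr a * R.excess (R.Y t) - t powr a * L.excess (L.Y t) + A2 t powr \<beta> * (r (V2 t) - K)
          - A1 t powr \<beta> * (r (V1 t) - K) = K * (A1 t powr \<beta> - A2 t powr \<beta>)"
        using balance[OF elim] by (simp add: right_diff_distrib mult.commute)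
      then show ?case using K(1) by simp
    qed
  qed simp
  have "((\<lambda>t. \<bar>A1 t powr \<beta> - A2 t powr \<beta>\<bar> powr (1 / \<beta>)) \<longlongrightarrow> 0 powr (1 / \<beta>)) at_top"
    using \<beta> by (intro tendsto_powr2 tendsto_rabs_zero pow tendsto_const) auto
  then have "((\<lambda>t. \<bar>A1 t powr \<beta> - A2 t powr \<beta>\<bar> powr (1 / \<beta>) + y1 t + y2 t) \<longlongrightarrow> 0 + 0 + 0) at_top"
    by (intro tendsto_add y1 y2) simp
  then have lim: "((\<lambda>t. \<bar>A1 t powr \<beta> - A2 t powr \<beta>\<bar> powr (1 / \<beta>) + y1 t + y2 t) \<longlongrightarrow> 0) at_top" by simp
  have "((\<lambda>t. 2 * \<xi> t - W) \<longlongrightarrow> 0) at_top"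
  proof (rule Lim_null_comparison[OF _ lim])
    show "\<forall>\<^sub>F t in at_top. norm (2 * \<xi> t - W) \<le> \<bar>A1 t powr \<beta> - A2 t powr \<beta>\<bar> powr (1 / \<beta>) + y1 t + y2 t"
      using eventually_gt_at_top[of 0]
    proof eventually_elim
      case (elim t)
      have "(\<bar>A1 t - A2 t\<bar> powr \<beta>) powr (1 / \<beta>) \<le> \<bar>A1 t powr \<beta> - A2 t powr \<beta>\<bar> powr (1 / \<beta>)"
        using \<beta> A1[OF elim] A2[OF elim] by (intro powr_mono2 powr_diff_superadditive) auto
      then have "\<bar>A1 t - A2 t\<bar> \<le> \<bar>A1 t powr \<beta> - A2 t powr \<beta>\<bar> powr (1 / \<beta>)"
        using \<beta> by (simp add: powr_powr)
      moreover have "\<bar>2 * \<xi> t - W\<bar> \<le> \<bar>A1 t - A2 t\<bar> + y1 t + y2 t"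
        using \<xi>[OF elim] y_bounds[OF elim] by (simp add: A1_def A2_def)
      ultimately show ?case by simp
    qed
  qed
  then have "((\<lambda>t. (2 * \<xi> t - W) / 2 + W / 2) \<longlongrightarrow> 0 / 2 + W / 2) at_top"
    by (intro tendsto_intros) auto
  moreover have "(2 * \<xi> t - W) / 2 + W / 2 = \<xi> t" for t
    by (simp add: diff_divide_distrib)
  ultimately show ?thesis by (simp add: \<xi>_def[abs_def] W_def)
qed

subsection \<open>Lebesgue norms of the speed difference\<close>

text \<open>Nothing is assumed about \<open>g\<close> at the end points, since the N-wave is left
  open on the chosen characteristics. Measurability comes from \<open>g'\<close>, a Borel function
  that agrees with \<open>g\<close> on the whole closed interval.\<close>

lemma set_Lq_bound:
  fixes a b q B :: real and g G :: "real \<Rightarrow> real"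
  assumes ab: "a \<le> b" and q: "0 < q" and G: "G \<in> borel_measurable borel"
    and eq: "\<And>x. a < x \<Longrightarrow> x < b \<Longrightarrow> g x = G x" and B: "\<And>x. a < x \<Longrightarrow> x < b \<Longrightarrow> \<bar>g x\<bar> \<le> B"
  shows "set_borel_measurable lebesgue {a..b} g"
    and "set_integrable lebesgue {a..b} (\<lambda>x. \<bar>g x\<bar> powr q)"
    and "(LINT x:{a..b}|lebesgue. \<bar>g x\<bar> powr q) \<le> B powr q * (b - a)"
proof -
  define g' where "g' x = (if x = a then g a else if x = b then g b else G x)" for x
  have g'_eq: "g x = g' x" if "x \<in> {a..b}" for x
    using that eq[of x] by (auto simp: g'_def)
  have meas: "g' \<in> borel_measurable borel"
    unfolding g'_def using G by measurable
  then have meas': "g' \<in> borel_measurable lebesgue"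
    by (intro measurable_completion) simp
  have ind: "indicator {a..b} x *\<^sub>R g x = indicator {a..b} x *\<^sub>R g' x" for x
    using g'_eq by (auto simp: indicator_def)
  show "set_borel_measurable lebesgue {a..b} g"
    unfolding set_borel_measurable_def ind
    by (intro borel_measurable_scaleR borel_measurable_indicator meas') simp
  have "AE x in lborel. x \<noteq> a \<and> x \<noteq> b"
    using AE_lborel_singleton[of a] AE_lborel_singleton[of b] by (rule AE_conjI)
  then have "AE x in lebesgue. x \<noteq> a \<and> x \<noteq> b"
    by (rule AE_completion)
  then have AE: "AE x in lebesgue. x \<in> {a..b} \<longrightarrow> \<bar>g' x\<bar> powr q \<le> B powr q"
  proof (rule AE_mp, intro AE_I2 impI)
    fix x assume "x \<noteq> a \<and> x \<noteq> b" "x \<in> {a..b}"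
    then show "\<bar>g' x\<bar> powr q \<le> B powr q"
      using B[of x] q eq[of x] by (intro powr_mono2) (auto simp: g'_def)
  qed
  have "integrable lebesgue (\<lambda>x. indicator {a..b} x *\<^sub>R (\<bar>g' x\<bar> powr q))"
    by (rule integrableI_bounded_set_indicator[where B = "B powr q"])
       (use AE meas' in \<open>auto simp: emeasure_lborel_Icc_eq\<close>)
  moreover have ind': "indicator {a..b} x *\<^sub>R (\<bar>g x\<bar> powr q) = indicator {a..b} x *\<^sub>R (\<bar>g' x\<bar> powr q)" for x
    using g'_eq by (auto simp: indicator_def)
  ultimately show int: "set_integrable lebesgue {a..b} (\<lambda>x. \<bar>g x\<bar> powr q)"
    unfolding set_integrable_def by (simp only:)
  have "(LINT x:{a..b}|lebesgue. \<bar>g x\<bar> powr q) \<le> (LINT x:{a..b}|lebesgue. B powr q)"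
  proof (rule set_integral_mono_AE[OF int])
    show "AE x\<in>{a..b} in lebesgue. \<bar>g x\<bar> powr q \<le> B powr q"
      using AE by eventually_elim (use g'_eq in auto)
  qed auto
  also have "\<dots> = integral {a..b} (\<lambda>_. B powr q)"
    by (rule set_lebesgue_integral_eq_integral) auto
  also have "\<dots> = B powr q * (b - a)" using ab by simp
  finally show "(LINT x:{a..b}|lebesgue. \<bar>g x\<bar> powr q) \<le> B powr q * (b - a)" .
qed

lemma Lq_norm_bound:
  fixes a b q B :: real and g G :: "real \<Rightarrow> real"
  assumes "a \<le> b" "0 < q" "0 \<le> B" "G \<in> borel_measurable borel"
    and "\<And>x. a < x \<Longrightarrow> x < b \<Longrightarrow> g x = G x" "\<And>x. a < x \<Longrightarrow> x < b \<Longrightarrow> \<bar>g x\<bar> \<le> B"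
  shows "in_Lq q {a..b} g" "Lq_norm q {a..b} g \<le> B * (b - a) powr (1 / q)"
proof -
  note bound = set_Lq_bound[OF assms(1,2,4-6)]
  show "in_Lq q {a..b} g" using bound by (simp add: in_Lq_def)
  have "Lq_norm q {a..b} g \<le> (B powr q * (b - a)) powr (1 / q)"
    unfolding Lq_norm_def using bound(3) assms(2)
    by (intro powr_mono2) (auto simp: set_lebesgue_integral_def intro!: integral_nonneg_AE)
  also have "\<dots> = B * (b - a) powr (1 / q)"
    using assms(2,3) by (simp add: powr_mult powr_powr)
  finally show "Lq_norm q {a..b} g \<le> B * (b - a) powr (1 / q)" .
qed

lemma Lq_norm_bound_split:
  fixes a m b q B1 B2 :: real and g G1 G2 :: "real \<Rightarrow> real"
  assumes ab: "a \<le> m" "m \<le> b" and q: "0 < q"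
    and G1: "G1 \<in> borel_measurable borel" "\<And>x. a < x \<Longrightarrow> x < m \<Longrightarrow> g x = G1 x"
      "\<And>x. a < x \<Longrightarrow> x < m \<Longrightarrow> \<bar>g x\<bar> \<le> B1"
    and G2: "G2 \<in> borel_measurable borel" "\<And>x. m < x \<Longrightarrow> x < b \<Longrightarrow> g x = G2 x"
      "\<And>x. m < x \<Longrightarrow> x < b \<Longrightarrow> \<bar>g x\<bar> \<le> B2"
  shows "in_Lq q {a..b} g"
    "Lq_norm q {a..b} g \<le> (B1 powr q * (m - a) + B2 powr q * (b - m)) powr (1 / q)"
proof -
  note bound1 = set_Lq_bound[OF ab(1) q G1]
  note bound2 = set_Lq_bound[OF ab(2) q G2]
  have un: "{a..b} = {a..m} \<union> {m..b}" using ab by auto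
  have int: "set_integrable lebesgue {a..b} (\<lambda>x. \<bar>g x\<bar> powr q)"
    unfolding un by (rule set_integrable_Un[OF bound1(2) bound2(2)]) auto
  have "set_borel_measurable lebesgue {a..b} g"
    unfolding set_borel_measurable_def
  proof -
    have "indicator {a..b} x *\<^sub>R g x
        = (if x \<le> m then indicator {a..m} x *\<^sub>R g x else indicator {m..b} x *\<^sub>R g x)" for x
      using ab by (auto simp: indicator_def)
    moreover have "(\<lambda>x. if x \<le> m then indicator {a..m} x *\<^sub>R g x else indicator {m..b} x *\<^sub>R g x)
        \<in> borel_measurable lebesgue"
    proof (rule measurable_If)
      have "{x \<in> space lebesgue. x \<le> m} = {..m}" by auto
      then show "{x \<in> space lebesgue. x \<le> m} \<in> sets lebesgue" by simp
    qed (use bound1(1) bound2(1) in \<open>simp_all add: set_borel_measurable_def\<close>)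
    ultimately show "(\<lambda>x. indicator {a..b} x *\<^sub>R g x) \<in> borel_measurable lebesgue" by simp
  qed
  with int show "in_Lq q {a..b} g" by (simp add: in_Lq_def)
  have "(LINT x:{a..b}|lebesgue. \<bar>g x\<bar> powr q)
      = (LINT x:{a..m}|lebesgue. \<bar>g x\<bar> powr q) + (LINT x:{m..b}|lebesgue. \<bar>g x\<bar> powr q)"
    using Henstock_Kurzweil_Integration.integral_combine[OF ab set_lebesgue_integral_eq_integral(1)[OF int]]
    by (simp add: set_lebesgue_integral_eq_integral(2)[OF int]
        set_lebesgue_integral_eq_integral(2)[OF bound1(2)] set_lebesgue_integral_eq_integral(2)[OF bound2(2)])
  then have "(LINT x:{a..b}|lebesgue. \<bar>g x\<bar> powr q) \<le> B1 powr q * (m - a) + B2 powr q * (b - m)"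
    using bound1(3) bound2(3) by simp
  then show "Lq_norm q {a..b} g \<le> (B1 powr q * (m - a) + B2 powr q * (b - m)) powr (1 / q)"
    unfolding Lq_norm_def using q
    by (intro powr_mono2) (auto simp: set_lebesgue_integral_def intro!: integral_nonneg_AE)
qed

section \<open>The entropy solution and forward characteristics in the variational picture\<close>

lemma extremal_minimizers:
  assumes "flux f" "in_Linf \<phi>" "0 < t"
  shows "u_left f \<phi> x t \<in> minimizers f (Phi \<phi>) x t" "u_right f \<phi> x t \<in> minimizers f (Phi \<phi>) x t"
    "entropy_solution f \<phi> x t \<in> minimizers f (Phi \<phi>) x t" "u_right f \<phi> x t \<le> u_left f \<phi> x t"
proof -
  obtain M where "M-lipschitz_on UNIV (Phi \<phi>)" using Phi_lipschitz[OF assms(2)] .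
  note K = minimizers_nonempty_compact[OF assms(1) this assms(3), of x]
  have bdd: "bdd_above (minimizers f (Phi \<phi>) x t)" "bdd_below (minimizers f (Phi \<phi>) x t)"
    using K(2) by (auto intro: bounded_imp_bdd_above bounded_imp_bdd_below compact_imp_bounded)
  note eq = maximizers_eq_minimizers[OF assms, of x]
  show l: "u_left f \<phi> x t \<in> minimizers f (Phi \<phi>) x t"
    unfolding u_left_def eq using K bdd by (intro closed_contains_Sup compact_imp_closed) auto
  show "u_right f \<phi> x t \<in> minimizers f (Phi \<phi>) x t" "entropy_solution f \<phi> x t \<in> minimizers f (Phi \<phi>) x t"
    unfolding u_right_def entropy_solution_def eq
    using K bdd by (auto intro!: closed_contains_Inf compact_imp_closed)
  show "u_right f \<phi> x t \<le> u_left f \<phi> x t"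
    using l bdd unfolding u_right_def eq by (intro cInf_lower) auto
qed

text \<open>The speed is \<open>(x - y x) / t\<close> with \<open>y x\<close> the foot, and feet are
  nondecreasing in \<open>x\<close>.\<close>

lemma borel_measurable_entropy_speed:
  assumes "flux f" "in_Linf \<phi>" "0 < t"
  shows "(\<lambda>x. deriv f (entropy_solution f \<phi> x t)) \<in> borel_measurable borel"
proof -
  define y where "y x = x - t * deriv f (entropy_solution f \<phi> x t)" for x
  have "mono y"
  proof (rule monoI)
    fix a b :: real assume "a \<le> b"
    then show "y a \<le> y b"
      using minimizers_foot_mono[OF assms(1,3) _ extremal_minimizers(3)[OF assms] extremal_minimizers(3)[OF assms]]
      unfolding y_def by (cases "a = b") auto
  qed
  then have [measurable]: "y \<in> borel_measurable borel" by (rule borel_measurable_mono)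
  have "(\<lambda>x. deriv f (entropy_solution f \<phi> x t)) = (\<lambda>x. (x - y x) / t)"
    using assms(3) by (auto simp: y_def)
  then show ?thesis by simp
qed

text \<open>On each horizontal slice the backward triangle is an interval whose left end belongs to
  \<open>u_left\<close> and whose right end belongs to \<open>u_right\<close>; inclusion of the
  slices orders these ends. The right ends satisfy the left-end inequality after reflection.\<close>

lemma fwd_char_nested_backward:
  assumes f: "flux f" and \<phi>: "in_Linf \<phi>" and X: "fwd_char f \<phi> X"
  shows "nested_backward f (Phi \<phi>) X (\<lambda>t. u_left f \<phi> (X t) t)"
    and "nested_backward (\<lambda>v. f (- v)) (\<lambda>y. Phi \<phi> (- y)) (\<lambda>t. - X t) (\<lambda>t. - u_right f \<phi> (X t) t)"
proof -
  \<comment> \<open>A single inclusion is extracted by restarting the characteristic at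
    \<open>t1\<close>; the definition also asks for a third time, for which any later one
    serves.\<close>
  have sub: "Delta_I f \<phi> (X t1) t1 \<subseteq> Delta_I f \<phi> (X t2) t2" if "0 < t1" "t1 < t2" for t1 t2
    using X that unfolding fwd_char_def fwd_char_from_def by (meson less_add_one)
  have inner: "\<exists>v'\<in>{u_right f \<phi> (X t2) t2..u_left f \<phi> (X t2) t2}.
      X t1 - (t1 - \<tau>) * deriv f v = X t2 - (t2 - \<tau>) * deriv f v'"
    if "0 < \<tau>" "\<tau> < t1" "t1 < t2" "v \<in> {u_right f \<phi> (X t1) t1..u_left f \<phi> (X t1) t1}" for \<tau> t1 t2 v
  proof -
    have "(X t1 + (\<tau> - t1) * deriv f v, \<tau>) \<in> Delta_I f \<phi> (X t1) t1"
      using that by (auto simp: Delta_I_def)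
    then have "(X t1 + (\<tau> - t1) * deriv f v, \<tau>) \<in> Delta_I f \<phi> (X t2) t2"
      using sub[of t1 t2] that by auto
    then show ?thesis by (auto simp: Delta_I_def algebra_simps)
  qed
  have le: "u_right f \<phi> (X t) t \<le> u_left f \<phi> (X t) t" if "0 < t" for t
    by (rule extremal_minimizers(4)[OF f \<phi> that])
  show "nested_backward f (Phi \<phi>) X (\<lambda>t. u_left f \<phi> (X t) t)"
    unfolding nested_backward_def
  proof (intro conjI allI impI; (elim conjE)?)
    fix \<tau> t1 t2 :: real assume t: "0 < \<tau>" "\<tau> < t1" "t1 < t2"
    obtain v where v: "v \<le> u_left f \<phi> (X t2) t2"
        "X t1 - (t1 - \<tau>) * deriv f (u_left f \<phi> (X t1) t1) = X t2 - (t2 - \<tau>) * deriv f v"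
      using inner[OF t, of "u_left f \<phi> (X t1) t1"] le[of t1] t by auto
    then show "X t2 - (t2 - \<tau>) * deriv f (u_left f \<phi> (X t2) t2)
        \<le> X t1 - (t1 - \<tau>) * deriv f (u_left f \<phi> (X t1) t1)"
      using t by (simp add: mult_left_mono flux_deriv_le_iff[OF f])
  qed (rule extremal_minimizers(1)[OF f \<phi>])
  show "nested_backward (\<lambda>v. f (- v)) (\<lambda>y. Phi \<phi> (- y)) (\<lambda>t. - X t) (\<lambda>t. - u_right f \<phi> (X t) t)"
    unfolding nested_backward_def deriv_reflect(1)[OF f]
  proof (intro conjI allI impI; (elim conjE)?)
    fix \<tau> t1 t2 :: real assume t: "0 < \<tau>" "\<tau> < t1" "t1 < t2"
    obtain v where v: "u_right f \<phi> (X t2) t2 \<le> v"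
        "X t1 - (t1 - \<tau>) * deriv f (u_right f \<phi> (X t1) t1) = X t2 - (t2 - \<tau>) * deriv f v"
      using inner[OF t, of "u_right f \<phi> (X t1) t1"] le[of t1] t by auto
    have "(t2 - \<tau>) * deriv f (u_right f \<phi> (X t2) t2) \<le> (t2 - \<tau>) * deriv f v"
      using v(1) t by (simp add: flux_deriv_le_iff[OF f])
    then show "- X t2 - (t2 - \<tau>) * - deriv f (- (- u_right f \<phi> (X t2) t2))
        \<le> - X t1 - (t1 - \<tau>) * - deriv f (- (- u_right f \<phi> (X t1) t1))"
      using v(2) by simp
  qed (rule minimizers_reflect[OF f extremal_minimizers(2)[OF f \<phi>]])
qed

text \<open>For large \<open>t\<close> the number \<open>(x - e) / t\<close> is a value of
  \<open>f'\<close>, so \<open>inv f'\<close> really inverts there; then the difference of speeds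
  is, up to sign, the displacement of the foot from \<open>e\<close> divided by
  \<open>t\<close>.\<close>

lemma speed_diff_right_of_divide:
  assumes \<phi>: "in_Linf \<phi>" and L: "right_of_divide f (Phi \<phi>) e c \<alpha> X V"
    and s: "((\<lambda>t. (X t - e - t * deriv f c) / t) \<longlongrightarrow> 0) at_top"
    and w: "\<forall>t>0. \<forall>x. e + t * deriv f c < x \<and> x < X t \<longrightarrow> w x t = inv (deriv f) ((x - e) / t)"
  shows "\<forall>\<^sub>F t in at_top. \<forall>x. e + t * deriv f c < x \<and> x < X t \<longrightarrow>
    speed_diff f \<phi> w t x = deriv f (entropy_solution f \<phi> x t) - (x - e) / t \<and>
    \<bar>speed_diff f \<phi> w t x\<bar> \<le> (X t - t * deriv f (V t) - e) / t"
proof -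
  interpret right_of_divide f "Phi \<phi>" e c \<alpha> X V "\<lambda>t. (X t - e - t * deriv f c) / t"
    by (fact L)
  show ?thesis
    using speed_estimate[OF s] eventually_gt_at_top[of 0]
  proof eventually_elim
    case (elim t)
    show ?case
    proof (intro allI impI, elim conjE)
      fix x assume x: "e + t * deriv f c < x" "x < X t"
      have *: "\<exists>v. deriv f v = (x - e) / t"
        "0 \<le> (x - e) / t - deriv f (entropy_solution f \<phi> x t)"
        "(x - e) / t - deriv f (entropy_solution f \<phi> x t) \<le> (X t - t * deriv f (V t) - e) / t"
        using elim(1)[rule_format, of x "entropy_solution f \<phi> x t"] x
          extremal_minimizers(3)[OF f \<phi> elim(2)] unfolding Y_def by auto
      then have "deriv f (w x t) = (x - e) / t"
        using w x elim(2) by (metis inv_deriv_flux[OF f])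
      then show "speed_diff f \<phi> w t x = deriv f (entropy_solution f \<phi> x t) - (x - e) / t \<and>
          \<bar>speed_diff f \<phi> w t x\<bar> \<le> (X t - t * deriv f (V t) - e) / t"
        using * by (simp add: speed_diff_def)
    qed
  qed
qed

lemma speed_diff_left_of_divide:
  assumes f: "flux f" and \<phi>: "in_Linf \<phi>"
    and R: "right_of_divide (\<lambda>v. f (- v)) (\<lambda>y. Phi \<phi> (- y)) (- h) (- c) \<alpha> (\<lambda>t. - X t) (\<lambda>t. - V t)"
    and s: "((\<lambda>t. (- X t - - h - t * deriv (\<lambda>v. f (- v)) (- c)) / t) \<longlongrightarrow> 0) at_top"
    and w: "\<forall>t>0. \<forall>x. X t < x \<and> x < h + t * deriv f c \<longrightarrow> w x t = inv (deriv f) ((x - h) / t)"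
  shows "\<forall>\<^sub>F t in at_top. \<forall>x. X t < x \<and> x < h + t * deriv f c \<longrightarrow>
    speed_diff f \<phi> w t x = deriv f (entropy_solution f \<phi> x t) - (x - h) / t \<and>
    \<bar>speed_diff f \<phi> w t x\<bar> \<le> (h - (X t - t * deriv f (V t))) / t"
proof -
  interpret R: right_of_divide "\<lambda>v. f (- v)" "\<lambda>y. Phi \<phi> (- y)" "- h" "- c" \<alpha> "\<lambda>t. - X t" "\<lambda>t. - V t"
    "\<lambda>t. (- X t - - h - t * deriv (\<lambda>v. f (- v)) (- c)) / t"
    by (fact R)
  note d = deriv_reflect(1)[OF f]
  show ?thesis
    using R.speed_estimate[OF s] eventually_gt_at_top[of 0]
  proof eventually_elim
    case (elim t)
    show ?case
    proof (intro allI impI, elim conjE)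
      fix x assume x: "X t < x" "x < h + t * deriv f c"
      define u where "u = entropy_solution f \<phi> x t"
      have "- u \<in> minimizers (\<lambda>v. f (- v)) (\<lambda>y. Phi \<phi> (- y)) (- x) t"
        unfolding u_def by (rule minimizers_reflect[OF f extremal_minimizers(3)[OF f \<phi> elim(2)]])
      then have *: "\<exists>v. - deriv f (- v) = (- x - - h) / t"
        "0 \<le> (- x - - h) / t + deriv f u"
        "(- x - - h) / t + deriv f u \<le> (- X t + t * deriv f (V t) + h) / t"
        using elim(1)[rule_format, of "- x" "- u"] x unfolding R.Y_def d by auto
      have neg: "(- x - - h) / t = - ((x - h) / t)"
        by (simp only: minus_divide_left minus_diff_eq) simp
      obtain v where "deriv f (- v) = (x - h) / t" using *(1) unfolding neg by auto
      then have "deriv f (w x t) = (x - h) / t"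
        using w x elim(2) by (metis inv_deriv_flux[OF f])
      moreover have eq: "- X t + t * deriv f (V t) + h = h - (X t - t * deriv f (V t))" by simp
      ultimately show "speed_diff f \<phi> w t x = deriv f (entropy_solution f \<phi> x t) - (x - h) / t \<and>
          \<bar>speed_diff f \<phi> w t x\<bar> \<le> (h - (X t - t * deriv f (V t))) / t"
        using *(2,3) unfolding neg eq by (simp add: speed_diff_def u_def)
    qed
  qed
qed

subsection \<open>Decay estimates\<close>

text \<open>Moves the sublinear growth from the base point 0 to \<open>e\<close>. The argument
  \<open>1 + (y - e)\<close> stays at least 1, so constants can be absorbed even at
  \<open>y = e\<close>.\<close>

lemma growth_excess:
  fixes P :: "real \<Rightarrow> real"
  assumes lip: "M-lipschitz_on UNIV P" and \<gamma>: "0 \<le> \<gamma>"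
    and C: "\<And>y. 0 \<le> y \<Longrightarrow> \<bar>P y - r * y\<bar> \<le> C * \<bar>y\<bar> powr \<gamma>"
  obtains G where "\<And>y. e \<le> y \<Longrightarrow> P y - (P e + r * (y - e)) \<le> G * (1 + (y - e)) powr \<gamma>"
proof -
  \<comment> \<open>The three terms absorb the growth for \<open>y \<ge> 0\<close>, the constant
    offset at \<open>e\<close>, and, when \<open>e < 0\<close>, the Lipschitz variation between
    \<open>e\<close> and 0.\<close>
  define G where "G = \<bar>C\<bar> * (1 + \<bar>e\<bar>) powr \<gamma> + \<bar>P e - r * e\<bar> + (M + \<bar>r\<bar>) * \<bar>e\<bar>"
  have M: "0 \<le> M" using lip by (simp add: lipschitz_on_def)
  have "P y - (P e + r * (y - e)) \<le> G * (1 + (y - e)) powr \<gamma>" if y: "e \<le> y" for y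
  proof -
    define z where "z = (1 + (y - e)) powr \<gamma>"
    have z: "1 \<le> z" unfolding z_def using y \<gamma> by (intro ge_one_powr_ge_zero) auto
    have nn: "0 \<le> \<bar>C\<bar> * (1 + \<bar>e\<bar>) powr \<gamma>" "0 \<le> (M + \<bar>r\<bar>) * \<bar>e\<bar>" using M by auto
    have "P y - (P e + r * (y - e)) \<le> G * z"
    proof (cases "0 \<le> y")
      case True
      have "\<bar>y\<bar> \<le> (1 + \<bar>e\<bar>) * (1 + (y - e))"
      proof -
        have "0 \<le> \<bar>e\<bar> * (y - e)" using y by simp
        then show ?thesis using True by (simp add: algebra_simps)
      qed
      then have "\<bar>y\<bar> powr \<gamma> \<le> ((1 + \<bar>e\<bar>) * (1 + (y - e))) powr \<gamma>"
        using \<gamma> by (intro powr_mono2) auto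
      also have "\<dots> = (1 + \<bar>e\<bar>) powr \<gamma> * z" by (simp only: powr_mult z_def)
      finally have "\<bar>C\<bar> * \<bar>y\<bar> powr \<gamma> \<le> \<bar>C\<bar> * (1 + \<bar>e\<bar>) powr \<gamma> * z"
        by (simp only: mult.assoc) (intro mult_left_mono, auto)
      moreover have "C * \<bar>y\<bar> powr \<gamma> \<le> \<bar>C\<bar> * \<bar>y\<bar> powr \<gamma>"
        by (intro mult_right_mono) auto
      moreover have "P y - r * y \<le> C * \<bar>y\<bar> powr \<gamma>" using C[OF True] by linarith
      moreover have "\<bar>P e - r * e\<bar> \<le> \<bar>P e - r * e\<bar> * z" using z by (simp add: mult_le_cancel_left1)
      moreover have "0 \<le> (M + \<bar>r\<bar>) * \<bar>e\<bar> * z" using nn z by simp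
      ultimately show ?thesis unfolding G_def distrib_right right_diff_distrib by linarith
    next
      case False
      have "\<bar>P y - P e\<bar> \<le> M * \<bar>y - e\<bar>" using lipschitz_onD[OF lip, of y e] by (simp add: dist_real_def)
      then have "P y - P e \<le> M * (y - e)" using y by simp
      moreover have "- (r * (y - e)) \<le> \<bar>r\<bar> * (y - e)"
        using y mult_right_mono[of "- r" "\<bar>r\<bar>" "y - e"] by simp
      moreover have "(M + \<bar>r\<bar>) * (y - e) \<le> (M + \<bar>r\<bar>) * \<bar>e\<bar>"
        using M False y by (intro mult_left_mono) auto
      moreover have "(M + \<bar>r\<bar>) * \<bar>e\<bar> \<le> (M + \<bar>r\<bar>) * \<bar>e\<bar> * z"
        using nn z by (simp add: mult_le_cancel_left1)
      moreover have "0 \<le> \<bar>C\<bar> * (1 + \<bar>e\<bar>) powr \<gamma> * z" "0 \<le> \<bar>P e - r * e\<bar> * z"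
        using nn z by auto
      ultimately show ?thesis unfolding G_def distrib_right by linarith
    qed
    then show ?thesis by (simp add: z_def)
  qed
  then show ?thesis using that by blast
qed

text \<open>For the asymptotic states this upgrades the limit superior and inferior in their
  definitions to genuine limits, as the contact point lemmas require.\<close>

lemma growth_tendsto:
  fixes P :: "real \<Rightarrow> real"
  assumes p: "1 \<le> p" and C: "\<forall>y\<ge>0. \<bar>P y - r * y\<bar> \<le> C * \<bar>y\<bar> powr (1 - 1 / p)"
  shows "((\<lambda>y. P y / y) \<longlongrightarrow> r) at_top"
proof (rule LIM_zero_cancel, rule Lim_null_comparison)
  have "((\<lambda>y. C * y powr (- (1 / p))) \<longlongrightarrow> C * 0) at_top"
    using p by (intro tendsto_intros tendsto_neg_powr filterlim_ident) auto
  then show "((\<lambda>y. C * y powr (- (1 / p))) \<longlongrightarrow> 0) at_top" by simp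
  show "\<forall>\<^sub>F y in at_top. norm (P y / y - r) \<le> C * y powr (- (1 / p))"
    using eventually_gt_at_top[of 0]
  proof eventually_elim
    case (elim y)
    have "P y / y - r = (P y - r * y) / y" using elim by (simp add: field_simps)
    then have "norm (P y / y - r) = \<bar>P y - r * y\<bar> / y" using elim by simp
    also have "\<dots> \<le> C * y powr (1 - 1 / p) / y"
      using C[rule_format, of y] elim by (simp add: divide_right_mono)
    also have "\<dots> = C * y powr (- (1 / p))"
      using elim by (simp add: powr_diff powr_minus field_simps)
    finally show ?case .
  qed
qed

context right_of_divide
begin

text \<open>\<open>N\<close> stands for the norm on either side, known only through the bound by
  foot displacement over \<open>t\<close> times width to the power \<open>1 / q\<close>; keeping it
  abstract lets the right region and the reflected left region share the proof.\<close>

lemma unbounded_rates: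
  fixes N :: "real \<Rightarrow> real"
  assumes lip: "M-lipschitz_on UNIV P" and p: "1 \<le> p" and q: "0 < q"
    and C: "\<forall>y\<ge>0. \<bar>P y - c * y\<bar> \<le> C * \<bar>y\<bar> powr (1 - 1 / p)"
    and pos: "\<forall>y>e. P e + c * (y - e) < P y"
  shows "(s \<longlongrightarrow> 0) at_top"
    and "\<forall>\<^sub>F t in at_top. \<bar>N t\<bar> \<le> (Y t - e) / t * (X t - e - t * deriv f c) powr (1 / q) \<Longrightarrow>
      N \<in> O(\<lambda>t. (Y t - e) * t powr (-1 + (p / q) / (p + 1 + \<alpha>)))"
    and "\<forall>\<^sub>F t in at_top. \<bar>N t\<bar> \<le> (Y t - e) / t * (X t - e - t * deriv f c) powr (1 / q) \<Longrightarrow>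
      0 < \<sigma> \<Longrightarrow> 0 < k \<Longrightarrow> \<forall>\<^sub>F y in at_right e. k * \<bar>y - e\<bar> powr (1 + \<sigma>) \<le> excess y \<Longrightarrow>
      N \<in> O(\<lambda>t. t powr (-1 + (p / q) / (p + 1 + \<alpha>) - (1 / \<sigma>) / (p + 1 + \<alpha>)))"
proof -
  note \<alpha> = exponent_nonneg
  define \<theta> where "\<theta> = p / (p + 1 + \<alpha>)"
  have \<theta>: "1 - \<theta> = (1 + \<alpha>) / (p + 1 + \<alpha>)" "0 < 1 - \<theta>"
    using p \<alpha> by (auto simp: \<theta>_def field_simps add_pos_nonneg)
  obtain G where G: "\<And>y. e \<le> y \<Longrightarrow> P y - (P e + c * (y - e)) \<le> G * (1 + (y - e)) powr (1 - 1 / p)"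
    by (rule growth_excess[OF lip, of "1 - 1 / p" c C e]) (use p C in auto)
  obtain B where B: "0 < B" "\<And>t. 1 \<le> t \<Longrightarrow> X t - e - t * deriv f c \<le> B * t powr \<theta>"
    by (rule length_rate[OF lip p, of G]) (use G in \<open>auto simp: excess_def \<theta>_def\<close>)
  have s_le: "\<forall>\<^sub>F t in at_top. s t \<le> B * t powr (- (1 - \<theta>))"
    using eventually_ge_at_top[of 1]
  proof eventually_elim
    case (elim t)
    have "s t \<le> B * t powr \<theta> / t"
      unfolding s_def using B(2)[OF elim] elim by (intro divide_right_mono) auto
    also have "\<dots> = B * t powr (- (1 - \<theta>))" using elim by (simp add: powr_diff)
    finally show ?case .
  qed
  show s0: "(s \<longlongrightarrow> 0) at_top"
  proof (rule tendsto_sandwich[OF _ s_le tendsto_const])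
    show "\<forall>\<^sub>F t in at_top. 0 \<le> s t"
      using eventually_gt_at_top[of 0] by eventually_elim (simp add: s_pos less_imp_le)
    have "((\<lambda>t. B * t powr (- (1 - \<theta>))) \<longlongrightarrow> B * 0) at_top"
      by (intro tendsto_mult_left tendsto_neg_powr filterlim_ident) (use \<theta>(2) in simp)
    then show "((\<lambda>t. B * t powr (- (1 - \<theta>))) \<longlongrightarrow> 0) at_top" by simp
  qed
  have Y: "(Y \<longlongrightarrow> e) at_top"
    by (rule Y_tendsto[OF lipschitz_on_continuous_on[OF lip] s0]) (use pos in \<open>simp add: excess_def\<close>)
  show bigo: "N \<in> O(\<lambda>t. (Y t - e) * t powr (-1 + (p / q) / (p + 1 + \<alpha>)))"
    if N: "\<forall>\<^sub>F t in at_top. \<bar>N t\<bar> \<le> (Y t - e) / t * (X t - e - t * deriv f c) powr (1 / q)"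
  proof (rule bigoI[where c = "B powr (1 / q)"])
    show "\<forall>\<^sub>F t in at_top. norm (N t) \<le> B powr (1 / q) * norm ((Y t - e) * t powr (-1 + (p / q) / (p + 1 + \<alpha>)))"
      using N eventually_ge_at_top[of 1]
    proof eventually_elim
      case (elim t)
      have t: "0 < t" using elim by simp
      have "norm (N t) \<le> (Y t - e) / t * (X t - e - t * deriv f c) powr (1 / q)"
        using elim by simp
      also have "\<dots> \<le> (Y t - e) / t * (B * t powr \<theta>) powr (1 / q)"
        using B(2)[OF elim(2)] right[OF t] Y_ge[OF t] t q
        by (intro mult_left_mono powr_mono2) auto
      also have "(B * t powr \<theta>) powr (1 / q) = B powr (1 / q) * t powr (\<theta> * (1 / q))"
        by (simp only: powr_mult powr_powr)
      also have "\<theta> * (1 / q) = p / q / (p + 1 + \<alpha>)" by (simp add: \<theta>_def)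
      also have "(Y t - e) / t * (B powr (1 / q) * t powr (p / q / (p + 1 + \<alpha>)))
          = B powr (1 / q) * ((Y t - e) * t powr (-1 + (p / q) / (p + 1 + \<alpha>)))"
        using t by (simp add: powr_diff mult_ac)
      also have "\<dots> = B powr (1 / q) * norm ((Y t - e) * t powr (-1 + (p / q) / (p + 1 + \<alpha>)))"
        using Y_ge[OF t] by (simp add: abs_mult)
      finally show ?case .
    qed
  qed
  show "N \<in> O(\<lambda>t. t powr (-1 + (p / q) / (p + 1 + \<alpha>) - (1 / \<sigma>) / (p + 1 + \<alpha>)))"
    if N: "\<forall>\<^sub>F t in at_top. \<bar>N t\<bar> \<le> (Y t - e) / t * (X t - e - t * deriv f c) powr (1 / q)"
      and \<sigma>: "0 < \<sigma>" and k: "0 < k"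
      and lower: "\<forall>\<^sub>F y in at_right e. k * \<bar>y - e\<bar> powr (1 + \<sigma>) \<le> excess y"
  proof -
    obtain D where D: "0 \<le> D" "\<forall>\<^sub>F t in at_top. Y t - e \<le> D * t powr (- (1 - \<theta>) / (\<sigma> * (1 + \<alpha>)))"
      using foot_rate[OF Y k \<sigma> lower s_le \<theta>(2)] .
    \<comment> \<open>The numerator of
      \<open>1 - \<theta> = (1 + \<alpha>) / (p + 1 + \<alpha>)\<close> cancels the factor that
      comes from the inverse rate of \<open>f'\<close>.\<close>
    have ex: "- (1 - \<theta>) / (\<sigma> * (1 + \<alpha>)) = - ((1 / \<sigma>) / (p + 1 + \<alpha>))"
    proof -
      have "- (a / b) / (\<sigma> * a) = - ((1 / \<sigma>) / b)" if "a \<noteq> 0" for a b :: real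
        using that by simp
      from this[of "1 + \<alpha>"] show ?thesis unfolding \<theta>(1) using \<alpha> by simp
    qed
    have "(\<lambda>t. Y t - e) \<in> O(\<lambda>t. t powr (- ((1 / \<sigma>) / (p + 1 + \<alpha>))))"
    proof (rule bigoI[where c = D])
      show "\<forall>\<^sub>F t in at_top. norm (Y t - e) \<le> D * norm (t powr (- ((1 / \<sigma>) / (p + 1 + \<alpha>))))"
        using D(2)[unfolded ex] eventually_gt_at_top[of 0]
        by eventually_elim (use Y_ge in auto)
    qed
    then have "(\<lambda>t. (Y t - e) * t powr (-1 + (p / q) / (p + 1 + \<alpha>)))
        \<in> O(\<lambda>t. t powr (- ((1 / \<sigma>) / (p + 1 + \<alpha>))) * t powr (-1 + (p / q) / (p + 1 + \<alpha>)))"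
      by (intro landau_o.big.mult) auto
    also have "(\<lambda>t. t powr (- ((1 / \<sigma>) / (p + 1 + \<alpha>))) * t powr (-1 + (p / q) / (p + 1 + \<alpha>)))
        = (\<lambda>t. t powr (-1 + (p / q) / (p + 1 + \<alpha>) - (1 / \<sigma>) / (p + 1 + \<alpha>)))"
      by (simp add: add_ac flip: powr_add)
    finally show ?thesis using bigo[OF N] landau_o.big_trans by blast
  qed
qed

end

text \<open>Two instances of the one-sided setting share the characteristic \<open>X\<close>: one at
  \<open>e\<close> and, reflected, one at \<open>h\<close>. Their contributions add as q-th powers
  of the norm, which is the form of \<open>eps_gap\<close>.\<close>

lemma gap_estimates:
  fixes f \<phi> X :: "real \<Rightarrow> real" and w :: "real \<Rightarrow> real \<Rightarrow> real"
  assumes f: "flux f" and \<phi>: "in_Linf \<phi>" and gap: "gap \<phi> e h"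
    and exponent: "flux_exponent f (gap_c \<phi> e h) \<alpha>" and q: "0 < q"
    and X: "fwd_char_in f \<phi> (H_gap f \<phi> e h) X"
    and wl: "\<forall>t>0. \<forall>x. e_line f \<phi> e h t < x \<and> x < X t \<longrightarrow> w x t = inv (deriv f) ((x - e) / t)"
    and wr: "\<forall>t>0. \<forall>x. X t < x \<and> x < h_line f \<phi> e h t \<longrightarrow> w x t = inv (deriv f) ((x - h) / t)"
  defines "N \<equiv> \<lambda>t. Lq_norm q {e_line f \<phi> e h t..h_line f \<phi> e h t} (speed_diff f \<phi> w t)"
  shows "\<forall>\<^sub>F t in at_top. in_Lq q {e_line f \<phi> e h t..h_line f \<phi> e h t} (speed_diff f \<phi> w t)"
    and "lessapprox N (\<lambda>t. ((h - e) / 2) powr (1 / q) * eps_gap f \<phi> e h X q t * t powr (-1))"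
    and "0 < \<sigma> \<Longrightarrow> 0 < k \<Longrightarrow>
      \<forall>\<^sub>F x in at_right e. (LINT \<xi>=e..x|lebesgue. (\<phi> \<xi> - gap_c \<phi> e h)) \<ge> k * \<bar>x - e\<bar> powr (1 + \<sigma>) \<Longrightarrow>
      \<forall>\<^sub>F x in at_left h. (LINT \<xi>=h..x|lebesgue. (\<phi> \<xi> - gap_c \<phi> e h)) \<ge> k * \<bar>x - h\<bar> powr (1 + \<sigma>) \<Longrightarrow>
      N \<in> O(\<lambda>t. t powr (-1 - 1 / (\<sigma> * (1 + \<alpha>))))"
proof -
  define c where "c = gap_c \<phi> e h"
  define P where "P = Phi \<phi>"
  define V1 where "V1 t = u_left f \<phi> (X t) t" for t
  define V2 where "V2 t = u_right f \<phi> (X t) t" for t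
  have eh: "e < h" using gap by (simp add: gap_def)
  note supp = gap_support[OF \<phi> gap, folded c_def P_def]
  have Ph: "P h = P e + c * (h - e)" using eh by (simp add: c_def gap_c_def P_def)
  have lines: "e_line f \<phi> e h t = e + t * deriv f c" "h_line f \<phi> e h t = h + t * deriv f c" for t
    by (simp_all add: e_line_def h_line_def c_def)
  obtain M where lip: "M-lipschitz_on UNIV P" using Phi_lipschitz[OF \<phi>] unfolding P_def .
  have cont: "continuous_on UNIV P" by (rule lipschitz_on_continuous_on[OF lip])
  have cont': "continuous_on UNIV (\<lambda>y. P (- y))"
    by (intro continuous_on_compose2[OF cont] continuous_intros) auto
  have fc: "fwd_char f \<phi> X" using X by (simp add: fwd_char_in_def)
  note nb = fwd_char_nested_backward[OF f \<phi> fc, folded P_def V1_def V2_def]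
  have in_gap: "e + t * deriv f c < X t" "X t < h + t * deriv f c" if "0 < t" for t
    using X that by (auto simp: fwd_char_in_def H_gap_def lines)
  note d = deriv_reflect(1)[OF f]
  have L: "right_of_divide f P e c \<alpha> X V1"
    by unfold_locales (use f supp exponent nb in_gap in \<open>auto simp: c_def\<close>)
  have "- h - t * deriv f c < - X t" if "0 < t" for t
    using in_gap(2)[OF that] by simp
  then have R: "right_of_divide (\<lambda>v. f (- v)) (\<lambda>y. P (- y)) (- h) (- c) \<alpha> (\<lambda>t. - X t) (\<lambda>t. - V2 t)"
    by unfold_locales
       (use supp nb flux_exponent_reflect[OF f exponent] in
         \<open>auto simp: flux_reflect[OF f] supported_at_reflect d c_def\<close>)
  interpret L: right_of_divide f P e c \<alpha> X V1 "\<lambda>t. (X t - e - t * deriv f c) / t" by (fact L)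
  interpret R: right_of_divide "\<lambda>v. f (- v)" "\<lambda>y. P (- y)" "- h" "- c" \<alpha> "\<lambda>t. - X t" "\<lambda>t. - V2 t"
    "\<lambda>t. (- X t - - h - t * deriv (\<lambda>v. f (- v)) (- c)) / t" by (fact R)
  have LB: "X t - e - t * deriv f c \<le> h - e" if "0 < t" for t using in_gap[OF that] by simp
  have RB: "- X t - - h - t * deriv (\<lambda>v. f (- v)) (- c) \<le> h - e" if "0 < t" for t
    using in_gap[OF that] by (simp add: d)
  have Ls: "((\<lambda>t. (X t - e - t * deriv f c) / t) \<longlongrightarrow> 0) at_top"
    by (rule L.s_tendsto_bounded[OF LB])
  have Rs: "((\<lambda>t. (- X t - - h - t * deriv (\<lambda>v. f (- v)) (- c)) / t) \<longlongrightarrow> 0) at_top"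
    by (rule R.s_tendsto_bounded[OF RB])
  have LY: "L.Y t = y_left f \<phi> X t" and RY: "R.Y t = - y_right f \<phi> X t" for t
    unfolding L.Y_def R.Y_def unfolding y_left_def y_right_def V1_def V2_def d by simp_all
  have Rexc: "R.excess (- y) = P y - (P e + c * (y - e))" for y
    by (simp add: R.excess_def Ph algebra_simps)
  have Y1: "(L.Y \<longlongrightarrow> e) at_top"
    by (rule L.Y_tendsto_gap[OF cont supp(2) _ in_gap(2) Ls]) (use supp(3) in \<open>auto simp: L.excess_def\<close>)
  have Y2: "(R.Y \<longlongrightarrow> - h) at_top"
  proof (rule R.Y_tendsto_gap[OF cont', of "- e"])
    show "supported_at (\<lambda>y. P (- y)) (- e) (- c)" using supp(1) by (simp add: supported_at_reflect)
    show "0 < R.excess y" if "- h < y" "y < - e" for y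
      using supp(3)[of "- y"] Rexc[of "- y"] that by simp
    show "- X t < - e + t * deriv (\<lambda>v. f (- v)) (- c)" if "0 < t" for t
      using in_gap(1)[OF that] by (simp add: d)
  qed (rule Rs)
  define \<xi> where "\<xi> t = X t - e - t * deriv f c" for t
  have mid: "(\<xi> \<longlongrightarrow> (h - e) / 2) at_top"
    unfolding \<xi>_def[abs_def]
  proof (rule gap_midpoint[OF L R Ph])
    show "((\<lambda>t. X t - t * deriv f (V1 t)) \<longlongrightarrow> e) at_top" using Y1 by (simp add: L.Y_def[abs_def])
    show "((\<lambda>t. X t - t * deriv f (V2 t)) \<longlongrightarrow> h) at_top"
      using tendsto_minus[OF Y2] by (simp add: R.Y_def[abs_def] d)
  qed
  \<comment> \<open>A common bound for the widths on the two sides of \<open>X t\<close>. Its limit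
    \<open>(h - e) / 2\<close> is the sharp constant; for the power rate
    \<open>m t \<le> h - e\<close> suffices.\<close>
  define m where "m t = max (\<xi> t) (h - e - \<xi> t)" for t
  have "(m \<longlongrightarrow> max ((h - e) / 2) (h - e - (h - e) / 2)) at_top"
    unfolding m_def by (intro tendsto_intros mid)
  moreover have "h - e - (h - e) / 2 = (h - e) / 2" by (simp add: field_simps)
  ultimately have m: "(m \<longlongrightarrow> (h - e) / 2) at_top" by (simp only: max.idem)
  define \<epsilon>1 where "\<epsilon>1 t = L.Y t - e" for t
  define \<epsilon>2 where "\<epsilon>2 t = R.Y t - - h" for t
  have eps: "eps_gap f \<phi> e h X q t = (\<epsilon>1 t powr q + \<epsilon>2 t powr q) powr (1 / q)" for t
    by (simp add: eps_gap_def \<epsilon>1_def \<epsilon>2_def LY RY)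
  have eps_nonneg: "0 \<le> \<epsilon>1 t" "0 \<le> \<epsilon>2 t" if "0 < t" for t
    using L.Y_ge[OF that] R.Y_ge[OF that] by (auto simp: \<epsilon>1_def \<epsilon>2_def)
  have "\<forall>\<^sub>F t in at_top. in_Lq q {e + t * deriv f c..h + t * deriv f c} (speed_diff f \<phi> w t) \<and>
      N t \<le> m t powr (1 / q) * eps_gap f \<phi> e h X q t * t powr (-1)"
    using speed_diff_right_of_divide[OF \<phi> L[unfolded P_def] Ls wl[unfolded lines]]
      speed_diff_left_of_divide[OF f \<phi> R[unfolded P_def] Rs wr[unfolded lines]] eventually_gt_at_top[of 0]
  proof eventually_elim
    case (elim t)
    have l: "speed_diff f \<phi> w t x = deriv f (entropy_solution f \<phi> x t) - (x - e) / t"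
      "\<bar>speed_diff f \<phi> w t x\<bar> \<le> \<epsilon>1 t / t" if "e + t * deriv f c < x" "x < X t" for x
      using elim(1) that by (auto simp: \<epsilon>1_def L.Y_def)
    have r: "speed_diff f \<phi> w t x = deriv f (entropy_solution f \<phi> x t) - (x - h) / t"
      "\<bar>speed_diff f \<phi> w t x\<bar> \<le> \<epsilon>2 t / t" if "X t < x" "x < h + t * deriv f c" for x
      using elim(2) that unfolding \<epsilon>2_def RY unfolding y_right_def V2_def by (auto simp: algebra_simps)
    note [measurable] = borel_measurable_entropy_speed[OF f \<phi> elim(3)]
    have meas: "(\<lambda>x. deriv f (entropy_solution f \<phi> x t) - (x - y) / t) \<in> borel_measurable borel" for y
      by measurable
    note bound = Lq_norm_bound_split[OF less_imp_le[OF in_gap(1)[OF elim(3)]]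
        less_imp_le[OF in_gap(2)[OF elim(3)]] q meas[of e] l meas[of h] r]
    have "N t \<le> ((\<epsilon>1 t / t) powr q * \<xi> t + (\<epsilon>2 t / t) powr q * (h - e - \<xi> t)) powr (1 / q)"
      using bound(2) unfolding N_def lines \<xi>_def by (simp add: algebra_simps)
    also have "\<dots> \<le> ((\<epsilon>1 t / t) powr q * m t + (\<epsilon>2 t / t) powr q * m t) powr (1 / q)"
    proof (intro powr_mono2 add_mono mult_left_mono)
      show "0 \<le> (\<epsilon>1 t / t) powr q * \<xi> t + (\<epsilon>2 t / t) powr q * (h - e - \<xi> t)"
        using in_gap[OF elim(3)] by (intro add_nonneg_nonneg mult_nonneg_nonneg) (auto simp: \<xi>_def)
    qed (use q in \<open>auto simp: m_def\<close>)
    also have "(\<epsilon>1 t / t) powr q * m t + (\<epsilon>2 t / t) powr q * m t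
        = m t * (\<epsilon>1 t powr q + \<epsilon>2 t powr q) * (1 / t) powr q"
      by (simp add: powr_divide algebra_simps add_divide_distrib)
    also have "\<dots> powr (1 / q) = m t powr (1 / q) * eps_gap f \<phi> e h X q t * t powr (-1)"
      using elim(3) q by (simp add: eps powr_mult powr_powr powr_divide powr_minus_divide)
    finally show ?case using bound(1) by simp
  qed
  then have Lq: "\<forall>\<^sub>F t in at_top. in_Lq q {e + t * deriv f c..h + t * deriv f c} (speed_diff f \<phi> w t)"
    and N_le: "\<forall>\<^sub>F t in at_top. N t \<le> m t powr (1 / q) * eps_gap f \<phi> e h X q t * t powr (-1)"
    by (auto elim: eventually_mono)
  show "\<forall>\<^sub>F t in at_top. in_Lq q {e_line f \<phi> e h t..h_line f \<phi> e h t} (speed_diff f \<phi> w t)"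
    using Lq unfolding lines .
  show "lessapprox N (\<lambda>t. ((h - e) / 2) powr (1 / q) * eps_gap f \<phi> e h X q t * t powr (-1))"
    unfolding lessapprox_def
  proof (intro exI conjI)
    have "((\<lambda>t. m t powr (1 / q) / ((h - e) / 2) powr (1 / q) - 1) \<longlongrightarrow>
        ((h - e) / 2) powr (1 / q) / ((h - e) / 2) powr (1 / q) - 1) at_top"
      using eh by (intro tendsto_intros m) auto
    then show "((\<lambda>t. m t powr (1 / q) / ((h - e) / 2) powr (1 / q) - 1) \<longlongrightarrow> 0) at_top"
      using eh by simp
    show "\<forall>\<^sub>F t in at_top. N t \<le> (1 + (m t powr (1 / q) / ((h - e) / 2) powr (1 / q) - 1)) *
        (((h - e) / 2) powr (1 / q) * eps_gap f \<phi> e h X q t * t powr (-1))"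
      using N_le by eventually_elim (use eh in simp)
  qed
  show "N \<in> O(\<lambda>t. t powr (-1 - 1 / (\<sigma> * (1 + \<alpha>))))"
    if \<sigma>: "0 < \<sigma>" and k: "0 < k"
      and le: "\<forall>\<^sub>F x in at_right e. (LINT \<xi>=e..x|lebesgue. (\<phi> \<xi> - gap_c \<phi> e h)) \<ge> k * \<bar>x - e\<bar> powr (1 + \<sigma>)"
      and lh: "\<forall>\<^sub>F x in at_left h. (LINT \<xi>=h..x|lebesgue. (\<phi> \<xi> - gap_c \<phi> e h)) \<ge> k * \<bar>x - h\<bar> powr (1 + \<sigma>)"
  proof -
    note LINT = interval_LINT_Phi[OF \<phi>, folded P_def]
    have lower1: "\<forall>\<^sub>F y in at_right e. k * \<bar>y - e\<bar> powr (1 + \<sigma>) \<le> L.excess y"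
      using le unfolding LINT L.excess_def c_def[symmetric] by (simp add: algebra_simps)
    have "\<forall>\<^sub>F x in at_left h. k * \<bar>x - h\<bar> powr (1 + \<sigma>) \<le> R.excess (- x)"
      using lh unfolding LINT Rexc c_def[symmetric] by (simp add: Ph algebra_simps)
    then have lower2: "\<forall>\<^sub>F y in at_right (- h). k * \<bar>y - - h\<bar> powr (1 + \<sigma>) \<le> R.excess y"
      unfolding eventually_at_left_to_right[of _ h] by (simp add: abs_minus_commute add.commute)
    \<comment> \<open>The distance from either divide is at most \<open>h - e\<close>, so
      \<open>foot_rate\<close> applies with \<open>\<theta> = 1\<close>.\<close>
    have Lr: "\<forall>\<^sub>F t in at_top. (X t - e - t * deriv f c) / t \<le> (h - e) * t powr (- 1)"
      using eventually_gt_at_top[of 0]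
      by eventually_elim (use LB in \<open>auto simp: powr_minus_divide intro!: divide_right_mono\<close>)
    have Rr: "\<forall>\<^sub>F t in at_top. (- X t - - h - t * deriv (\<lambda>v. f (- v)) (- c)) / t \<le> (h - e) * t powr (- 1)"
      using eventually_gt_at_top[of 0]
    proof eventually_elim
      case (elim t)
      then show ?case using divide_right_mono[OF RB[OF elim], of t] by (simp add: powr_minus_divide)
    qed
    define \<tau> where "\<tau> t = t powr (- 1 / (\<sigma> * (1 + \<alpha>)))" for t :: real
    obtain C1 where C1: "0 \<le> C1" "\<forall>\<^sub>F t in at_top. L.Y t - e \<le> C1 * \<tau> t"
      using L.foot_rate[OF Y1 k \<sigma> lower1 Lr] unfolding \<tau>_def by auto
    obtain C2 where C2: "0 \<le> C2" "\<forall>\<^sub>F t in at_top. R.Y t - - h \<le> C2 * \<tau> t"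
      using R.foot_rate[OF Y2 k \<sigma> lower2 Rr] unfolding \<tau>_def by auto
    define D where "D = (C1 powr q + C2 powr q) powr (1 / q)"
    show ?thesis
    proof (rule bigoI[where c = "(h - e) powr (1 / q) * D"])
      show "\<forall>\<^sub>F t in at_top. norm (N t) \<le> (h - e) powr (1 / q) * D * norm (t powr (-1 - 1 / (\<sigma> * (1 + \<alpha>))))"
        using N_le C1(2) C2(2) eventually_gt_at_top[of 0]
      proof eventually_elim
        case (elim t)
        have \<tau>: "0 \<le> \<tau> t" by (simp add: \<tau>_def)
        have "eps_gap f \<phi> e h X q t \<le> ((C1 * \<tau> t) powr q + (C2 * \<tau> t) powr q) powr (1 / q)"
          unfolding eps using elim eps_nonneg[OF elim(4)] q
          by (intro powr_mono2 add_mono) (auto simp: \<epsilon>1_def \<epsilon>2_def)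
        also have "(C1 * \<tau> t) powr q + (C2 * \<tau> t) powr q = (C1 powr q + C2 powr q) * \<tau> t powr q"
          by (simp add: powr_mult distrib_right)
        also have "\<dots> powr (1 / q) = D * \<tau> t"
          using q \<tau> by (simp add: powr_mult powr_powr D_def)
        finally have e_le: "eps_gap f \<phi> e h X q t \<le> D * \<tau> t" .
        have m_le: "m t powr (1 / q) \<le> (h - e) powr (1 / q)"
          using in_gap[OF elim(4)] q by (intro powr_mono2) (auto simp: m_def \<xi>_def)
        have "0 \<le> N t" by (simp add: N_def Lq_norm_def)
        then have "norm (N t) \<le> m t powr (1 / q) * eps_gap f \<phi> e h X q t * t powr (-1)"
          using elim by simp
        also have "\<dots> \<le> (h - e) powr (1 / q) * (D * \<tau> t) * t powr (-1)"
          using e_le m_le by (intro mult_right_mono mult_mono) (auto simp: eps)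
        also have "\<dots> = (h - e) powr (1 / q) * D * t powr (-1 - 1 / (\<sigma> * (1 + \<alpha>)))"
        proof -
          have "\<tau> t * t powr (-1) = t powr (-1 - 1 / (\<sigma> * (1 + \<alpha>)))"
            unfolding \<tau>_def powr_add[symmetric] by (simp add: add.commute)
          then show ?thesis by (simp only: mult.assoc)
        qed
        finally show ?case by simp
      qed
    qed
  qed
qed

lemma right_estimates:
  fixes f \<phi> X :: "real \<Rightarrow> real" and w :: "real \<Rightarrow> real \<Rightarrow> real"
  assumes f: "flux f" and \<phi>: "in_Linf \<phi>" and p: "1 \<le> p" and q: "0 < q"
    and exponent: "flux_exponent f r \<alpha>"
    and C: "\<forall>y\<ge>0. \<bar>Phi \<phi> y - r * y\<bar> \<le> C * \<bar>y\<bar> powr (1 - 1 / p)"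
    and sup: "supported_at (Phi \<phi>) e r" and pos: "\<forall>y>e. Phi \<phi> e + r * (y - e) < Phi \<phi> y"
    and X: "fwd_char f \<phi> X" and X_gt: "\<forall>t>0. e + t * deriv f r < X t"
    and w: "\<forall>t>0. \<forall>x. e + t * deriv f r < x \<and> x < X t \<longrightarrow> w x t = inv (deriv f) ((x - e) / t)"
  defines "N \<equiv> \<lambda>t. Lq_norm q {e + t * deriv f r..X t} (speed_diff f \<phi> w t)"
  shows "\<forall>\<^sub>F t in at_top. in_Lq q {e + t * deriv f r..X t} (speed_diff f \<phi> w t)"
    and "N \<in> O(\<lambda>t. (y_left f \<phi> X t - e) * t powr (-1 + (p / q) / (p + 1 + \<alpha>)))"
    and "0 < \<sigma> \<Longrightarrow> 0 < k \<Longrightarrow>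
      \<forall>\<^sub>F x in at_right e. (LINT \<xi>=e..x|lebesgue. (\<phi> \<xi> - r)) \<ge> k * \<bar>x - e\<bar> powr (1 + \<sigma>) \<Longrightarrow>
      N \<in> O(\<lambda>t. t powr (-1 + (p / q) / (p + 1 + \<alpha>) - (1 / \<sigma>) / (p + 1 + \<alpha>)))"
proof -
  define P where "P = Phi \<phi>"
  define V where "V t = u_left f \<phi> (X t) t" for t
  obtain M where lip: "M-lipschitz_on UNIV P" using Phi_lipschitz[OF \<phi>] unfolding P_def .
  note nb = fwd_char_nested_backward(1)[OF f \<phi> X, folded P_def V_def]
  have L: "right_of_divide f P e r \<alpha> X V"
    by unfold_locales (use f sup exponent nb X_gt in \<open>auto simp: P_def\<close>)
  interpret L: right_of_divide f P e r \<alpha> X V "\<lambda>t. (X t - e - t * deriv f r) / t" by (fact L)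
  note rates = L.unbounded_rates[OF lip p q C[folded P_def] pos[folded P_def]]
  have LY: "L.Y t = y_left f \<phi> X t" for t by (simp add: L.Y_def y_left_def V_def)
  have "\<forall>\<^sub>F t in at_top. in_Lq q {e + t * deriv f r..X t} (speed_diff f \<phi> w t) \<and>
      \<bar>N t\<bar> \<le> (L.Y t - e) / t * (X t - e - t * deriv f r) powr (1 / q)"
    using speed_diff_right_of_divide[OF \<phi> L[unfolded P_def] rates(1) w] eventually_gt_at_top[of 0]
  proof eventually_elim
    case (elim t)
    note [measurable] = borel_measurable_entropy_speed[OF f \<phi> elim(2)]
    have meas: "(\<lambda>x. deriv f (entropy_solution f \<phi> x t) - (x - e) / t) \<in> borel_measurable borel"
      by measurable
    have l: "speed_diff f \<phi> w t x = deriv f (entropy_solution f \<phi> x t) - (x - e) / t"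
      "\<bar>speed_diff f \<phi> w t x\<bar> \<le> (L.Y t - e) / t" if "e + t * deriv f r < x" "x < X t" for x
      using elim(1) that by (auto simp: L.Y_def)
    have nn: "0 \<le> (L.Y t - e) / t" using L.Y_ge[OF elim(2)] elim(2) by simp
    note bound = Lq_norm_bound[OF less_imp_le[OF X_gt[rule_format, OF elim(2)]] q nn meas l]
    have "0 \<le> N t" by (simp add: N_def Lq_norm_def)
    then show ?case using bound by (simp add: N_def diff_diff_eq)
  qed
  then have N: "\<forall>\<^sub>F t in at_top. \<bar>N t\<bar> \<le> (L.Y t - e) / t * (X t - e - t * deriv f r) powr (1 / q)"
    and Lq: "\<forall>\<^sub>F t in at_top. in_Lq q {e + t * deriv f r..X t} (speed_diff f \<phi> w t)"
    by (auto elim: eventually_mono)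
  show "\<forall>\<^sub>F t in at_top. in_Lq q {e + t * deriv f r..X t} (speed_diff f \<phi> w t)" by (fact Lq)
  show "N \<in> O(\<lambda>t. (y_left f \<phi> X t - e) * t powr (-1 + (p / q) / (p + 1 + \<alpha>)))"
    using rates(2)[OF N] unfolding LY .
  show "N \<in> O(\<lambda>t. t powr (-1 + (p / q) / (p + 1 + \<alpha>) - (1 / \<sigma>) / (p + 1 + \<alpha>)))"
    if "0 < \<sigma>" "0 < k"
      and "\<forall>\<^sub>F x in at_right e. (LINT \<xi>=e..x|lebesgue. (\<phi> \<xi> - r)) \<ge> k * \<bar>x - e\<bar> powr (1 + \<sigma>)"
    using rates(3)[OF N that(1,2)] that(3)
    unfolding interval_LINT_Phi[OF \<phi>, folded P_def] L.excess_def by (simp add: diff_diff_eq)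
qed

text \<open>Reflection acts on \<open>f\<close> and on the primitive only; datum and N-wave stay as
  they are, and the reflected quantities are translated back through \<open>RY\<close>,
  \<open>RX\<close> and \<open>Rexc\<close>.\<close>

lemma left_estimates:
  fixes f \<phi> X :: "real \<Rightarrow> real" and w :: "real \<Rightarrow> real \<Rightarrow> real"
  assumes f: "flux f" and \<phi>: "in_Linf \<phi>" and p: "1 \<le> p" and q: "0 < q"
    and exponent: "flux_exponent f l \<alpha>"
    and C: "\<forall>y\<le>0. \<bar>Phi \<phi> y - l * y\<bar> \<le> C * \<bar>y\<bar> powr (1 - 1 / p)"
    and sup: "supported_at (Phi \<phi>) h l" and pos: "\<forall>y<h. Phi \<phi> h + l * (y - h) < Phi \<phi> y"
    and X: "fwd_char f \<phi> X" and X_lt: "\<forall>t>0. X t < h + t * deriv f l"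
    and w: "\<forall>t>0. \<forall>x. X t < x \<and> x < h + t * deriv f l \<longrightarrow> w x t = inv (deriv f) ((x - h) / t)"
  defines "N \<equiv> \<lambda>t. Lq_norm q {X t..h + t * deriv f l} (speed_diff f \<phi> w t)"
  shows "\<forall>\<^sub>F t in at_top. in_Lq q {X t..h + t * deriv f l} (speed_diff f \<phi> w t)"
    and "N \<in> O(\<lambda>t. (h - y_right f \<phi> X t) * t powr (-1 + (p / q) / (p + 1 + \<alpha>)))"
    and "0 < \<sigma> \<Longrightarrow> 0 < k \<Longrightarrow>
      \<forall>\<^sub>F x in at_left h. (LINT \<xi>=h..x|lebesgue. (\<phi> \<xi> - l)) \<ge> k * \<bar>x - h\<bar> powr (1 + \<sigma>) \<Longrightarrow>
      N \<in> O(\<lambda>t. t powr (-1 + (p / q) / (p + 1 + \<alpha>) - (1 / \<sigma>) / (p + 1 + \<alpha>)))"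
proof -
  define P where "P = Phi \<phi>"
  define V where "V t = u_right f \<phi> (X t) t" for t
  obtain M where lip: "M-lipschitz_on UNIV P" using Phi_lipschitz[OF \<phi>] unfolding P_def .
  have lip': "M-lipschitz_on UNIV (\<lambda>y. P (- y))"
  proof (rule lipschitz_onI)
    fix x y :: real
    show "dist (P (- x)) (P (- y)) \<le> M * dist x y"
      using lipschitz_onD[OF lip, of "- x" "- y"] by (simp add: dist_real_def abs_minus_commute)
  qed (use lip in \<open>simp add: lipschitz_on_def\<close>)
  note nb = fwd_char_nested_backward(2)[OF f \<phi> X, folded P_def V_def]
  note d = deriv_reflect(1)[OF f]
  have "- h - t * deriv f l < - X t" if "0 < t" for t
    using X_lt[rule_format, OF that] by simp
  then have R: "right_of_divide (\<lambda>v. f (- v)) (\<lambda>y. P (- y)) (- h) (- l) \<alpha> (\<lambda>t. - X t) (\<lambda>t. - V t)"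
    by unfold_locales
       (use sup nb flux_exponent_reflect[OF f exponent] in
         \<open>auto simp: flux_reflect[OF f] supported_at_reflect d P_def\<close>)
  interpret R: right_of_divide "\<lambda>v. f (- v)" "\<lambda>y. P (- y)" "- h" "- l" \<alpha> "\<lambda>t. - X t" "\<lambda>t. - V t"
    "\<lambda>t. (- X t - - h - t * deriv (\<lambda>v. f (- v)) (- l)) / t" by (fact R)
  have C': "\<forall>y\<ge>0. \<bar>P (- y) - (- l) * y\<bar> \<le> C * \<bar>y\<bar> powr (1 - 1 / p)"
  proof (intro allI impI)
    fix y :: real assume "0 \<le> y"
    then show "\<bar>P (- y) - (- l) * y\<bar> \<le> C * \<bar>y\<bar> powr (1 - 1 / p)"
      using C[rule_format, of "- y"] by (simp add: P_def)
  qed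
  have pos': "\<forall>y>- h. P (- (- h)) + (- l) * (y - - h) < P (- y)"
  proof (intro allI impI)
    fix y assume "- h < y"
    then show "P (- (- h)) + (- l) * (y - - h) < P (- y)"
      using pos[rule_format, of "- y"] by (simp add: P_def algebra_simps)
  qed
  note rates = R.unbounded_rates[OF lip' p q C' pos']
  have RY: "R.Y t - - h = h - y_right f \<phi> X t" for t
    unfolding R.Y_def unfolding y_right_def V_def d by simp
  have RX: "- X t - - h - t * deriv (\<lambda>v. f (- v)) (- l) = h + t * deriv f l - X t" for t
    by (simp add: d)
  have Rexc: "R.excess (- y) = P y - (P h + l * (y - h))" for y
    by (simp add: R.excess_def algebra_simps)
  have "\<forall>\<^sub>F t in at_top. in_Lq q {X t..h + t * deriv f l} (speed_diff f \<phi> w t) \<and>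
      \<bar>N t\<bar> \<le> (R.Y t - - h) / t * (- X t - - h - t * deriv (\<lambda>v. f (- v)) (- l)) powr (1 / q)"
    using speed_diff_left_of_divide[OF f \<phi> R[unfolded P_def] rates(1) w] eventually_gt_at_top[of 0]
  proof eventually_elim
    case (elim t)
    note [measurable] = borel_measurable_entropy_speed[OF f \<phi> elim(2)]
    have meas: "(\<lambda>x. deriv f (entropy_solution f \<phi> x t) - (x - h) / t) \<in> borel_measurable borel"
      by measurable
    have l: "speed_diff f \<phi> w t x = deriv f (entropy_solution f \<phi> x t) - (x - h) / t"
      "\<bar>speed_diff f \<phi> w t x\<bar> \<le> (R.Y t - - h) / t" if "X t < x" "x < h + t * deriv f l" for x
      using elim(1) that unfolding RY unfolding y_right_def V_def by auto
    have nn: "0 \<le> (R.Y t - - h) / t" using R.Y_ge[OF elim(2)] elim(2) by simp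
    note bound = Lq_norm_bound[OF less_imp_le[OF X_lt[rule_format, OF elim(2)]] q nn meas l]
    have "0 \<le> N t" by (simp add: N_def Lq_norm_def)
    then show ?case unfolding RX using bound by (simp add: N_def)
  qed
  then have N: "\<forall>\<^sub>F t in at_top. \<bar>N t\<bar> \<le>
        (R.Y t - - h) / t * (- X t - - h - t * deriv (\<lambda>v. f (- v)) (- l)) powr (1 / q)"
    and Lq: "\<forall>\<^sub>F t in at_top. in_Lq q {X t..h + t * deriv f l} (speed_diff f \<phi> w t)"
    by (auto elim: eventually_mono)
  show "\<forall>\<^sub>F t in at_top. in_Lq q {X t..h + t * deriv f l} (speed_diff f \<phi> w t)" by (fact Lq)
  show "N \<in> O(\<lambda>t. (h - y_right f \<phi> X t) * t powr (-1 + (p / q) / (p + 1 + \<alpha>)))"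
    using rates(2)[OF N] unfolding RY .
  show "N \<in> O(\<lambda>t. t powr (-1 + (p / q) / (p + 1 + \<alpha>) - (1 / \<sigma>) / (p + 1 + \<alpha>)))"
    if "0 < \<sigma>" "0 < k"
      and lh: "\<forall>\<^sub>F x in at_left h. (LINT \<xi>=h..x|lebesgue. (\<phi> \<xi> - l)) \<ge> k * \<bar>x - h\<bar> powr (1 + \<sigma>)"
  proof (rule rates(3)[OF N that(1,2)])
    have "\<forall>\<^sub>F x in at_left h. k * \<bar>x - h\<bar> powr (1 + \<sigma>) \<le> R.excess (- x)"
      using lh unfolding interval_LINT_Phi[OF \<phi>, folded P_def] Rexc by (simp add: algebra_simps)
    then show "\<forall>\<^sub>F y in at_right (- h). k * \<bar>y - - h\<bar> powr (1 + \<sigma>) \<le> R.excess y"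
      unfolding eventually_at_left_to_right[of _ h] by (simp add: abs_minus_commute add.commute)
  qed
qed

theorem lemma7p8:
  fixes f \<phi> :: "real \<Rightarrow> real" and p :: real
    and X :: "real \<Rightarrow> real \<Rightarrow> real \<Rightarrow> real" and Xr Xl :: "real \<Rightarrow> real"
    and w :: "real \<Rightarrow> real \<Rightarrow> real"
  assumes flux: "flux f"
    and bounded_data: "in_Linf \<phi>"
    and states: "ul_bar \<phi> < ur_bar \<phi> \<or> ul_bar \<phi> = ur_bar \<phi> \<and> K0 \<phi> \<noteq> {}"
    and p: "1 \<le> p"
    and Lp_right: "in_Lq p {0..} (\<lambda>x. \<phi> x - ur_bar \<phi>)"
    and Lp_left: "in_Lq p {..0} (\<lambda>x. \<phi> x - ul_bar \<phi>)"
    and wave: "generalized_N_wave f \<phi> X Xr Xl w"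
  shows
    "(\<forall>(x, t) \<in> divides f \<phi>. entropy_solution f \<phi> x t = w x t)
     \<and>
     (\<forall>e h \<alpha> q. gap \<phi> e h \<and> flux_exponent f (gap_c \<phi> e h) \<alpha> \<and> 0 < q \<longrightarrow>
        (\<forall>\<^sub>F t in at_top. in_Lq q {e_line f \<phi> e h t..h_line f \<phi> e h t} (speed_diff f \<phi> w t)) \<and>
        lessapprox
          (\<lambda>t. Lq_norm q {e_line f \<phi> e h t..h_line f \<phi> e h t} (speed_diff f \<phi> w t))
          (\<lambda>t. ((h - e) / 2) powr (1 / q) * eps_gap f \<phi> e h (X e h) q t * t powr (-1)) \<and>
        (\<forall>\<sigma>>0. \<forall>k>0.
           (\<forall>\<^sub>F x in at_right e.
              (LINT \<xi>=e..x|lebesgue. (\<phi> \<xi> - gap_c \<phi> e h)) \<ge> k * \<bar>x - e\<bar> powr (1 + \<sigma>)) \<and>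
           (\<forall>\<^sub>F x in at_left h.
              (LINT \<xi>=h..x|lebesgue. (\<phi> \<xi> - gap_c \<phi> e h)) \<ge> k * \<bar>x - h\<bar> powr (1 + \<sigma>)) \<longrightarrow>
           (\<lambda>t. Lq_norm q {e_line f \<phi> e h t..h_line f \<phi> e h t} (speed_diff f \<phi> w t))
             \<in> O[at_top](\<lambda>t. t powr (-1 - 1 / (\<sigma> * (1 + \<alpha>))))))
     \<and>
     (\<forall>\<alpha> q. bdd_above (K0 \<phi>) \<and> flux_exponent f (ur_bar \<phi>) \<alpha> \<and> p / (p + 1 + \<alpha>) < q \<longrightarrow>
        (\<forall>\<^sub>F t in at_top. in_Lq q {x0_plus_line f \<phi> t..Xr t} (speed_diff f \<phi> w t)) \<and>
        (\<lambda>t. Lq_norm q {x0_plus_line f \<phi> t..Xr t} (speed_diff f \<phi> w t))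
          \<in> O[at_top](\<lambda>t. eps_r f \<phi> Xr t * t powr (-1 + (p / q) / (p + 1 + \<alpha>))) \<and>
        (\<forall>\<sigma>>0. \<forall>k>0.
           (\<forall>\<^sub>F x in at_right (x0_plus \<phi>).
              (LINT \<xi>=x0_plus \<phi>..x|lebesgue. (\<phi> \<xi> - ur_bar \<phi>))
                \<ge> k * \<bar>x - x0_plus \<phi>\<bar> powr (1 + \<sigma>)) \<longrightarrow>
           (\<lambda>t. Lq_norm q {x0_plus_line f \<phi> t..Xr t} (speed_diff f \<phi> w t))
             \<in> O[at_top](\<lambda>t. t powr (-1 + (p / q) / (p + 1 + \<alpha>) - (1 / \<sigma>) / (p + 1 + \<alpha>)))))
     \<and>
     (\<forall>\<alpha> q. bdd_below (K0 \<phi>) \<and> flux_exponent f (ul_bar \<phi>) \<alpha> \<and> p / (p + 1 + \<alpha>) < q \<longrightarrow>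
        (\<forall>\<^sub>F t in at_top. in_Lq q {Xl t..x0_minus_line f \<phi> t} (speed_diff f \<phi> w t)) \<and>
        (\<lambda>t. Lq_norm q {Xl t..x0_minus_line f \<phi> t} (speed_diff f \<phi> w t))
          \<in> O[at_top](\<lambda>t. eps_l f \<phi> Xl t * t powr (-1 + (p / q) / (p + 1 + \<alpha>))) \<and>
        (\<forall>\<sigma>>0. \<forall>k>0.
           (\<forall>\<^sub>F x in at_left (x0_minus \<phi>).
              (LINT \<xi>=x0_minus \<phi>..x|lebesgue. (\<phi> \<xi> - ul_bar \<phi>))
                \<ge> k * \<bar>x - x0_minus \<phi>\<bar> powr (1 + \<sigma>)) \<longrightarrow>
           (\<lambda>t. Lq_norm q {Xl t..x0_minus_line f \<phi> t} (speed_diff f \<phi> w t))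
             \<in> O[at_top](\<lambda>t. t powr (-1 + (p / q) / (p + 1 + \<alpha>) - (1 / \<sigma>) / (p + 1 + \<alpha>)))))"
proof -
  note wave_divides = wave[unfolded generalized_N_wave_def, THEN conjunct1, rule_format]
  note wave_gap = wave[unfolded generalized_N_wave_def, THEN conjunct2, THEN conjunct1, rule_format]
  note wave_right = wave[unfolded generalized_N_wave_def, THEN conjunct2, THEN conjunct2, THEN conjunct1, THEN mp]
  note wave_left = wave[unfolded generalized_N_wave_def, THEN conjunct2, THEN conjunct2, THEN conjunct2, THEN mp]
  obtain M where lip: "M-lipschitz_on UNIV (Phi \<phi>)" using Phi_lipschitz[OF bounded_data] .
  have cont: "continuous_on UNIV (Phi \<phi>)" by (rule lipschitz_on_continuous_on[OF lip])
  have cont': "continuous_on UNIV (\<lambda>y. Phi \<phi> (- y))"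
    by (intro continuous_on_compose2[OF cont] continuous_intros) auto
  note K0 = K0_eq_supported_points[OF bounded_data]
  obtain Cr where Cr: "\<And>y. y \<in> {0..} \<Longrightarrow> \<bar>Phi \<phi> y - ur_bar \<phi> * y\<bar> \<le> Cr * \<bar>y\<bar> powr (1 - 1 / p)"
    using Phi_Lp_growth[OF bounded_data p Lp_right] by blast
  then have Cr': "\<forall>y\<ge>0. \<bar>Phi \<phi> y - ur_bar \<phi> * y\<bar> \<le> Cr * \<bar>y\<bar> powr (1 - 1 / p)"
    by simp
  obtain Cl where Cl: "\<And>y. y \<in> {..0} \<Longrightarrow> \<bar>Phi \<phi> y - ul_bar \<phi> * y\<bar> \<le> Cl * \<bar>y\<bar> powr (1 - 1 / p)"
    using Phi_Lp_growth[OF bounded_data p Lp_left] by blast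
  then have Cl': "\<forall>y\<le>0. \<bar>Phi \<phi> y - ul_bar \<phi> * y\<bar> \<le> Cl * \<bar>y\<bar> powr (1 - 1 / p)"
    by simp
  have Cl'': "\<forall>y\<ge>0. \<bar>Phi \<phi> (- y) - (- ul_bar \<phi>) * y\<bar> \<le> Cl * \<bar>y\<bar> powr (1 - 1 / p)"
  proof (intro allI impI)
    fix y :: real assume "0 \<le> y"
    then show "\<bar>Phi \<phi> (- y) - (- ul_bar \<phi>) * y\<bar> \<le> Cl * \<bar>y\<bar> powr (1 - 1 / p)"
      using Cl'[rule_format, of "- y"] by simp
  qed
  note lim_r = growth_tendsto[OF p Cr'] and lim_l = growth_tendsto[OF p Cl'']
  \<comment> \<open>If the asymptotic states are strictly ordered, a contact point exists by
    tilting; if they coincide, the hypothesis on \<open>K0\<close> supplies it.\<close>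
  have ne: "\<exists>x m. supported_at (Phi \<phi>) x m"
    using states ex_supported_at[OF cont _ lim_r lim_l] by (auto simp: K0)
  \<comment> \<open>On a divide \<open>c\<close> is the only maximizer and
    \<open>(x - x0) / t\<close> is exactly \<open>f' c\<close>, so \<open>inv f'\<close> returns
    \<open>c\<close> at every positive time.\<close>
  have divides: "entropy_solution f \<phi> x t = w x t" if xt: "(x, t) \<in> divides f \<phi>" for x t
  proof -
    obtain c x0 where c: "is_divide f \<phi> c x0" "(x, t) \<in> char_line f c x0"
      using xt unfolding divides_def by blast
    then have "maximizers f \<phi> x t = {c}" by (auto simp: is_divide_def)
    then have "entropy_solution f \<phi> x t = c" by (simp add: entropy_solution_def)
    moreover have "w x t = inv (deriv f) ((x - x0) / t)"
      using c by (intro wave_divides conjI)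
    moreover have "(x - x0) / t = deriv f c" using c(2) by (auto simp: char_line_def)
    ultimately show "entropy_solution f \<phi> x t = w x t" by (simp add: inv_deriv_flux[OF flux])
  qed
  have q_pos: "0 < q" if "p / (p + 1 + \<alpha>) < q" "flux_exponent f c \<alpha>" for q c \<alpha>
  proof -
    have "0 \<le> p / (p + 1 + \<alpha>)" using p that(2) by (simp add: flux_exponent_def)
    with that(1) show ?thesis by simp
  qed
  have right: "supported_at (Phi \<phi>) (x0_plus \<phi>) (ur_bar \<phi>)"
    "\<forall>y>x0_plus \<phi>. Phi \<phi> (x0_plus \<phi>) + ur_bar \<phi> * (y - x0_plus \<phi>) < Phi \<phi> y"
    "fwd_char f \<phi> Xr" "\<forall>t>0. x0_plus \<phi> + t * deriv f (ur_bar \<phi>) < Xr t"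
    "\<forall>t>0. \<forall>x. x0_plus \<phi> + t * deriv f (ur_bar \<phi>) < x \<and> x < Xr t \<longrightarrow>
      w x t = inv (deriv f) ((x - x0_plus \<phi>) / t)"
    if "bdd_above (K0 \<phi>)"
  proof -
    note S = Sup_supported_points[OF cont lim_r ne that[unfolded K0], folded K0 x0_plus_def]
    show "supported_at (Phi \<phi>) (x0_plus \<phi>) (ur_bar \<phi>)"
      "\<forall>y>x0_plus \<phi>. Phi \<phi> (x0_plus \<phi>) + ur_bar \<phi> * (y - x0_plus \<phi>) < Phi \<phi> y"
      using S by simp_all
    show "fwd_char f \<phi> Xr" "\<forall>t>0. x0_plus \<phi> + t * deriv f (ur_bar \<phi>) < Xr t"
      "\<forall>t>0. \<forall>x. x0_plus \<phi> + t * deriv f (ur_bar \<phi>) < x \<and> x < Xr t \<longrightarrow>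
        w x t = inv (deriv f) ((x - x0_plus \<phi>) / t)"
      using wave_right[OF that] by (auto simp: fwd_char_in_def H_right_def x0_plus_line_def)
  qed
  have left: "supported_at (Phi \<phi>) (x0_minus \<phi>) (ul_bar \<phi>)"
    "\<forall>y<x0_minus \<phi>. Phi \<phi> (x0_minus \<phi>) + ul_bar \<phi> * (y - x0_minus \<phi>) < Phi \<phi> y"
    "fwd_char f \<phi> Xl" "\<forall>t>0. Xl t < x0_minus \<phi> + t * deriv f (ul_bar \<phi>)"
    "\<forall>t>0. \<forall>x. Xl t < x \<and> x < x0_minus \<phi> + t * deriv f (ul_bar \<phi>) \<longrightarrow>
      w x t = inv (deriv f) ((x - x0_minus \<phi>) / t)"
    if bdd: "bdd_below (K0 \<phi>)"
  proof -
    \<comment> \<open>The contact set of the reflected primitive is the negative of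
      \<open>K0\<close>, so its last point is \<open>- x0_minus \<phi>\<close>, with slope
      \<open>- ul_bar \<phi>\<close>.\<close>
    have refl: "{x. \<exists>m. supported_at (\<lambda>y. Phi \<phi> (- y)) x m} = uminus ` K0 \<phi>"
    proof -
      have "(\<exists>m. supported_at (\<lambda>y. Phi \<phi> (- y)) x m) \<longleftrightarrow> - x \<in> K0 \<phi>" for x
        unfolding K0 supported_at_reflect mem_Collect_eq by (metis minus_minus)
      then show ?thesis unfolding set_eq_iff image_iff mem_Collect_eq by (metis minus_minus)
    qed
    have ne': "\<exists>x m. supported_at (\<lambda>y. Phi \<phi> (- y)) x m"
      using ne unfolding supported_at_reflect by (metis minus_minus)
    have "bdd_above (uminus ` K0 \<phi>)" using bdd by simp
    note S = Sup_supported_points[OF cont' lim_l ne', unfolded refl, OF this]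
    have x0: "Sup (uminus ` K0 \<phi>) = - x0_minus \<phi>" by (simp add: x0_minus_def Inf_real_def)
    show "supported_at (Phi \<phi>) (x0_minus \<phi>) (ul_bar \<phi>)"
      using S(1) by (simp add: x0 supported_at_reflect)
    show "\<forall>y<x0_minus \<phi>. Phi \<phi> (x0_minus \<phi>) + ul_bar \<phi> * (y - x0_minus \<phi>) < Phi \<phi> y"
    proof (intro allI impI)
      fix y assume "y < x0_minus \<phi>"
      then show "Phi \<phi> (x0_minus \<phi>) + ul_bar \<phi> * (y - x0_minus \<phi>) < Phi \<phi> y"
        using S(2)[of "- y"] by (simp add: x0 algebra_simps)
    qed
    show "fwd_char f \<phi> Xl" "\<forall>t>0. Xl t < x0_minus \<phi> + t * deriv f (ul_bar \<phi>)"
      "\<forall>t>0. \<forall>x. Xl t < x \<and> x < x0_minus \<phi> + t * deriv f (ul_bar \<phi>) \<longrightarrow>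
        w x t = inv (deriv f) ((x - x0_minus \<phi>) / t)"
      using wave_left[OF bdd] by (auto simp: fwd_char_in_def H_left_def x0_minus_line_def)
  qed
  show ?thesis
  proof (intro conjI allI impI ballI; (elim conjE)?)
    fix z assume "z \<in> divides f \<phi>"
    then show "case z of (x, t) \<Rightarrow> entropy_solution f \<phi> x t = w x t"
      using divides by auto
  next
    fix e h \<alpha> q :: real assume gap: "gap \<phi> e h" and \<alpha>: "flux_exponent f (gap_c \<phi> e h) \<alpha>" and q: "0 < q"
    have X: "fwd_char_in f \<phi> (H_gap f \<phi> e h) (X e h)"
      and wl: "\<forall>t>0. \<forall>x. e_line f \<phi> e h t < x \<and> x < X e h t \<longrightarrow> w x t = inv (deriv f) ((x - e) / t)"
      and wr: "\<forall>t>0. \<forall>x. X e h t < x \<and> x < h_line f \<phi> e h t \<longrightarrow> w x t = inv (deriv f) ((x - h) / t)"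
      using wave_gap[OF gap] by auto
    note est = gap_estimates[OF flux bounded_data gap \<alpha> q X wl wr]
    show "\<forall>\<^sub>F t in at_top. in_Lq q {e_line f \<phi> e h t..h_line f \<phi> e h t} (speed_diff f \<phi> w t)"
      by (rule est(1))
    show "lessapprox (\<lambda>t. Lq_norm q {e_line f \<phi> e h t..h_line f \<phi> e h t} (speed_diff f \<phi> w t))
        (\<lambda>t. ((h - e) / 2) powr (1 / q) * eps_gap f \<phi> e h (X e h) q t * t powr (-1))"
      by (rule est(2))
    show "(\<lambda>t. Lq_norm q {e_line f \<phi> e h t..h_line f \<phi> e h t} (speed_diff f \<phi> w t))
        \<in> O[at_top](\<lambda>t. t powr (-1 - 1 / (\<sigma> * (1 + \<alpha>))))"
      if "0 < \<sigma>" "0 < k"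
        "\<forall>\<^sub>F x in at_right e. (LINT \<xi>=e..x|lebesgue. (\<phi> \<xi> - gap_c \<phi> e h)) \<ge> k * \<bar>x - e\<bar> powr (1 + \<sigma>)"
        "\<forall>\<^sub>F x in at_left h. (LINT \<xi>=h..x|lebesgue. (\<phi> \<xi> - gap_c \<phi> e h)) \<ge> k * \<bar>x - h\<bar> powr (1 + \<sigma>)"
      for \<sigma> k
      by (rule est(3)[OF that])
  next
    fix \<alpha> q assume bdd: "bdd_above (K0 \<phi>)" and \<alpha>: "flux_exponent f (ur_bar \<phi>) \<alpha>"
      and q: "p / (p + 1 + \<alpha>) < q"
    note est = right_estimates[OF flux bounded_data p q_pos[OF q \<alpha>] \<alpha> Cr' right[OF bdd],
        folded x0_plus_line_def eps_r_def]
    show "\<forall>\<^sub>F t in at_top. in_Lq q {x0_plus_line f \<phi> t..Xr t} (speed_diff f \<phi> w t)"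
      by (rule est(1))
    show "(\<lambda>t. Lq_norm q {x0_plus_line f \<phi> t..Xr t} (speed_diff f \<phi> w t))
        \<in> O[at_top](\<lambda>t. eps_r f \<phi> Xr t * t powr (-1 + (p / q) / (p + 1 + \<alpha>)))"
      by (rule est(2))
    show "(\<lambda>t. Lq_norm q {x0_plus_line f \<phi> t..Xr t} (speed_diff f \<phi> w t))
        \<in> O[at_top](\<lambda>t. t powr (-1 + (p / q) / (p + 1 + \<alpha>) - (1 / \<sigma>) / (p + 1 + \<alpha>)))"
      if "0 < \<sigma>" "0 < k"
        "\<forall>\<^sub>F x in at_right (x0_plus \<phi>). (LINT \<xi>=x0_plus \<phi>..x|lebesgue. (\<phi> \<xi> - ur_bar \<phi>))
          \<ge> k * \<bar>x - x0_plus \<phi>\<bar> powr (1 + \<sigma>)"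
      for \<sigma> k
      by (rule est(3)[OF that])
  next
    fix \<alpha> q assume bdd: "bdd_below (K0 \<phi>)" and \<alpha>: "flux_exponent f (ul_bar \<phi>) \<alpha>"
      and q: "p / (p + 1 + \<alpha>) < q"
    note est = left_estimates[OF flux bounded_data p q_pos[OF q \<alpha>] \<alpha> Cl' left[OF bdd],
        folded x0_minus_line_def eps_l_def]
    show "\<forall>\<^sub>F t in at_top. in_Lq q {Xl t..x0_minus_line f \<phi> t} (speed_diff f \<phi> w t)"
      by (rule est(1))
    show "(\<lambda>t. Lq_norm q {Xl t..x0_minus_line f \<phi> t} (speed_diff f \<phi> w t))
        \<in> O[at_top](\<lambda>t. eps_l f \<phi> Xl t * t powr (-1 + (p / q) / (p + 1 + \<alpha>)))"
      by (rule est(2))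
    show "(\<lambda>t. Lq_norm q {Xl t..x0_minus_line f \<phi> t} (speed_diff f \<phi> w t))
        \<in> O[at_top](\<lambda>t. t powr (-1 + (p / q) / (p + 1 + \<alpha>) - (1 / \<sigma>) / (p + 1 + \<alpha>)))"
      if "0 < \<sigma>" "0 < k"
        "\<forall>\<^sub>F x in at_left (x0_minus \<phi>). (LINT \<xi>=x0_minus \<phi>..x|lebesgue. (\<phi> \<xi> - ul_bar \<phi>))
          \<ge> k * \<bar>x - x0_minus \<phi>\<bar> powr (1 + \<sigma>)"
      for \<sigma> k
      by (rule est(3)[OF that])
  qed
qed

end
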